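(* Let $Y=(U,V)\in\mathcal{L}^2(\Omega,\mathcal{F},\mathbb{P})$ and suppose that the law of $Y$ is $\mathcal{D}$-regular. Then an equilibrium $(Q,f)$ exists. If, in addition, the laws of $U$ and $V$ are atomless, then the insider's order $Q$, the total order $R=Q+U$ and the price $S=f(R)$ are unique (the same for all equilibria); moreover, $X=(R,S)$ is the unique optimal map (minimizer of $\mathbb{E}[c(X,Y)]$ over $\mathcal{X}(Y)$) and $\gamma=\operatorname{Law}(X,Y)$ is the unique optimal plan (minimizer of $\int c\,d\gamma$ over $\Gamma(\operatorname{Law}(Y))$).
   Context: $c(x,y)=(x_1-y_1)(x_2-y_2)$ for $x,y\in\mathbb{R}^2$. For $\nu$ a Borel probability measure on $\mathbb{R}^2$ with finite second moment, $\Gamma(\nu)$ is the set of Borel probability measures $\gamma$ on $\mathbb{R}^2\times\mathbb{R}^2$ (points $(x,y)$) with finite second moment, $y$-marginal $\nu$ and $\gamma(y|x)=x$ (conditional expectation of $y$ given $x$ equals $x$, $\gamma$-a.s.). $\mathcal{X}(Y)$: two-dimensional $Y$-measurable $X\in\mathcal{L}^2$ with $\mathbb{E}[Y|X]=X$. $\mathcal{D}$: family of graphs of strictly decreasing functions $f$ on closed intervals of $\mathbb{R}$ (possibly a single point) with $\frac1K(t-s)\le f(s)-f(t)\le K(t-s)$ for $s<t$, some $K>0$; a Borel probability measure $\mu$ on $\mathbb{R}^2$ is $\mathcal{D}$-regular if $\mu(D)=0$ for all $D\in\mathcal{D}$. $\overline{\mathbb{R}}=\mathbb{R}\cup\{\pm\infty\}$.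 A trading strategy is a $(U,V)$-measurable real random variable $Q$; a pricing rule is a Borel function $f:\mathbb{R}\to\overline{\mathbb{R}}$. $(Q,f)$ is an equilibrium if, with $R=Q+U$, $S=f(R)$: (1) $S=\mathbb{E}[V|R]$; (2) $Q(V-f(Q+U))=\max_{q\in\mathbb{R}}q(V-f(q+U))$ a.s., with the convention $0\times\infty=0$. *)

theory Defs
  imports "HOL-Probability.Probability"
begin

definition cost :: "real \<times> real \<Rightarrow> real \<times> real \<Rightarrow> real" where
  "cost x y = (fst x - fst y) * (snd x - snd y)"

definition D_family :: "(real \<times> real) set set" where
  "D_family = {D. \<exists>I g K. is_interval I \<and> closed I \<and> I \<noteq> {} \<and> K > 0 \<and>
      (\<forall>s\<in>I. \<forall>t\<in>I. s < t \<longrightarrow> (t - s) / K \<le> g s - g t \<and> g s - g t \<le> K * (t - s)) \<and>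
      D = {(s, g s) | s. s \<in> I}}"

definition D_regular :: "(real \<times> real) measure \<Rightarrow> bool" where
  "D_regular \<mu> \<longleftrightarrow> (\<forall>D\<in>D_family. measure \<mu> D = 0)"

definition trading_strategy :: "'a measure \<Rightarrow> ('a \<Rightarrow> real) \<Rightarrow> ('a \<Rightarrow> real) \<Rightarrow> ('a \<Rightarrow> real) \<Rightarrow> bool" where
  "trading_strategy M U V Q \<longleftrightarrow>
     Q \<in> borel_measurable (vimage_algebra (space M) (\<lambda>\<omega>. (U \<omega>, V \<omega>)) borel)"

definition pricing_rule :: "(real \<Rightarrow> ereal) \<Rightarrow> bool" where
  "pricing_rule f \<longleftrightarrow> f \<in> borel_measurable borel"

text \<open>Equilibrium (Q,f), with R = Q + U, S = f(R).  Condition (1): S = E[V|R] a.s.;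
  condition (2): Q maximizes q (V - f(q+U)) a.s. (ereal arithmetic, where 0 * \<infinity> = 0).\<close>
definition equilibrium :: "'a measure \<Rightarrow> ('a \<Rightarrow> real) \<Rightarrow> ('a \<Rightarrow> real) \<Rightarrow> ('a \<Rightarrow> real) \<Rightarrow> (real \<Rightarrow> ereal) \<Rightarrow> bool" where
  "equilibrium M U V Q f \<longleftrightarrow> trading_strategy M U V Q \<and> pricing_rule f \<and>
     (AE \<omega> in M. f (Q \<omega> + U \<omega>) =
        ereal (real_cond_exp M (vimage_algebra (space M) (\<lambda>\<omega>. Q \<omega> + U \<omega>) borel) V \<omega>)) \<and>
     (AE \<omega> in M. \<forall>q::real. ereal q * (ereal (V \<omega>) - f (q + U \<omega>))
                  \<le> ereal (Q \<omega>) * (ereal (V \<omega>) - f (Q \<omega> + U \<omega>)))"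

definition admissible_maps :: "'a measure \<Rightarrow> ('a \<Rightarrow> real) \<Rightarrow> ('a \<Rightarrow> real) \<Rightarrow> ('a \<Rightarrow> real \<times> real) set" where
  "admissible_maps M U V = {X.
     X \<in> measurable (vimage_algebra (space M) (\<lambda>\<omega>. (U \<omega>, V \<omega>)) borel) borel \<and>
     integrable M (\<lambda>\<omega>. (norm (X \<omega>))\<^sup>2) \<and>
     (AE \<omega> in M. real_cond_exp M (vimage_algebra (space M) X borel) U \<omega> = fst (X \<omega>)) \<and>
     (AE \<omega> in M. real_cond_exp M (vimage_algebra (space M) X borel) V \<omega> = snd (X \<omega>))}"

definition Gamma :: "(real \<times> real) measure \<Rightarrow> ((real \<times> real) \<times> (real \<times> real)) measure set" where
  "Gamma \<nu> = {\<gamma>. prob_space \<gamma> \<and> sets \<gamma> = sets borel \<and>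
     integrable \<gamma> (\<lambda>p. (norm (fst p))\<^sup>2 + (norm (snd p))\<^sup>2) \<and>
     distr \<gamma> borel snd = \<nu> \<and>
     (AE p in \<gamma>. real_cond_exp \<gamma> (vimage_algebra (space \<gamma>) fst borel) (\<lambda>p. fst (snd p)) p = fst (fst p)) \<and>
     (AE p in \<gamma>. real_cond_exp \<gamma> (vimage_algebra (space \<gamma>) fst borel) (\<lambda>p. snd (snd p)) p = snd (fst p))}"

definition atomless_law :: "'a measure \<Rightarrow> ('a \<Rightarrow> real) \<Rightarrow> bool" where
  "atomless_law M W \<longleftrightarrow> (\<forall>x. measure (distr M borel W) {x} = 0)"

end

theory Submission
  imports Defs "HOL-Complex_Analysis.Great_Picard"
begin

text \<open>A maximal monotone set in the plane is the image of a curve z(t) = (t + h t, t - h t) with h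
  nonexpansive, and then c(z(t), y) = (t - y')^2 - (h t - y'')^2 with y' = (y1 + y2)/2 and
  y'' = (y1 - y2)/2. If x lies on the antidiagonal through z = x + (d, -d), then c(x, y) - c(z, y)
  is d^2 plus a term that vanishes under E[y | x] = x; hence the expected minimum of c(z(t), y) over t
  is a lower bound for the transport cost, attained only by plans that live on the curve and
  on the minimizers. Ties between strictly ordered points lie on decreasing bi-Lipschitz graphs, and ties
  in a common column or row force y1 or y2 into a countable set, so the minimizer is almost surely unique.

  In an equilibrium the price function supports such a curve: averaging the insider's inequality over the
  fibres of R shows that the price is monotone around E[U | R], and atomlessness of V gives E[U | R] = R.

  An equilibrium is constructed from a curve that maximizes the expected minimum, which exists by an
  Arzela-Ascoli argument and Fatou's lemma. Dilating the curve shows that minimizers exist and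
  are square integrable; moving its first coordinate gives E[V | R] = S away from vertical segments.\<close>

section \<open>Monotone curves\<close>

text \<open>The sign is reversed throughout: \<open>depth\<close> is minus the minimal cost along
  the curve, hence nonnegative, and the dual problem minimizes its mean \<open>dual_value\<close>.
  The infimum over t need not be attained a priori, because h may have slope 1 or -1 at infinity;
  this is why variations of the curve are estimated from one side only and why a coercive direction
  is mixed in.

  Existence is claimed for laws with atoms. Then ties are possible for y on the curve itself, and
  every variation must bound what such ties can lose. Vertical segments (columns) are the second
  obstacle: the price has to be a function of R, but a column holds many prices for one R. It turns
  out that mass off the curve never selects a point of a column, while for mass on the curve the
  insider stays idle, so any price in the column is compatible with optimality and the mean of V can
  be chosen.

  Almost sure statements about all pairs of parameters, all columns or all points of a price graph
  are reduced to countable families by rational or dense choices.\<close>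

definition nonexpansive :: "(real \<Rightarrow> real) \<Rightarrow> bool" where
  "nonexpansive h \<longleftrightarrow> (\<forall>s t. \<bar>h s - h t\<bar> \<le> \<bar>s - t\<bar>)"

definition curve :: "(real \<Rightarrow> real) \<Rightarrow> real \<Rightarrow> real \<times> real" where
  "curve h t = (t + h t, t - h t)"

text \<open>Minus the infimum of the cost along the curve, possibly infinite. Truncation by
  \<open>ennreal\<close> at 0 loses nothing, because some point of the curve has nonpositive cost
  (\<open>cost_curve_nonpos_exists\<close>).\<close>

definition depth :: "(real \<Rightarrow> real) \<Rightarrow> real \<times> real \<Rightarrow> ennreal" where
  "depth h y = (SUP t. ennreal (- cost (curve h t) y))"

definition minimizers :: "(real \<Rightarrow> real) \<Rightarrow> real \<times> real \<Rightarrow> real set" where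
  "minimizers h y = {t. \<forall>s. cost (curve h t) y \<le> cost (curve h s) y}"

lemma cost_curve:
  "cost (curve h t) (u, v) = (t - (u + v) / 2)\<^sup>2 - (h t - (u - v) / 2)\<^sup>2"
  by (simp add: cost_def curve_def power2_eq_square field_simps)

lemma cost_curve_expand: "cost (curve h t) (u, v) = (t + h t - u) * (t - h t - v)"
  by (simp add: cost_def curve_def)

lemma continuous_on_cost [continuous_intros]:
  assumes "continuous_on A f" "continuous_on A g"
  shows "continuous_on A (\<lambda>x. cost (f x) (g x))"
  unfolding cost_def using assms by (intro continuous_intros)

lemma borel_measurable_cost [measurable]:
  assumes [measurable]: "f \<in> M \<rightarrow>\<^sub>M borel" "g \<in> M \<rightarrow>\<^sub>M borel"
  shows "(\<lambda>x. cost (f x) (g x)) \<in> borel_measurable M"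
proof -
  have [measurable]: "f \<in> M \<rightarrow>\<^sub>M borel \<Otimes>\<^sub>M borel" "g \<in> M \<rightarrow>\<^sub>M borel \<Otimes>\<^sub>M borel"
    using assms by (simp_all add: borel_prod)
  show ?thesis unfolding cost_def by measurable
qed

lemma nonexpansiveD: "nonexpansive h \<Longrightarrow> \<bar>h s - h t\<bar> \<le> \<bar>s - t\<bar>"
  by (simp add: nonexpansive_def)

lemma nonexpansive_continuous_on:
  assumes "nonexpansive h" shows "continuous_on A h"
proof -
  have "1-lipschitz_on A h"
    using assms by (auto simp: lipschitz_on_def nonexpansive_def dist_real_def)
  then show ?thesis by (rule lipschitz_on_continuous_on)
qed

lemma nonexpansive_mono_fst: "nonexpansive h \<Longrightarrow> s \<le> t \<Longrightarrow> s + h s \<le> t + h t"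
  using nonexpansiveD[of h s t] by (auto simp: abs_if split: if_splits)

lemma nonexpansive_mono_snd: "nonexpansive h \<Longrightarrow> s \<le> t \<Longrightarrow> s - h s \<le> t - h t"
  using nonexpansiveD[of h s t] by (auto simp: abs_if split: if_splits)

lemma continuous_on_curve [continuous_intros]:
  assumes h: "nonexpansive h" and f: "continuous_on A f"
  shows "continuous_on A (\<lambda>x. curve h (f x))"
proof -
  have "continuous_on A (\<lambda>x. h (f x))"
    by (rule continuous_on_compose2[OF nonexpansive_continuous_on[OF h, of UNIV] f]) auto
  then show ?thesis unfolding curve_def using f by (intro continuous_intros)
qed

lemma nonexpansive_minus_reflect: "nonexpansive h \<Longrightarrow> nonexpansive (\<lambda>t. - h (- t))"
  unfolding nonexpansive_def
proof (intro allI)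
  fix s t assume "\<forall>s t. \<bar>h s - h t\<bar> \<le> \<bar>s - t\<bar>"
  then have "\<bar>h (-s) - h (-t)\<bar> \<le> \<bar>(-s) - (-t)\<bar>" by blast
  then show "\<bar>- h (- s) - - h (- t)\<bar> \<le> \<bar>s - t\<bar>" by (simp add: abs_minus_commute)
qed

text \<open>Increments of the same sign satisfy |da - db| \<le> |da + db|, so half the difference is
  a nonexpansive function of half the sum. This turns a perturbed pair of coordinates back into a
  competitor curve.\<close>

lemma curve_of_monotone:
  fixes a b :: "real \<Rightarrow> real"
  assumes "mono a" "mono b" and surj: "\<And>t. \<exists>s. a s + b s = 2 * t"
  obtains k where "nonexpansive k" "\<And>s. curve k ((a s + b s) / 2) = (a s, b s)"
proof -
  have eq: "a s = a s' \<and> b s = b s'" if "a s + b s = a s' + b s'" for s s'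
  proof (cases "s \<le> s'")
    case True
    with monoD[OF assms(1) True] monoD[OF assms(2) True] that show ?thesis by simp
  next
    case False
    then have "s' \<le> s" by simp
    with monoD[OF assms(1) this] monoD[OF assms(2) this] that show ?thesis by simp
  qed
  \<comment> \<open>Any preimage will do: by \<open>eq\<close>, parameters with the same sum give
    the same point.\<close>
  obtain \<sigma> where \<sigma>: "\<And>t. a (\<sigma> t) + b (\<sigma> t) = 2 * t" using surj by metis
  define k where "k t = (a (\<sigma> t) - b (\<sigma> t)) / 2" for t
  have "\<bar>k s - k t\<bar> \<le> \<bar>s - t\<bar>" for s t
  proof -
    have "(a (\<sigma> s) \<le> a (\<sigma> t) \<and> b (\<sigma> s) \<le> b (\<sigma> t)) \<or> (a (\<sigma> t) \<le> a (\<sigma> s) \<and> b (\<sigma> t) \<le> b (\<sigma> s))"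
      using monoD[OF assms(1)] monoD[OF assms(2)] by (meson linear)
    then show ?thesis using \<sigma>[of s] \<sigma>[of t] unfolding k_def by (auto simp: abs_if field_simps)
  qed
  then have "nonexpansive k" by (simp add: nonexpansive_def)
  moreover have "curve k ((a s + b s) / 2) = (a s, b s)" for s
  proof -
    have "a (\<sigma> ((a s + b s) / 2)) + b (\<sigma> ((a s + b s) / 2)) = a s + b s" by (simp add: \<sigma>)
    from eq[OF this] show ?thesis unfolding curve_def k_def by (simp add: field_simps)
  qed
  ultimately show thesis by (rule that)
qed

section \<open>Depth and minimizers of the cost along a curve\<close>

lemma borel_measurable_depth [measurable]:
  assumes "nonexpansive h"
  shows "depth h \<in> borel_measurable borel"
proof (rule borel_measurableI_greater)
  fix c :: ennreal
  have "{y. c < depth h y} = (\<Union>t. {y. c < ennreal (- cost (curve h t) y)})"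
    by (auto simp: depth_def less_SUP_iff)
  moreover have "open {y. c < ennreal (- cost (curve h t) y)}" for t
    by (intro open_Collect_less continuous_intros continuous_on_ennreal)
  ultimately have "open {y. c < depth h y}" by auto
  then show "{y \<in> space borel. c < depth h y} \<in> sets borel" by simp
qed

lemma depth_ge: "ennreal (- cost (curve h t) y) \<le> depth h y"
  unfolding depth_def by (rule SUP_upper) simp

lemma depth_le: "(\<And>t. - cost (curve h t) y \<le> c) \<Longrightarrow> depth h y \<le> ennreal c"
  unfolding depth_def by (rule SUP_least) (simp add: ennreal_leI)

lemma cost_ge_depth:
  assumes "depth h y < \<infinity>" shows "- enn2real (depth h y) \<le> cost (curve h t) y"
proof (cases "cost (curve h t) y \<ge> 0")
  case True then show ?thesis using enn2real_nonneg[of "depth h y"] by linarith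
next
  case False
  have "enn2real (ennreal (- cost (curve h t) y)) \<le> enn2real (depth h y)"
    by (rule enn2real_mono[OF depth_ge]) (use assms in simp)
  then show ?thesis using False by simp
qed

lemma cost_curve_nonpos_exists: "\<exists>t. cost (curve h t) y \<le> 0"
proof -
  obtain u v where y: "y = (u, v)" by (cases y)
  have "cost (curve h ((u + v) / 2)) y \<le> 0" unfolding y cost_curve by simp
  then show ?thesis ..
qed

lemma depth_minimizer:
  assumes "t \<in> minimizers h y" shows "depth h y = ennreal (- cost (curve h t) y)"
  using assms by (intro antisym depth_ge depth_le) (auto simp: minimizers_def)

lemma minimizer_nonpos: "t \<in> minimizers h y \<Longrightarrow> cost (curve h t) y \<le> 0"
  using cost_curve_nonpos_exists[of h y] unfolding minimizers_def by (auto intro: order_trans)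

lemma minimizers_depth:
  assumes "depth h y < \<infinity>" "cost (curve h t) y = - enn2real (depth h y)"
  shows "t \<in> minimizers h y"
  using assms cost_ge_depth[of h y] by (auto simp: minimizers_def)

text \<open>The antidiagonal through y always meets the curve, at a point of cost
  minus the squared distance; so the minimum vanishes only on the curve itself.\<close>

lemma minimizer_cost_eq_0:
  assumes "nonexpansive h" "t \<in> minimizers h (u, v)" "cost (curve h t) (u, v) = 0"
  shows "curve h ((u + v) / 2) = (u, v)"
proof -
  have "0 \<le> cost (curve h ((u + v) / 2)) (u, v)" using assms(2,3) by (auto simp: minimizers_def)
  then have "h ((u + v) / 2) - (u - v) / 2 = 0" unfolding cost_curve by simp
  then show ?thesis by (simp add: curve_def field_simps)
qed

text \<open>Two points of a monotone curve are ordered coordinatewise, so the two factors of the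
  cost have the same sign.\<close>

lemma cost_curve_curve_nonneg:
  assumes "nonexpansive h" shows "0 \<le> cost (curve h s) (curve h t)"
proof -
  have "(h s - h t)\<^sup>2 \<le> (s - t)\<^sup>2" using nonexpansiveD[OF assms, of s t] by (simp add: abs_le_square_iff)
  then show ?thesis unfolding curve_def[of h t] cost_curve by (simp add: field_simps)
qed

lemma closed_minimizers_graph:
  assumes "nonexpansive h" shows "closed {(t, y). t \<in> minimizers h y}"
proof -
  have "{(t, y). t \<in> minimizers h y} = (\<Inter>s. {p. cost (curve h (fst p)) (snd p) \<le> cost (curve h s) (snd p)})"
    by (auto simp: minimizers_def)
  moreover have "closed {p. cost (curve h (fst p)) (snd p) \<le> cost (curve h s) (snd p)}" for s
    by (intro closed_Collect_le continuous_intros assms)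
  ultimately show ?thesis by auto
qed

text \<open>The value 0 where there is no minimizer or more than one gives a total Borel function
  without a measurable selection; only its values at unique minimizers matter.\<close>

definition the_minimizer :: "(real \<Rightarrow> real) \<Rightarrow> real \<times> real \<Rightarrow> real" where
  "the_minimizer h y = (if \<exists>!t. t \<in> minimizers h y then THE t. t \<in> minimizers h y else 0)"

lemma the_minimizer_eq: "t \<in> minimizers h y \<Longrightarrow> (\<And>s. s \<in> minimizers h y \<Longrightarrow> s = t) \<Longrightarrow> the_minimizer h y = t"
  unfolding the_minimizer_def by (subst if_P, blast, rule the_equality)

text \<open>The set of y with a minimizer in [a, b] is closed, as a projection of the closed
  minimizer graph along a compact interval. Existence, uniqueness and sublevel sets of the minimizer
  are countable Boolean combinations of such sets.\<close>

lemma borel_measurable_the_minimizer [measurable]: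
  assumes h: "nonexpansive h" shows "the_minimizer h \<in> borel_measurable borel"
    and sets_unique_minimizer: "{y. \<exists>!t. t \<in> minimizers h y} \<in> sets borel"
proof -
  define N where "N a b = {y. \<exists>t. t \<in> {a..b} \<and> t \<in> minimizers h y}" for a b
  have N: "N a b \<in> sets borel" for a b
  proof -
    have "closed {y. \<exists>t. t \<in> {a..b} \<and> (t, y) \<in> {(t, y). t \<in> minimizers h y}}"
      by (rule closed_compact_projection) (use closed_minimizers_graph[OF h] in auto)
    then show ?thesis by (simp add: N_def borel_closed)
  qed
  define E where "E = (\<Union>n::nat. N (- real n) (real n))"
  \<comment> \<open>Two distinct minimizers are separated by rationals q < r, one lying to the left
    of q and the other to the right of r.\<close>
  define D where "D = (\<Union>q\<in>\<rat>. \<Union>r\<in>\<rat>. \<Union>n::nat. if q < r then N (- real n) q \<inter> N r (real n) else {})"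
  have ED: "E \<in> sets borel" "D \<in> sets borel"
  proof -
    show "E \<in> sets borel" unfolding E_def by (intro sets.countable_UN') (auto simp: N)
    have "(if q < r then N (- real n) q \<inter> N r (real n) else {}) \<in> sets borel" for q r :: real and n :: nat
      using N by auto
    then show "D \<in> sets borel" unfolding D_def
      by (intro sets.countable_UN'' countable_rat countableI_type)
  qed
  have nat: "\<exists>n::nat. \<bar>s\<bar> \<le> n \<and> \<bar>t\<bar> \<le> n" for s t :: real
  proof -
    obtain n :: nat where "max \<bar>s\<bar> \<bar>t\<bar> \<le> n" using real_arch_simple by blast
    then show ?thesis by (intro exI[of _ n]) auto
  qed
  have E: "y \<in> E \<longleftrightarrow> (\<exists>t. t \<in> minimizers h y)" for y
  proof
    assume "\<exists>t. t \<in> minimizers h y"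
    then obtain t where t: "t \<in> minimizers h y" ..
    obtain n :: nat where "\<bar>t\<bar> \<le> n" using nat by blast
    then show "y \<in> E" using t unfolding E_def N_def by (auto intro!: exI[of _ n] exI[of _ t])
  qed (auto simp: E_def N_def)
  have D: "y \<in> D \<longleftrightarrow> (\<exists>s t. s < t \<and> s \<in> minimizers h y \<and> t \<in> minimizers h y)" for y
  proof
    assume "y \<in> D"
    then show "\<exists>s t. s < t \<and> s \<in> minimizers h y \<and> t \<in> minimizers h y"
    proof -
      from \<open>y \<in> D\<close> obtain q r and n :: nat where "y \<in> (if q < r then N (- real n) q \<inter> N r (real n) else {})"
        unfolding D_def by blast
      then have "q < r" "y \<in> N (- real n) q" "y \<in> N r (real n)" by (auto split: if_splits)
      then obtain s t where "s \<le> q" "s \<in> minimizers h y" "r \<le> t" "t \<in> minimizers h y"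
        unfolding N_def by auto
      with \<open>q < r\<close> show ?thesis by (intro exI[of _ s] exI[of _ t]) auto
    qed
  next
    assume "\<exists>s t. s < t \<and> s \<in> minimizers h y \<and> t \<in> minimizers h y"
    then obtain s t where st: "s < t" "s \<in> minimizers h y" "t \<in> minimizers h y" by blast
    obtain q where q: "q \<in> \<rat>" "s < q" "q < t" using Rats_dense_in_real[OF st(1)] by blast
    obtain r where r: "r \<in> \<rat>" "q < r" "r < t" using Rats_dense_in_real[OF q(3)] by blast
    obtain n :: nat where n: "\<bar>s\<bar> \<le> n" "\<bar>t\<bar> \<le> n" using nat by blast
    have "s \<in> {- real n..q}" "t \<in> {r..real n}" using q r n by auto
    then have "y \<in> N (- real n) q" "y \<in> N r (real n)" unfolding N_def using st by blast+
    then have "y \<in> (if q < r then N (- real n) q \<inter> N r (real n) else {})" using r by simp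
    then show "y \<in> D" unfolding D_def using q(1) r(1) by blast
  qed
  define S where "S = E - D"
  have S: "y \<in> S \<longleftrightarrow> (\<exists>!t. t \<in> minimizers h y)" for y
  proof -
    have "y \<in> S \<longleftrightarrow> (\<exists>t. t \<in> minimizers h y) \<and> \<not> (\<exists>s t. s < t \<and> s \<in> minimizers h y \<and> t \<in> minimizers h y)"
      unfolding S_def using E[of y] D[of y] by blast
    also have "\<dots> \<longleftrightarrow> (\<exists>!t. t \<in> minimizers h y)" 
    proof
      assume *: "(\<exists>t. t \<in> minimizers h y) \<and> \<not> (\<exists>s t. s < t \<and> s \<in> minimizers h y \<and> t \<in> minimizers h y)"
      then obtain t where t: "t \<in> minimizers h y" by blast
      show "\<exists>!t. t \<in> minimizers h y"
      proof (intro ex1I[of _ t] t)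
        fix s assume "s \<in> minimizers h y"
        with * t show "s = t" by (cases s t rule: linorder_cases) auto
      qed
    qed (auto elim!: ex1E)
    finally show ?thesis .
  qed
  have Sm: "S \<in> sets borel" unfolding S_def by (intro sets.Diff ED)
  moreover have "S = {y. \<exists>!t. t \<in> minimizers h y}" using S by blast
  ultimately show "{y. \<exists>!t. t \<in> minimizers h y} \<in> sets borel" by simp
  show "the_minimizer h \<in> borel_measurable borel"
  proof (rule borel_measurableI_le)
    fix a :: real
    have "{y. the_minimizer h y \<le> a} = (S \<inter> (\<Union>n::nat. N (- real n) a)) \<union> (if 0 \<le> a then - S else {})"
    proof (rule set_eqI)
      fix y
      show "y \<in> {y. the_minimizer h y \<le> a} \<longleftrightarrow> y \<in> (S \<inter> (\<Union>n::nat. N (- real n) a)) \<union> (if 0 \<le> a then - S else {})"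
      proof (cases "y \<in> S")
        case True
        then obtain t where t: "t \<in> minimizers h y" "\<And>s. s \<in> minimizers h y \<Longrightarrow> s = t" using S by blast
        then have "the_minimizer h y = t" by (rule the_minimizer_eq)
        moreover have "(\<exists>n::nat. y \<in> N (- real n) a) \<longleftrightarrow> t \<le> a"
        proof
          assume "t \<le> a"
          moreover obtain n :: nat where "\<bar>t\<bar> \<le> n" using nat by blast
          ultimately have "y \<in> N (- real n) a" unfolding N_def using t(1) by (auto intro!: exI[of _ t])
          then show "\<exists>n::nat. y \<in> N (- real n) a" ..
        qed (use t(2) in \<open>auto simp: N_def\<close>)
        ultimately show ?thesis using True by auto
      next
        case False
        then have "the_minimizer h y = 0" unfolding the_minimizer_def using S by auto
        then show ?thesis using False by auto
      qed
    qed
    moreover have "\<dots> \<in> sets borel"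
    proof -
      have "(\<Union>n::nat. N (- real n) a) \<in> sets borel" by (intro sets.countable_UN') (auto simp: N)
      then show ?thesis using Sm by (auto intro: borel_comp)
    qed
    ultimately show "{y \<in> space borel. the_minimizer h y \<le> a} \<in> sets borel" by simp
  qed
qed

text \<open>A diagonal subsequence converges at all rationals, and equicontinuity extends the
  convergence to every t.\<close>

lemma nonexpansive_subseq:
  assumes ne: "\<And>n. nonexpansive (k n)" and bd: "\<And>n. \<bar>k n 0\<bar> \<le> B"
  obtains r h where "strict_mono (r :: nat \<Rightarrow> nat)" "nonexpansive h" "\<And>t. (\<lambda>n. k (r n) t) \<longlonglongrightarrow> h t"
proof -
  \<comment> \<open>Division by 1 + |t| turns linear growth into a single bound for all n and t, the
    form in which the diagonal subsequence is extracted.\<close>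
  have bound: "norm (k n t / (1 + \<bar>t\<bar>)) \<le> B + 1" for n t
  proof -
    have "\<bar>k n t\<bar> \<le> \<bar>k n 0\<bar> + \<bar>t\<bar>" using nonexpansiveD[OF ne[of n], of t 0] by linarith
    also have "\<dots> \<le> B + \<bar>t\<bar> + (1 + B * \<bar>t\<bar>)" 
    proof -
      have "0 \<le> B" using bd[of n] abs_ge_zero[of "k n 0"] by (rule order_trans[rotated])
      then have "0 \<le> B * \<bar>t\<bar>" by simp
      then show ?thesis using bd[of n] by linarith
    qed
    also have "\<dots> = (B + 1) * (1 + \<bar>t\<bar>)" by (simp add: algebra_simps)
    finally show ?thesis by (simp add: divide_le_eq)
  qed
  obtain r :: "nat \<Rightarrow> nat" where r: "strict_mono r"
    and conv: "\<And>q. q \<in> \<rat> \<Longrightarrow> \<exists>l. (\<lambda>n. k (r n) q / (1 + \<bar>q\<bar>)) \<longlonglongrightarrow> l"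
    using function_convergent_subsequence[of \<rat> "\<lambda>n t. k n t / (1 + \<bar>t\<bar>)", OF countable_rat bound]
    by metis
  have convQ: "Cauchy (\<lambda>n. k (r n) q)" if q: "q \<in> \<rat>" for q
  proof -
    obtain l where "(\<lambda>n. k (r n) q / (1 + \<bar>q\<bar>)) \<longlonglongrightarrow> l" using conv[OF q] by blast
    then have "(\<lambda>n. k (r n) q / (1 + \<bar>q\<bar>) * (1 + \<bar>q\<bar>)) \<longlonglongrightarrow> l * (1 + \<bar>q\<bar>)" by (intro tendsto_intros)
    moreover have "1 + \<bar>q\<bar> \<noteq> 0" using abs_ge_zero[of q] by linarith
    ultimately show ?thesis by (auto intro: LIMSEQ_imp_Cauchy)
  qed
  have "convergent (\<lambda>n. k (r n) t)" for t
  proof -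
    have "Cauchy (\<lambda>n. k (r n) t)"
    proof (rule metric_CauchyI)
      fix e :: real assume e: "e > 0"
      obtain q where q: "q \<in> \<rat>" "t < q" "q < t + e / 3" using Rats_dense_in_real[of t "t + e / 3"] e by auto
      obtain N where N: "\<And>m n. m \<ge> N \<Longrightarrow> n \<ge> N \<Longrightarrow> dist (k (r m) q) (k (r n) q) < e / 3"
        using metric_CauchyD[OF convQ[OF q(1)], of "e / 3"] e by auto
      have "dist (k (r m) t) (k (r n) t) < e" if "m \<ge> N" "n \<ge> N" for m n
        using N[OF that] nonexpansiveD[OF ne[of "r m"], of t q] nonexpansiveD[OF ne[of "r n"], of t q] q
        unfolding dist_real_def by linarith
      then show "\<exists>N. \<forall>m\<ge>N. \<forall>n\<ge>N. dist (k (r m) t) (k (r n) t) < e" by blast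
    qed
    then show ?thesis by (simp add: Cauchy_convergent_iff)
  qed
  then obtain h where h: "\<And>t. (\<lambda>n. k (r n) t) \<longlonglongrightarrow> h t" unfolding convergent_def by metis
  have "nonexpansive h"
    unfolding nonexpansive_def
  proof (intro allI)
    fix s t
    have "(\<lambda>n. \<bar>k (r n) s - k (r n) t\<bar>) \<longlonglongrightarrow> \<bar>h s - h t\<bar>" by (intro tendsto_intros h)
    then show "\<bar>h s - h t\<bar> \<le> \<bar>s - t\<bar>"
      by (rule LIMSEQ_le_const2) (auto intro: nonexpansiveD[OF ne])
  qed
  with r h show thesis using that by blast
qed

section \<open>Ties between minimizers\<close>

text \<open>A bi-Lipschitz implicit function theorem: slopes of at least m give exactly one zero on
  each vertical line, and comparing moves in the two variables bounds the slopes of the resulting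
  decreasing graph by \<open>L / m\<close> and its inverse. The graph lives over the whole
  line.\<close>

lemma zero_set_in_D_family:
  fixes \<Phi> :: "real \<Rightarrow> real \<Rightarrow> real"
  assumes m: "0 < m"
    and fst: "\<And>u u' v. u < u' \<Longrightarrow> m * (u' - u) \<le> \<Phi> u' v - \<Phi> u v \<and> \<Phi> u' v - \<Phi> u v \<le> L * (u' - u)"
    and snd: "\<And>u v v'. v < v' \<Longrightarrow> m * (v' - v) \<le> \<Phi> u v' - \<Phi> u v \<and> \<Phi> u v' - \<Phi> u v \<le> L * (v' - v)"
  shows "{(u, v). \<Phi> u v = 0} \<in> D_family"
proof -
  have "m * (1 - 0) \<le> L * (1 - 0)" using fst[of 0 1 0] by linarith
  then have L: "0 < L" using m by simp
  have lip: "\<bar>\<Phi> u v' - \<Phi> u v\<bar> \<le> L * \<bar>v' - v\<bar>" for u v v'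
  proof (cases v v' rule: linorder_cases)
    case less
    have "0 \<le> m * (v' - v)" using less m by simp
    with snd[OF less, of u] less show ?thesis by simp
  next
    case greater
    have "0 \<le> m * (v - v')" using greater m by simp
    with snd[OF greater, of u] greater show ?thesis by simp
  qed simp
  have "\<exists>v. \<Phi> u v = 0" for u
  proof -
    have cont: "continuous_on A (\<Phi> u)" for A
      by (rule lipschitz_on_continuous_on[of L]) (use lip L in \<open>auto simp: lipschitz_on_def dist_real_def\<close>)
    \<comment> \<open>A move by B changes \<Phi> by at least |\<Phi> u 0| + 1, enough to reach the
      other sign.\<close>
    define B where "B = (\<bar>\<Phi> u 0\<bar> + 1) / m"
    have B: "0 < B" "m * B = \<bar>\<Phi> u 0\<bar> + 1" using m by (auto simp: B_def)
    have "\<Phi> u (- B) \<le> 0" using snd[of "-B" 0 u] B by auto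
    moreover have "0 \<le> \<Phi> u B" using snd[of 0 B u] B by auto
    ultimately show ?thesis using IVT'[of "\<Phi> u" "-B" 0 B] B(1) cont by auto
  qed
  then obtain g where g: "\<And>u. \<Phi> u (g u) = 0" by metis
  have uniq: "v = g u" if "\<Phi> u v = 0" for u v
  proof (rule ccontr)
    assume "v \<noteq> g u"
    then consider "v < g u" | "g u < v" by linarith
    then show False
    proof cases
      case 1
      have "0 < m * (g u - v)" using 1 m by simp
      then show False using snd[OF 1, of u] that g[of u] by linarith
    next
      case 2
      have "0 < m * (v - g u)" using 2 m by simp
      then show False using snd[OF 2, of u] that g[of u] by linarith
    qed
  qed
  have bounds: "(t - s) / (L / m) \<le> g s - g t \<and> g s - g t \<le> L / m * (t - s)" if st: "s < t" for s t
  proof -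
    have lo: "m * (t - s) \<le> \<Phi> t (g s)" and hi: "\<Phi> t (g s) \<le> L * (t - s)"
      using fst[OF st, of "g s"] g[of s] by auto
    have pos: "0 < m * (t - s)" using st m by simp
    have lt: "g t < g s"
    proof (rule ccontr)
      assume "\<not> g t < g s"
      then consider "g s = g t" | "g s < g t" by linarith
      then show False
      proof cases
        case 1 then show False using lo pos g[of t] by simp
      next
        case 2
        have "0 < m * (g t - g s)" using 2 m by simp
        then show False using snd[OF 2, of t] lo pos g[of t] by linarith
      qed
    qed
    have "m * (g s - g t) \<le> L * (t - s)" "m * (t - s) \<le> L * (g s - g t)"
      using snd[OF lt, of t] g[of t] lo hi by linarith+
    then show ?thesis using m L by (simp add: field_simps)
  qed
  have eq: "{(u, v). \<Phi> u v = 0} = {(s, g s) | s. s \<in> UNIV}"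
    using g uniq by auto
  show ?thesis
    unfolding D_family_def eq using bounds m L
    by (intro CollectI exI[of _ UNIV] exI[of _ g] exI[of _ "L / m"]) auto
qed

text \<open>The part of the curve over [a,b] contributes a convex function of y, whose partial
  slopes lie between the coordinates of the end points. Ties between two strictly comparable
  pieces hence occur along a decreasing bi-Lipschitz graph.\<close>

definition envelope :: "(real \<Rightarrow> real) \<Rightarrow> real \<Rightarrow> real \<Rightarrow> real \<Rightarrow> real \<Rightarrow> real" where
  "envelope h a b u v = (SUP t\<in>{a..b}. u * v - cost (curve h t) (u, v))"

lemma envelope_attained:
  assumes "nonexpansive h" "a \<le> b"
  shows "\<exists>t\<in>{a..b}. envelope h a b u v = u * v - cost (curve h t) (u, v)"
    and "\<And>s. s \<in> {a..b} \<Longrightarrow> u * v - cost (curve h s) (u, v) \<le> envelope h a b u v"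
proof -
  have "continuous_on {a..b} (\<lambda>t. u * v - cost (curve h t) (u, v))"
    using assms(1) by (intro continuous_intros)
  then obtain t where t: "t \<in> {a..b}"
      "\<And>s. s \<in> {a..b} \<Longrightarrow> u * v - cost (curve h s) (u, v) \<le> u * v - cost (curve h t) (u, v)"
    using continuous_attains_sup[of "{a..b}" "\<lambda>t. u * v - cost (curve h t) (u, v)"] assms(2) by auto
  have eq: "envelope h a b u v = u * v - cost (curve h t) (u, v)"
    unfolding envelope_def using t by (intro cSup_eq_maximum) auto
  show "\<exists>t\<in>{a..b}. envelope h a b u v = u * v - cost (curve h t) (u, v)" using t(1) eq by blast
  show "\<And>s. s \<in> {a..b} \<Longrightarrow> u * v - cost (curve h s) (u, v) \<le> envelope h a b u v" using t(2) eq by simp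
qed

text \<open>Subtracting the cost from u v cancels its only quadratic term in y. What remains for
  fixed t is affine in (u, v), so \<open>envelope\<close> is a supremum of affine functions.\<close>

lemma cost_affine: "u * v - cost (curve h t) (u, v) = (t + h t) * v + (t - h t) * u - (t + h t) * (t - h t)"
  unfolding cost_curve_expand by (simp add: algebra_simps)

text \<open>The maximizer at one end is a competitor at the other. The coordinates are swapped: the
  slope in u is the second coordinate t - h t of the curve, the slope in v is the first.\<close>

lemma envelope_slope_fst:
  assumes h: "nonexpansive h" and ab: "a \<le> b" and u: "u < u'"
  shows "(a - h a) * (u' - u) \<le> envelope h a b u' v - envelope h a b u v"
    and "envelope h a b u' v - envelope h a b u v \<le> (b - h b) * (u' - u)"
proof -
  obtain t where t: "t \<in> {a..b}" "envelope h a b u v = u * v - cost (curve h t) (u, v)"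
    using envelope_attained(1)[OF h ab] by blast
  have "u' * v - cost (curve h t) (u', v) \<le> envelope h a b u' v"
    by (rule envelope_attained(2)[OF h ab t(1)])
  moreover have "(a - h a) * (u' - u) \<le> (t - h t) * (u' - u)"
    using nonexpansive_mono_snd[OF h, of a t] t(1) u by (intro mult_right_mono) auto
  ultimately show "(a - h a) * (u' - u) \<le> envelope h a b u' v - envelope h a b u v"
    unfolding t(2) cost_affine by (simp add: algebra_simps)
  obtain t where t: "t \<in> {a..b}" "envelope h a b u' v = u' * v - cost (curve h t) (u', v)"
    using envelope_attained(1)[OF h ab] by blast
  have "u * v - cost (curve h t) (u, v) \<le> envelope h a b u v"
    by (rule envelope_attained(2)[OF h ab t(1)])
  moreover have "(t - h t) * (u' - u) \<le> (b - h b) * (u' - u)"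
    using nonexpansive_mono_snd[OF h, of t b] t(1) u by (intro mult_right_mono) auto
  ultimately show "envelope h a b u' v - envelope h a b u v \<le> (b - h b) * (u' - u)"
    unfolding t(2) cost_affine by (simp add: algebra_simps)
qed

lemma envelope_slope_snd:
  assumes h: "nonexpansive h" and ab: "a \<le> b" and v: "v < v'"
  shows "(a + h a) * (v' - v) \<le> envelope h a b u v' - envelope h a b u v"
    and "envelope h a b u v' - envelope h a b u v \<le> (b + h b) * (v' - v)"
proof -
  obtain t where t: "t \<in> {a..b}" "envelope h a b u v = u * v - cost (curve h t) (u, v)"
    using envelope_attained(1)[OF h ab] by blast
  have "u * v' - cost (curve h t) (u, v') \<le> envelope h a b u v'"
    by (rule envelope_attained(2)[OF h ab t(1)])
  moreover have "(a + h a) * (v' - v) \<le> (t + h t) * (v' - v)"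
    using nonexpansive_mono_fst[OF h, of a t] t(1) v by (intro mult_right_mono) auto
  ultimately show "(a + h a) * (v' - v) \<le> envelope h a b u v' - envelope h a b u v"
    unfolding t(2) cost_affine by (simp add: algebra_simps)
  obtain t where t: "t \<in> {a..b}" "envelope h a b u v' = u * v' - cost (curve h t) (u, v')"
    using envelope_attained(1)[OF h ab] by blast
  have "u * v - cost (curve h t) (u, v) \<le> envelope h a b u v"
    by (rule envelope_attained(2)[OF h ab t(1)])
  moreover have "(t + h t) * (v' - v) \<le> (b + h b) * (v' - v)"
    using nonexpansive_mono_fst[OF h, of t b] t(1) v by (intro mult_right_mono) auto
  ultimately show "envelope h a b u v' - envelope h a b u v \<le> (b + h b) * (v' - v)"
    unfolding t(2) cost_affine by (simp add: algebra_simps)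
qed

lemma tie_set_in_D_family:
  assumes h: "nonexpansive h" and le: "- n \<le> a" "a < b" "b \<le> n"
    and strict: "a + h a < b + h b" "a - h a < b - h b"
  shows "{(u, v). envelope h b n u v - envelope h (- n) a u v = 0} \<in> D_family"
proof (rule zero_set_in_D_family)
  \<comment> \<open>m is the smaller coordinate gap between the two pieces, L the larger extent of
    the curve over [-n, n]; together they bound all slopes of the difference of the
    envelopes.\<close>
  define m where "m = min (b + h b - (a + h a)) (b - h b - (a - h a))"
  define L where "L = max (n + h n - (- n + h (- n))) (n - h n - (- n - h (- n)))"
  show "0 < m" using strict by (simp add: m_def)
  fix u u' v :: real assume u: "u < u'"
  have "m * (u' - u) \<le> (b - h b - (a - h a)) * (u' - u)"
    "(n - h n - (- n - h (- n))) * (u' - u) \<le> L * (u' - u)"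
    using u by (intro mult_right_mono; simp add: m_def L_def)+
  moreover note envelope_slope_fst[OF h _ u, of b n v] envelope_slope_fst[OF h _ u, of "- n" a v] le
  ultimately show "m * (u' - u) \<le> envelope h b n u' v - envelope h (- n) a u' v - (envelope h b n u v - envelope h (- n) a u v) \<and>
      envelope h b n u' v - envelope h (- n) a u' v - (envelope h b n u v - envelope h (- n) a u v) \<le> L * (u' - u)"
    unfolding left_diff_distrib by linarith
next
  define m where "m = min (b + h b - (a + h a)) (b - h b - (a - h a))"
  define L where "L = max (n + h n - (- n + h (- n))) (n - h n - (- n - h (- n)))"
  fix u v v' :: real assume v: "v < v'"
  have "m * (v' - v) \<le> (b + h b - (a + h a)) * (v' - v)"
    "(n + h n - (- n + h (- n))) * (v' - v) \<le> L * (v' - v)"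
    using v by (intro mult_right_mono; simp add: m_def L_def)+
  moreover note envelope_slope_snd[OF h _ v, of b n u] envelope_slope_snd[OF h _ v, of "- n" a u] le
  ultimately show "m * (v' - v) \<le> envelope h b n u v' - envelope h (- n) a u v' - (envelope h b n u v - envelope h (- n) a u v) \<and>
      envelope h b n u v' - envelope h (- n) a u v' - (envelope h b n u v - envelope h (- n) a u v) \<le> L * (v' - v)"
    unfolding left_diff_distrib by linarith
qed

lemma envelope_minimizer:
  assumes h: "nonexpansive h" and t: "t \<in> minimizers h (u, v)" "t \<in> {a..b}"
  shows "envelope h a b u v = u * v - cost (curve h t) (u, v)"
proof -
  have ab: "a \<le> b" using t(2) by auto
  obtain s where "envelope h a b u v = u * v - cost (curve h s) (u, v)"
    using envelope_attained(1)[OF h ab] by blast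
  then have "envelope h a b u v \<le> u * v - cost (curve h t) (u, v)"
    using t(1) by (auto simp: minimizers_def)
  with envelope_attained(2)[OF h ab t(2), of u v] show ?thesis by linarith
qed

lemma strict_ties_rational:
  assumes h: "nonexpansive h" and "s < t" "s + h s < t + h t" "s - h s < t - h t"
  obtains a b where "a \<in> \<rat>" "b \<in> \<rat>" "s < a" "a < b" "b < t" "a + h a < b + h b" "a - h a < b - h b"
proof -
  \<comment> \<open>Moving s to a and t to b changes each coordinate by less than 2 e at each end,
    so gaps of 5 e stay positive. Rational a and b leave only countably many tie sets.\<close>
  define e where "e = min (t + h t - (s + h s)) (min (t - h t - (s - h s)) (t - s)) / 5"
  have e: "0 < e" using assms by (simp add: e_def)
  have e5: "5 * e \<le> t + h t - (s + h s)" "5 * e \<le> t - h t - (s - h s)" "5 * e \<le> t - s"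
    by (simp_all add: e_def)
  obtain a where a: "a \<in> \<rat>" "s < a" "a < s + e" using Rats_dense_in_real[of s "s + e"] e by auto
  obtain b where b: "b \<in> \<rat>" "t - e < b" "b < t" using Rats_dense_in_real[of "t - e" t] e by auto
  show thesis
    using that[OF a(1) b(1) a(2) _ b(3)] a b e e5 nonexpansiveD[OF h, of a s] nonexpansiveD[OF h, of b t] by linarith
qed

text \<open>\<open>D_regular\<close> is phrased with \<open>measure\<close>, which is also 0 on
  nonmeasurable sets. Closedness makes the graphs Borel, so that measure 0 really means a null
  set.\<close>

lemma closed_D_family:
  assumes "C \<in> D_family" shows "closed C"
proof -
  from assms obtain I g K where I: "closed I" "K > 0"
    and bd: "\<forall>s\<in>I. \<forall>t\<in>I. s < t \<longrightarrow> (t - s) / K \<le> g s - g t \<and> g s - g t \<le> K * (t - s)"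
    and C: "C = {(s, g s) | s. s \<in> I}"
    unfolding D_family_def mem_Collect_eq by (elim exE conjE) (rule that)
  have "K-lipschitz_on I g"
  proof (rule lipschitz_onI)
    have *: "\<bar>g s - g t\<bar> \<le> K * \<bar>s - t\<bar>" if "s \<in> I" "t \<in> I" "s < t" for s t
    proof -
      have "0 \<le> (t - s) / K" using that I(2) by simp
      moreover have "(t - s) / K \<le> g s - g t \<and> g s - g t \<le> K * (t - s)" using bd that by blast
      ultimately show ?thesis using that by simp
    qed
    fix s t assume st: "s \<in> I" "t \<in> I"
    show "dist (g s) (g t) \<le> K * dist s t"
      using *[OF st] *[OF st(2,1)]
      by (cases s t rule: linorder_cases) (auto simp: dist_real_def abs_minus_commute)
  qed (use I in auto)
  then have "continuous_on I g" by (rule lipschitz_on_continuous_on)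
  then have "closed ((\<lambda>s. (s, g s)) ` I)"
    by (rule continuous_closed_graph[OF I(1)])
  moreover have "C = (\<lambda>s. (s, g s)) ` I" using C by auto
  ultimately show ?thesis by simp
qed

text \<open>A strict tie between s and t makes the envelopes over [-n, a] and [b, n] agree at y for
  some rationals s < a < b < t and some natural n. Each of these countably many tie sets is
  null.\<close>

lemma (in prob_space) AE_no_strict_ties:
  fixes Y :: "'a \<Rightarrow> real \<times> real"
  assumes [measurable]: "Y \<in> M \<rightarrow>\<^sub>M borel" and D: "D_regular (distr M borel Y)" and h: "nonexpansive h"
  shows "AE \<omega> in M. \<forall>s t. s \<in> minimizers h (Y \<omega>) \<longrightarrow> t \<in> minimizers h (Y \<omega>) \<longrightarrow> s < t \<longrightarrow>
    s + h s = t + h t \<or> s - h s = t - h t"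
proof -
  have null: "AE \<omega> in M. Y \<omega> \<notin> C" if C: "C \<in> D_family" "closed C" for C
  proof -
    have C': "C \<in> sets borel" using C(2) by (rule borel_closed)
    have "measure (distr M borel Y) C = 0" using D C(1) by (simp add: D_regular_def)
    then have "prob (Y -` C \<inter> space M) = 0" by (simp add: measure_distr C')
    moreover have "Y -` C \<inter> space M \<in> events" using measurable_sets[OF assms(1) C'] .
    ultimately have "Y -` C \<inter> space M \<in> null_sets M" by (simp add: emeasure_eq_measure null_setsI)
    then show ?thesis by (rule AE_I') auto
  qed
  define T where "T a b n = {(u, v). envelope h b n u v - envelope h (- n) a u v = 0}" for a b n :: real
  have ae: "AE \<omega> in M. \<forall>a\<in>\<rat>. \<forall>b\<in>\<rat>. \<forall>n::nat.
      - real n \<le> a \<and> a < b \<and> b \<le> real n \<and> a + h a < b + h b \<and> a - h a < b - h b \<longrightarrow> Y \<omega> \<notin> T a b (real n)"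
  proof -
    have "AE \<omega> in M. - real n \<le> a \<and> a < b \<and> b \<le> real n \<and> a + h a < b + h b \<and> a - h a < b - h b \<longrightarrow> Y \<omega> \<notin> T a b (real n)"
      for a b :: real and n :: nat
    proof (cases "- real n \<le> a \<and> a < b \<and> b \<le> real n \<and> a + h a < b + h b \<and> a - h a < b - h b")
      case True
      then have D: "T a b (real n) \<in> D_family" unfolding T_def by (intro tie_set_in_D_family h) auto
      have "closed (T a b (real n))" by (rule closed_D_family[OF D])
      from null[OF D this] show ?thesis by eventually_elim simp
    qed auto
    then show ?thesis by (simp add: AE_ball_countable countable_rat AE_all_countable)
  qed
  then show ?thesis
  proof eventually_elim
    case (elim \<omega>)
    obtain u v where Y: "Y \<omega> = (u, v)" by (cases "Y \<omega>")
    show ?case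
    proof (intro allI impI)
      fix s t assume st: "s \<in> minimizers h (Y \<omega>)" "t \<in> minimizers h (Y \<omega>)" "s < t"
      show "s + h s = t + h t \<or> s - h s = t - h t"
      proof (rule ccontr)
        assume "\<not> (s + h s = t + h t \<or> s - h s = t - h t)"
        then have "s + h s < t + h t" "s - h s < t - h t"
          using nonexpansive_mono_fst[OF h, of s t] nonexpansive_mono_snd[OF h, of s t] st(3) by auto
        from strict_ties_rational[OF h st(3) this] obtain a b where
          ab: "a \<in> \<rat>" "b \<in> \<rat>" "s < a" "a < b" "b < t" "a + h a < b + h b" "a - h a < b - h b" by blast
        obtain n :: nat where n: "max \<bar>s\<bar> \<bar>t\<bar> \<le> real n" using real_arch_simple by blast
        have "envelope h (- real n) a u v = u * v - cost (curve h s) (u, v)"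
          "envelope h b (real n) u v = u * v - cost (curve h t) (u, v)"
          using st ab n Y by (auto intro!: envelope_minimizer[OF h])
        moreover have "cost (curve h s) (u, v) = cost (curve h t) (u, v)"
          using st Y unfolding minimizers_def by (auto intro: antisym)
        ultimately have "Y \<omega> \<in> T a b (real n)" by (simp add: T_def Y)
        moreover have "- real n \<le> a" "b \<le> real n" using ab n by auto
        ultimately show False using elim ab by blast
      qed
    qed
  qed
qed

text \<open>In a common column the first factors of the two costs agree and the second factors
  differ, so equal costs force the first factor to be 0. The cost is then 0, which by
  \<open>minimizer_cost_eq_0\<close> puts y on the curve.\<close>

lemma tie_same_fst:
  assumes "s \<in> minimizers h (u, v)" "t \<in> minimizers h (u, v)" "s \<noteq> t" "s + h s = t + h t"
  shows "u = t + h t" "cost (curve h t) (u, v) = 0"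
proof -
  have "cost (curve h s) (u, v) = cost (curve h t) (u, v)"
    using assms(1,2) unfolding minimizers_def by (auto intro: antisym)
  then have "(t + h t - u) * (s - h s - v) = (t + h t - u) * (t - h t - v)"
    unfolding cost_curve_expand assms(4) .
  moreover have "s - h s \<noteq> t - h t" using assms(3,4) by auto
  ultimately show "u = t + h t" by auto
  then show "cost (curve h t) (u, v) = 0" by (simp add: cost_curve_expand)
qed

lemma tie_same_snd:
  assumes "s \<in> minimizers h (u, v)" "t \<in> minimizers h (u, v)" "s \<noteq> t" "s - h s = t - h t"
  shows "v = t - h t" "cost (curve h t) (u, v) = 0"
proof -
  have "cost (curve h s) (u, v) = cost (curve h t) (u, v)"
    using assms(1,2) unfolding minimizers_def by (auto intro: antisym)
  then have "(s + h s - u) * (t - h t - v) = (t + h t - u) * (t - h t - v)"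
    unfolding cost_curve_expand assms(4) .
  moreover have "s + h s \<noteq> t + h t" using assms(3,4) by auto
  ultimately show "v = t - h t" by auto
  then show "cost (curve h t) (u, v) = 0" by (simp add: cost_curve_expand)
qed

section \<open>Vertical and horizontal segments of a curve\<close>

definition columns :: "(real \<Rightarrow> real) \<Rightarrow> real set" where
  "columns h = {r. \<exists>s t. s < t \<and> s + h s = r \<and> t + h t = r}"

lemma column_between:
  assumes "nonexpansive h" "s \<le> q" "q \<le> t" "s + h s = r" "t + h t = r"
  shows "q + h q = r"
  using nonexpansive_mono_fst[OF assms(1,2)] nonexpansive_mono_fst[OF assms(1,3)] assms(4,5) by linarith

text \<open>Segments above different abscissas occupy disjoint parameter intervals, and each
  contains a rational.\<close>

lemma countable_columns:
  assumes h: "nonexpansive h" shows "countable (columns h)"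
proof (rule countable_subset)
  show "columns h \<subseteq> (\<lambda>q. q + h q) ` \<rat>"
  proof
    fix r assume "r \<in> columns h"
    then obtain s t where st: "s < t" "s + h s = r" "t + h t = r" by (auto simp: columns_def)
    obtain q where "q \<in> \<rat>" "s < q" "q < t" using Rats_dense_in_real[OF st(1)] by blast
    then show "r \<in> (\<lambda>q. q + h q) ` \<rat>" using column_between[OF h _ _ st(2,3), of q] by (intro image_eqI[of _ _ q]) auto
  qed
qed (simp add: countable_rat)

lemma rows_eq_columns: "{r. \<exists>s t. s < t \<and> s - h s = r \<and> t - h t = r} = columns (\<lambda>t. - h t)"
  by (auto simp: columns_def)

lemma nonexpansive_uminus: "nonexpansive h \<Longrightarrow> nonexpansive (\<lambda>t. - h t)"
  unfolding nonexpansive_def by (simp add: abs_minus_commute)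

lemma (in prob_space) AE_not_in_countable:
  assumes [measurable]: "W \<in> borel_measurable M" and at: "atomless_law M W" and C: "countable C"
  shows "AE \<omega> in M. W \<omega> \<notin> C"
proof -
  have "AE \<omega> in M. W \<omega> \<noteq> x" for x
  proof -
    have "prob (W -` {x} \<inter> space M) = 0"
      using at by (simp add: atomless_law_def measure_distr)
    moreover have "W -` {x} \<inter> space M \<in> events" by measurable
    ultimately have "W -` {x} \<inter> space M \<in> null_sets M" by (simp add: emeasure_eq_measure null_setsI)
    then show ?thesis by (rule AE_I') auto
  qed
  then have "AE \<omega> in M. \<forall>x\<in>C. W \<omega> \<noteq> x" using C by (simp add: AE_ball_countable)
  then show ?thesis by eventually_elim auto
qed

lemma (in prob_space) AE_minimizer_unique:
  assumes [measurable]: "U \<in> borel_measurable M" "V \<in> borel_measurable M"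
    and D: "D_regular (distr M borel (\<lambda>\<omega>. (U \<omega>, V \<omega>)))" and h: "nonexpansive h"
    and at: "atomless_law M U" "atomless_law M V"
  shows "AE \<omega> in M. \<forall>s t. s \<in> minimizers h (U \<omega>, V \<omega>) \<longrightarrow> t \<in> minimizers h (U \<omega>, V \<omega>) \<longrightarrow> s = t"
proof -
  have [measurable]: "(\<lambda>\<omega>. (U \<omega>, V \<omega>)) \<in> M \<rightarrow>\<^sub>M borel"
    by (simp add: borel_prod[symmetric])
  have "AE \<omega> in M. U \<omega> \<notin> columns h"
    by (rule AE_not_in_countable) (use at countable_columns[OF h] in auto)
  moreover have "AE \<omega> in M. V \<omega> \<notin> columns (\<lambda>t. - h t)"
    by (rule AE_not_in_countable) (use at countable_columns[OF nonexpansive_uminus[OF h]] in auto)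
  moreover note AE_no_strict_ties[OF _ D h]
  ultimately have "AE \<omega> in M. \<forall>s t. s \<in> minimizers h (U \<omega>, V \<omega>) \<longrightarrow> t \<in> minimizers h (U \<omega>, V \<omega>) \<longrightarrow> \<not> s < t"
  proof (simp, elim AE_mp, intro AE_I2 impI allI notI)
    fix \<omega> s t
    assume U: "U \<omega> \<notin> columns h" and V: "V \<omega> \<notin> columns (\<lambda>t. - h t)"
      and tie: "\<forall>s. s \<in> minimizers h (U \<omega>, V \<omega>) \<longrightarrow> (\<forall>t. t \<in> minimizers h (U \<omega>, V \<omega>) \<longrightarrow> s < t \<longrightarrow>
            s + h s = t + h t \<or> s - h s = t - h t)"
      and st: "s \<in> minimizers h (U \<omega>, V \<omega>)" "t \<in> minimizers h (U \<omega>, V \<omega>)" "s < t"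
    from tie st consider "s + h s = t + h t" | "s - h s = t - h t" by blast
    then show False
    proof cases
      case 1
      with tie_same_fst(1)[OF st(1,2) _ 1] st(3) U show False by (force simp: columns_def)
    next
      case 2
      with tie_same_snd(1)[OF st(1,2) _ 2] st(3) V show False by (force simp: rows_eq_columns[symmetric])
    qed
  qed
  then show ?thesis by eventually_elim (metis linorder_neqE)
qed

section \<open>Weak duality\<close>

lemma measurable_fst_borel [measurable]:
  "fst \<in> (borel :: ('a::second_countable_topology \<times> 'b::second_countable_topology) measure) \<rightarrow>\<^sub>M borel"
  by (simp add: borel_prod[symmetric])

lemma measurable_snd_borel [measurable]:
  "snd \<in> (borel :: ('a::second_countable_topology \<times> 'b::second_countable_topology) measure) \<rightarrow>\<^sub>M borel"
  by (simp add: borel_prod[symmetric])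

lemma borel_measurable_nonexpansive [measurable]: "nonexpansive h \<Longrightarrow> h \<in> borel_measurable borel"
  by (intro borel_measurable_continuous_onI nonexpansive_continuous_on)

lemma borel_measurable_curve [measurable]:
  assumes [measurable]: "nonexpansive h" "f \<in> borel_measurable M"
  shows "(\<lambda>x. curve h (f x)) \<in> M \<rightarrow>\<^sub>M borel"
  unfolding curve_def by measurable

lemma subalgebra_vimage_algebra:
  assumes "f \<in> M \<rightarrow>\<^sub>M N" shows "subalgebra M (vimage_algebra (space M) f N)"
  unfolding subalgebra_def using assms
  by (auto simp: sets_vimage_algebra2 measurable_space dest: measurable_sets)

lemma (in prob_space) finite_measure_subalgebra_vimage:
  "f \<in> M \<rightarrow>\<^sub>M N \<Longrightarrow> finite_measure_subalgebra M (vimage_algebra (space M) f N)"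
  by (intro finite_measure_subalgebra.intro finite_measure_axioms finite_measure_subalgebra_axioms.intro
      subalgebra_vimage_algebra)

lemma measurable_vimage_algebra_compose:
  assumes "f \<in> M \<rightarrow>\<^sub>M N" "g \<in> N \<rightarrow>\<^sub>M L"
  shows "(\<lambda>x. g (f x)) \<in> vimage_algebra (space M) f N \<rightarrow>\<^sub>M L"
  using assms measurable_space[OF assms(1)]
  by (intro measurable_compose[OF measurable_vimage_algebra1]) auto

lemma integrable_mult_squares:
  fixes f g :: "'a \<Rightarrow> real"
  assumes [measurable]: "f \<in> borel_measurable M" "g \<in> borel_measurable M"
    and "integrable M (\<lambda>x. (f x)\<^sup>2)" "integrable M (\<lambda>x. (g x)\<^sup>2)"
  shows "integrable M (\<lambda>x. f x * g x)"
proof (rule Bochner_Integration.integrable_bound)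
  show "integrable M (\<lambda>x. (f x)\<^sup>2 + (g x)\<^sup>2)" using assms by simp
  show "AE x in M. norm (f x * g x) \<le> norm ((f x)\<^sup>2 + (g x)\<^sup>2)"
  proof (rule AE_I2)
    fix x
    have "0 \<le> (\<bar>f x\<bar> - \<bar>g x\<bar>)\<^sup>2" by simp
    also have "\<dots> = (f x)\<^sup>2 + (g x)\<^sup>2 - 2 * \<bar>f x * g x\<bar>"
      by (simp add: power2_diff abs_mult)
    finally have "2 * \<bar>f x * g x\<bar> \<le> (f x)\<^sup>2 + (g x)\<^sup>2" by simp
    then show "norm (f x * g x) \<le> norm ((f x)\<^sup>2 + (g x)\<^sup>2)" using abs_ge_zero[of "f x * g x"] by simp
  qed
qed simp

lemma (in prob_space) integrable_of_square:
  fixes f :: "'a \<Rightarrow> real"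
  assumes "f \<in> borel_measurable M" "integrable M (\<lambda>x. (f x)\<^sup>2)"
  shows "integrable M f"
  using square_integrable_imp_integrable[OF assms] .

lemma integrable_add_squares:
  fixes f g :: "'a \<Rightarrow> real"
  assumes [measurable]: "f \<in> borel_measurable M" "g \<in> borel_measurable M"
    and "integrable M (\<lambda>x. (f x)\<^sup>2)" "integrable M (\<lambda>x. (g x)\<^sup>2)"
  shows "integrable M (\<lambda>x. (f x + g x)\<^sup>2)" "integrable M (\<lambda>x. (f x - g x)\<^sup>2)"
  using assms(3,4) integrable_mult_squares[OF assms] by (simp_all add: power2_sum power2_diff mult.assoc)

lemma integrable_square_bound:
  fixes f g :: "'a \<Rightarrow> real"
  assumes [measurable]: "f \<in> borel_measurable M"
    and "integrable M (\<lambda>x. (g x)\<^sup>2)" "\<And>x. \<bar>f x\<bar> \<le> \<bar>g x\<bar>"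
  shows "integrable M (\<lambda>x. (f x)\<^sup>2)"
  by (rule Bochner_Integration.integrable_bound[OF assms(2)])
     (use assms(3) in \<open>auto simp: abs_le_square_iff\<close>)

lemma integrable_abs_square: "integrable M (\<lambda>x. (f x :: real)\<^sup>2) \<Longrightarrow> integrable M (\<lambda>x. \<bar>f x\<bar>\<^sup>2)"
  by simp

text \<open>The right-hand side depends only on the joint law of x and w. It carries the martingale
  condition from M to the law of a plan, and from the information of R to that of R together with
  its price.\<close>

lemma (in prob_space) cond_exp_vimage_iff:
  fixes x :: "'a \<Rightarrow> 'b::topological_space" and w :: "'a \<Rightarrow> real"
  assumes [measurable]: "x \<in> M \<rightarrow>\<^sub>M borel" "g \<in> borel_measurable borel"
    and w: "integrable M w" and gx: "integrable M (\<lambda>\<omega>. g (x \<omega>))"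
  shows "(AE \<omega> in M. real_cond_exp M (vimage_algebra (space M) x borel) w \<omega> = g (x \<omega>)) \<longleftrightarrow>
    (\<forall>A\<in>sets borel. (\<integral>\<omega>. indicator A (x \<omega>) * w \<omega> \<partial>M) = (\<integral>\<omega>. indicator A (x \<omega>) * g (x \<omega>) \<partial>M))"
proof -
  let ?F = "vimage_algebra (space M) x borel"
  interpret finite_measure_subalgebra M ?F by (rule finite_measure_subalgebra_vimage) measurable
  have [measurable]: "w \<in> borel_measurable M" using w by simp
  have int: "integrable M (\<lambda>\<omega>. indicator A (x \<omega>) * f \<omega>)" if "integrable M f" "A \<in> sets borel" for A and f :: "'a \<Rightarrow> real"
    by (rule Bochner_Integration.integrable_bound[OF that(1)]) (use that in \<open>auto simp: indicator_def\<close>)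
  show ?thesis
  proof
    assume ae: "AE \<omega> in M. real_cond_exp M ?F w \<omega> = g (x \<omega>)"
    show "\<forall>A\<in>sets borel. (\<integral>\<omega>. indicator A (x \<omega>) * w \<omega> \<partial>M) = (\<integral>\<omega>. indicator A (x \<omega>) * g (x \<omega>) \<partial>M)"
    proof
      fix A :: "'b set" assume A [measurable]: "A \<in> sets borel"
      have "(\<integral>\<omega>. indicator A (x \<omega>) * w \<omega> \<partial>M) = (\<integral>\<omega>. indicator A (x \<omega>) * real_cond_exp M ?F w \<omega> \<partial>M)"
        by (intro real_cond_exp_intg(2)[symmetric] int w A measurable_vimage_algebra_compose[of x M borel "indicator A"])
           auto
      also have "\<dots> = (\<integral>\<omega>. indicator A (x \<omega>) * g (x \<omega>) \<partial>M)"
        by (rule integral_cong_AE) (use ae in auto)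
      finally show "(\<integral>\<omega>. indicator A (x \<omega>) * w \<omega> \<partial>M) = (\<integral>\<omega>. indicator A (x \<omega>) * g (x \<omega>) \<partial>M)" .
    qed
  next
    assume *: "\<forall>A\<in>sets borel. (\<integral>\<omega>. indicator A (x \<omega>) * w \<omega> \<partial>M) = (\<integral>\<omega>. indicator A (x \<omega>) * g (x \<omega>) \<partial>M)"
    show "AE \<omega> in M. real_cond_exp M ?F w \<omega> = g (x \<omega>)"
    proof (rule real_cond_exp_charact[OF _ w gx])
      show "(\<lambda>\<omega>. g (x \<omega>)) \<in> borel_measurable ?F" by (rule measurable_vimage_algebra_compose) measurable
      fix B assume "B \<in> sets ?F"
      then obtain A where A: "A \<in> sets borel" "B = x -` A \<inter> space M" by (auto simp: sets_vimage_algebra2)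
      have eq: "(\<integral>\<omega>\<in>B. f \<omega> \<partial>M) = (\<integral>\<omega>. indicator A (x \<omega>) * f \<omega> \<partial>M)" for f :: "'a \<Rightarrow> real"
        unfolding set_lebesgue_integral_def A(2) by (intro Bochner_Integration.integral_cong) (auto simp: indicator_def)
      show "(\<integral>\<omega>\<in>B. w \<omega> \<partial>M) = (\<integral>\<omega>\<in>B. g (x \<omega>) \<partial>M)" unfolding eq using * A(1) by blast
    qed
  qed
qed

lemma the_minimizer_unique:
  "\<exists>!t. t \<in> minimizers h y \<Longrightarrow> t \<in> minimizers h y \<Longrightarrow> the_minimizer h y = t"
  unfolding the_minimizer_def by (simp add: the1_equality)

lemma minimizersI:
  assumes "x = curve h t" "\<And>s. cost x y \<le> cost (curve h s) y"
  shows "t \<in> minimizers h y"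
  using assms by (simp add: minimizers_def)

text \<open>Random variables x, u, v on any probability space are allowed, so that the statement
  serves maps on M as well as plans, where x is the first projection. The bound \<psi> is any
  integrable minorant of the costs along the curve, which avoids integrating the infimum
  itself.\<close>

lemma (in prob_space) weak_duality:
  fixes x :: "'a \<Rightarrow> real \<times> real" and u v :: "'a \<Rightarrow> real"
  assumes [measurable]: "x \<in> M \<rightarrow>\<^sub>M borel" "u \<in> borel_measurable M" "v \<in> borel_measurable M"
    and sq: "integrable M (\<lambda>\<omega>. (norm (x \<omega>))\<^sup>2)" "integrable M (\<lambda>\<omega>. (u \<omega>)\<^sup>2)" "integrable M (\<lambda>\<omega>. (v \<omega>)\<^sup>2)"
    and ceu: "AE \<omega> in M. real_cond_exp M (vimage_algebra (space M) x borel) u \<omega> = fst (x \<omega>)"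
    and cev: "AE \<omega> in M. real_cond_exp M (vimage_algebra (space M) x borel) v \<omega> = snd (x \<omega>)"
    and h: "nonexpansive h"
  defines "\<tau> \<equiv> \<lambda>\<omega>. (fst (x \<omega>) + snd (x \<omega>)) / 2"
  shows "integrable M (\<lambda>\<omega>. cost (x \<omega>) (u \<omega>, v \<omega>))"
    and "\<And>\<psi>. integrable M \<psi> \<Longrightarrow> AE \<omega> in M. \<forall>t. \<psi> \<omega> \<le> cost (curve h t) (u \<omega>, v \<omega>) \<Longrightarrow>
      (\<integral>\<omega>. \<psi> \<omega> \<partial>M) \<le> (\<integral>\<omega>. cost (x \<omega>) (u \<omega>, v \<omega>) \<partial>M)"
    and "\<And>\<psi>. integrable M \<psi> \<Longrightarrow> AE \<omega> in M. \<forall>t. \<psi> \<omega> \<le> cost (curve h t) (u \<omega>, v \<omega>) \<Longrightarrow>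
      (\<integral>\<omega>. cost (x \<omega>) (u \<omega>, v \<omega>) \<partial>M) \<le> (\<integral>\<omega>. \<psi> \<omega> \<partial>M) \<Longrightarrow>
      AE \<omega> in M. x \<omega> = curve h (\<tau> \<omega>) \<and> cost (x \<omega>) (u \<omega>, v \<omega>) = \<psi> \<omega>"
proof -
  let ?F = "vimage_algebra (space M) x borel"
  interpret finite_measure_subalgebra M ?F by (rule finite_measure_subalgebra_vimage) measurable
  note [measurable] = h
  have [measurable]: "\<tau> \<in> borel_measurable M" unfolding \<tau>_def by measurable
  have sqx: "integrable M (\<lambda>\<omega>. (fst (x \<omega>))\<^sup>2)" "integrable M (\<lambda>\<omega>. (snd (x \<omega>))\<^sup>2)"
    by (rule Bochner_Integration.integrable_bound[OF sq(1)]; simp add: norm_prod_def)+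
  \<comment> \<open>Signed displacement along the antidiagonal: the curve point at \<tau> is x + (d,
    -d).\<close>
  define d where "d = (\<lambda>\<omega>. h (\<tau> \<omega>) - (fst (x \<omega>) - snd (x \<omega>)) / 2)"
  have [measurable]: "d \<in> borel_measurable M" unfolding d_def by measurable
  have dF: "d \<in> borel_measurable ?F"
    unfolding d_def \<tau>_def by (rule measurable_vimage_algebra_compose[of x M borel
        "\<lambda>x. h ((fst x + snd x) / 2) - (fst x - snd x) / 2"]) measurable
  have sqd: "integrable M (\<lambda>\<omega>. (d \<omega>)\<^sup>2)"
  proof (rule integrable_square_bound)
    show "integrable M (\<lambda>\<omega>. (\<bar>h 0\<bar> + (\<bar>fst (x \<omega>)\<bar> + \<bar>snd (x \<omega>)\<bar>))\<^sup>2)"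
      by (intro integrable_add_squares integrable_abs_square sqx) (auto simp: sqx)
    show "\<bar>d \<omega>\<bar> \<le> \<bar>\<bar>h 0\<bar> + (\<bar>fst (x \<omega>)\<bar> + \<bar>snd (x \<omega>)\<bar>)\<bar>" for \<omega>
    proof -
      have "\<bar>d \<omega>\<bar> \<le> \<bar>h 0\<bar> + (\<bar>fst (x \<omega>)\<bar> + \<bar>snd (x \<omega>)\<bar>)"
      proof -
        have "\<bar>h (\<tau> \<omega>)\<bar> \<le> \<bar>h 0\<bar> + \<bar>\<tau> \<omega>\<bar>"
          using nonexpansiveD[OF h, of "\<tau> \<omega>" 0] by linarith
        moreover have "\<bar>\<tau> \<omega>\<bar> \<le> (\<bar>fst (x \<omega>)\<bar> + \<bar>snd (x \<omega>)\<bar>) / 2"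
          "\<bar>(fst (x \<omega>) - snd (x \<omega>)) / 2\<bar> \<le> (\<bar>fst (x \<omega>)\<bar> + \<bar>snd (x \<omega>)\<bar>) / 2"
          by (simp_all add: \<tau>_def)
        moreover have "\<bar>d \<omega>\<bar> \<le> \<bar>h (\<tau> \<omega>)\<bar> + \<bar>(fst (x \<omega>) - snd (x \<omega>)) / 2\<bar>"
          unfolding d_def by (rule abs_triangle_ineq4)
        ultimately show ?thesis by argo
      qed
      then show ?thesis by linarith
    qed
  qed measurable
  have sqxu: "integrable M (\<lambda>\<omega>. (fst (x \<omega>) - u \<omega>)\<^sup>2)" "integrable M (\<lambda>\<omega>. (snd (x \<omega>) - v \<omega>)\<^sup>2)"
    by (intro integrable_add_squares sqx sq; measurable)+
  show int: "integrable M (\<lambda>\<omega>. cost (x \<omega>) (u \<omega>, v \<omega>))"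
    unfolding cost_def fst_conv snd_conv by (intro integrable_mult_squares sqxu) measurable
  \<comment> \<open>d depends on x alone, so it is orthogonal to fst x - u and to snd x - v.\<close>
  have orth: "integrable M (\<lambda>\<omega>. d \<omega> * (g \<omega> - w \<omega>)) \<and> (\<integral>\<omega>. d \<omega> * (g \<omega> - w \<omega>) \<partial>M) = 0"
    if [measurable]: "w \<in> borel_measurable M" "g \<in> borel_measurable M"
      and w: "integrable M (\<lambda>\<omega>. (w \<omega>)\<^sup>2)" "integrable M (\<lambda>\<omega>. (g \<omega>)\<^sup>2)"
      "AE \<omega> in M. real_cond_exp M ?F w \<omega> = g \<omega>" for w g
  proof -
    have i: "integrable M (\<lambda>\<omega>. d \<omega> * w \<omega>)" "integrable M (\<lambda>\<omega>. d \<omega> * g \<omega>)"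
      by (intro integrable_mult_squares sqd w; measurable)+
    have "(\<integral>\<omega>. d \<omega> * g \<omega> \<partial>M) = (\<integral>\<omega>. d \<omega> * real_cond_exp M ?F w \<omega> \<partial>M)"
      by (rule integral_cong_AE) (use w(3) in auto)
    also have "\<dots> = (\<integral>\<omega>. d \<omega> * w \<omega> \<partial>M)" by (rule real_cond_exp_intg(2)[OF i(1) dF]) measurable
    finally show ?thesis using i by (simp add: right_diff_distrib)
  qed
  note ou = orth[OF _ _ sq(2) sqx(1) ceu] and ov = orth[OF _ _ sq(3) sqx(2) cev]
  define z where "z \<omega> = cost (curve h (\<tau> \<omega>)) (u \<omega>, v \<omega>)" for \<omega>
  have zeq: "z \<omega> = cost (x \<omega>) (u \<omega>, v \<omega>) + d \<omega> * (snd (x \<omega>) - v \<omega>) - d \<omega> * (fst (x \<omega>) - u \<omega>) - (d \<omega>)\<^sup>2" for \<omega>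
  proof -
    have "curve h (\<tau> \<omega>) = (fst (x \<omega>) + d \<omega>, snd (x \<omega>) - d \<omega>)"
      unfolding curve_def d_def \<tau>_def by (simp add: field_simps)
    then show ?thesis unfolding z_def cost_def by (simp add: algebra_simps power2_eq_square)
  qed
  have intz: "integrable M z" unfolding zeq using int ou ov sqd by simp
  have Ez: "(\<integral>\<omega>. cost (x \<omega>) (u \<omega>, v \<omega>) \<partial>M) = (\<integral>\<omega>. z \<omega> \<partial>M) + (\<integral>\<omega>. (d \<omega>)\<^sup>2 \<partial>M)"
    unfolding zeq using int ou ov sqd by simp
  have d0: "0 \<le> (\<integral>\<omega>. (d \<omega>)\<^sup>2 \<partial>M)" by simp
  fix \<psi> :: "'a \<Rightarrow> real"
  assume \<psi>: "integrable M \<psi>" "AE \<omega> in M. \<forall>t. \<psi> \<omega> \<le> cost (curve h t) (u \<omega>, v \<omega>)"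
  have ae: "AE \<omega> in M. \<psi> \<omega> \<le> z \<omega>" using \<psi>(2) by eventually_elim (simp add: z_def)
  have le: "(\<integral>\<omega>. \<psi> \<omega> \<partial>M) \<le> (\<integral>\<omega>. z \<omega> \<partial>M)" by (rule integral_mono_AE[OF \<psi>(1) intz ae])
  show "(\<integral>\<omega>. \<psi> \<omega> \<partial>M) \<le> (\<integral>\<omega>. cost (x \<omega>) (u \<omega>, v \<omega>) \<partial>M)" using le Ez d0 by linarith
  assume opt: "(\<integral>\<omega>. cost (x \<omega>) (u \<omega>, v \<omega>) \<partial>M) \<le> (\<integral>\<omega>. \<psi> \<omega> \<partial>M)"
  \<comment> \<open>The gap between the mean of \<psi> and the mean cost of x is E(z - \<psi>) +
    E(d^2), a sum of two nonnegative terms that must both vanish.\<close>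
  have "(\<integral>\<omega>. (d \<omega>)\<^sup>2 \<partial>M) = 0" "(\<integral>\<omega>. z \<omega> - \<psi> \<omega> \<partial>M) = 0"
  proof -
    show "(\<integral>\<omega>. (d \<omega>)\<^sup>2 \<partial>M) = 0" using le Ez d0 opt by linarith
    then show "(\<integral>\<omega>. z \<omega> - \<psi> \<omega> \<partial>M) = 0" using le Ez opt intz \<psi>(1) by simp
  qed
  then have "AE \<omega> in M. (d \<omega>)\<^sup>2 = 0" "AE \<omega> in M. z \<omega> - \<psi> \<omega> = 0"
    using integral_nonneg_eq_0_iff_AE[OF sqd] integral_nonneg_eq_0_iff_AE[of M "\<lambda>\<omega>. z \<omega> - \<psi> \<omega>"] ae intz \<psi>(1)
    by auto
  then show "AE \<omega> in M. x \<omega> = curve h (\<tau> \<omega>) \<and> cost (x \<omega>) (u \<omega>, v \<omega>) = \<psi> \<omega>"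
  proof eventually_elim
    case (elim \<omega>)
    then have "d \<omega> = 0" by simp
    then have "x \<omega> = curve h (\<tau> \<omega>)"
      unfolding curve_def d_def \<tau>_def by (cases "x \<omega>") (simp add: field_simps)
    then show ?case using elim unfolding z_def by simp
  qed
qed


section \<open>Optimal maps and plans from a supporting curve\<close>

context prob_space
begin

context
  fixes U V :: "'a \<Rightarrow> real" and h :: "real \<Rightarrow> real" and X :: "'a \<Rightarrow> real \<times> real"
  assumes U [measurable]: "U \<in> borel_measurable M" and V [measurable]: "V \<in> borel_measurable M"
    and U2: "integrable M (\<lambda>\<omega>. (U \<omega>)\<^sup>2)" and V2: "integrable M (\<lambda>\<omega>. (V \<omega>)\<^sup>2)"
    and D: "D_regular (distr M borel (\<lambda>\<omega>. (U \<omega>, V \<omega>)))"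
    and atU: "atomless_law M U" and atV: "atomless_law M V"
    and h [measurable]: "nonexpansive h"
    and X: "X \<in> admissible_maps M U V"
    and supp: "AE \<omega> in M. \<forall>t. cost (X \<omega>) (U \<omega>, V \<omega>) \<le> cost (curve h t) (U \<omega>, V \<omega>)"
begin

lemma admissible_measurable:
  assumes "X' \<in> admissible_maps M U V" shows "X' \<in> M \<rightarrow>\<^sub>M borel"
proof (rule measurable_from_subalg)
  show "subalgebra M (vimage_algebra (space M) (\<lambda>\<omega>. (U \<omega>, V \<omega>)) borel)"
    by (rule subalgebra_vimage_algebra) measurable
  show "X' \<in> vimage_algebra (space M) (\<lambda>\<omega>. (U \<omega>, V \<omega>)) borel \<rightarrow>\<^sub>M borel"
    using assms by (simp add: admissible_maps_def)
qed

lemmas admissible_weak_duality =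
  weak_duality[OF admissible_measurable U V _ U2 V2 _ _ h]

lemma X_measurable [measurable]: "X \<in> M \<rightarrow>\<^sub>M borel"
  by (rule admissible_measurable[OF X])

lemma integrable_cost_X: "integrable M (\<lambda>\<omega>. cost (X \<omega>) (U \<omega>, V \<omega>))"
  using X by (intro admissible_weak_duality(1)) (auto simp: admissible_maps_def)

text \<open>By \<open>supp\<close> the cost of X is itself a minorant of the costs along the curve,
  and it takes the role of \<psi>.\<close>

lemma X_optimal:
  assumes "X' \<in> admissible_maps M U V"
  shows "(\<integral>\<omega>. cost (X \<omega>) (U \<omega>, V \<omega>) \<partial>M) \<le> (\<integral>\<omega>. cost (X' \<omega>) (U \<omega>, V \<omega>) \<partial>M)"
  using assms by (intro admissible_weak_duality(2)[OF _ _ _ _ integrable_cost_X supp]) (auto simp: admissible_maps_def)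

text \<open>The equality case of the duality with the cost of X as \<psi>. Applied to X itself, it
  shows that X lies on the curve.\<close>

lemma optimal_on_curve:
  assumes "X' \<in> admissible_maps M U V"
    and "(\<integral>\<omega>. cost (X' \<omega>) (U \<omega>, V \<omega>) \<partial>M) \<le> (\<integral>\<omega>. cost (X \<omega>) (U \<omega>, V \<omega>) \<partial>M)"
  shows "AE \<omega> in M. X' \<omega> = curve h ((fst (X' \<omega>) + snd (X' \<omega>)) / 2) \<and>
    cost (X' \<omega>) (U \<omega>, V \<omega>) = cost (X \<omega>) (U \<omega>, V \<omega>)"
  using assms(1) by (intro admissible_weak_duality(3)[OF _ _ _ _ integrable_cost_X supp assms(2)])
    (auto simp: admissible_maps_def)

lemma AE_unique_minimizer: "AE \<omega> in M. \<exists>!t. t \<in> minimizers h (U \<omega>, V \<omega>)"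
  using AE_minimizer_unique[OF U V D h atU atV] optimal_on_curve[OF X order_refl] supp
proof eventually_elim
  case (elim \<omega>)
  have "(fst (X \<omega>) + snd (X \<omega>)) / 2 \<in> minimizers h (U \<omega>, V \<omega>)"
    using elim(2,3) by (intro minimizersI[of "X \<omega>"]) auto
  then show ?case using elim(1) by blast
qed

text \<open>A solution lies on the curve and costs no more than any curve point, so its parameter is
  the almost surely unique minimizer. Every solution is thus the same function of (U, V).\<close>

lemma optimal_eq_minimizer:
  assumes "X' \<in> admissible_maps M U V"
    and "(\<integral>\<omega>. cost (X' \<omega>) (U \<omega>, V \<omega>) \<partial>M) \<le> (\<integral>\<omega>. cost (X \<omega>) (U \<omega>, V \<omega>) \<partial>M)"
  shows "AE \<omega> in M. X' \<omega> = curve h (the_minimizer h (U \<omega>, V \<omega>))"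
  using AE_unique_minimizer optimal_on_curve[OF assms] supp
proof eventually_elim
  case (elim \<omega>)
  have "(fst (X' \<omega>) + snd (X' \<omega>)) / 2 \<in> minimizers h (U \<omega>, V \<omega>)"
    using elim(2,3) by (intro minimizersI[of "X' \<omega>"]) auto
  then have "the_minimizer h (U \<omega>, V \<omega>) = (fst (X' \<omega>) + snd (X' \<omega>)) / 2"
    using elim(1) by (intro the_minimizer_unique)
  then show ?case using elim(2) by metis
qed

lemma optimal_unique:
  assumes X': "X' \<in> admissible_maps M U V"
    and "\<forall>X''\<in>admissible_maps M U V.
      (\<integral>\<omega>. cost (X' \<omega>) (U \<omega>, V \<omega>) \<partial>M) \<le> (\<integral>\<omega>. cost (X'' \<omega>) (U \<omega>, V \<omega>) \<partial>M)"
  shows "AE \<omega> in M. X' \<omega> = X \<omega>"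
  using optimal_eq_minimizer[OF X' assms(2)[rule_format, OF X]] optimal_eq_minimizer[OF X order_refl]
  by eventually_elim simp

definition plan :: "((real \<times> real) \<times> (real \<times> real)) measure" where
  "plan = distr M borel (\<lambda>\<omega>. (X \<omega>, (U \<omega>, V \<omega>)))"

lemma plan_in_Gamma: "plan \<in> Gamma (distr M borel (\<lambda>\<omega>. (U \<omega>, V \<omega>)))"
proof -
  interpret P: prob_space plan unfolding plan_def by (rule prob_space_distr) measurable
  have XX: "integrable M (\<lambda>\<omega>. (norm (X \<omega>))\<^sup>2)"
    "AE \<omega> in M. real_cond_exp M (vimage_algebra (space M) X borel) U \<omega> = fst (X \<omega>)"
    "AE \<omega> in M. real_cond_exp M (vimage_algebra (space M) X borel) V \<omega> = snd (X \<omega>)"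
    using X by (auto simp: admissible_maps_def)
  have sqX: "integrable M (\<lambda>\<omega>. (fst (X \<omega>))\<^sup>2)" "integrable M (\<lambda>\<omega>. (snd (X \<omega>))\<^sup>2)"
    by (rule Bochner_Integration.integrable_bound[OF XX(1)]; simp add: norm_prod_def)+
  have int: "integrable M U" "integrable M V" "integrable M (\<lambda>\<omega>. fst (X \<omega>))" "integrable M (\<lambda>\<omega>. snd (X \<omega>))"
    by (rule integrable_of_square, measurable, fact)+
  have ce: "AE p in plan. real_cond_exp plan (vimage_algebra (space plan) fst borel) w p = g (fst p)"
    if [measurable]: "w \<in> borel_measurable borel" "g \<in> borel_measurable borel"
      and i: "integrable M (\<lambda>\<omega>. w (X \<omega>, (U \<omega>, V \<omega>)))" "integrable M (\<lambda>\<omega>. g (X \<omega>))"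
      and ae: "AE \<omega> in M. real_cond_exp M (vimage_algebra (space M) X borel) (\<lambda>\<omega>. w (X \<omega>, (U \<omega>, V \<omega>))) \<omega> = g (X \<omega>)"
    for w :: "(real \<times> real) \<times> (real \<times> real) \<Rightarrow> real" and g :: "real \<times> real \<Rightarrow> real"
  proof (subst P.cond_exp_vimage_iff)
    show "fst \<in> plan \<rightarrow>\<^sub>M borel" unfolding plan_def by simp
    show "integrable plan w" "integrable plan (\<lambda>\<omega>. g (fst \<omega>))"
      using i by (simp_all add: plan_def integrable_distr_eq)
    show "\<forall>A\<in>sets borel. (\<integral>\<omega>. indicator A (fst \<omega>) * w \<omega> \<partial>plan) = (\<integral>\<omega>. indicator A (fst \<omega>) * g (fst \<omega>) \<partial>plan)"
      using ae unfolding cond_exp_vimage_iff[OF X_measurable that(2) i]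
      by (simp add: plan_def integral_distr)
  qed measurable
  have "distr plan borel snd = distr M borel (\<lambda>\<omega>. (U \<omega>, V \<omega>))"
    unfolding plan_def by (subst distr_distr) (auto simp: comp_def)
  moreover have "integrable plan (\<lambda>p. (norm (fst p))\<^sup>2 + (norm (snd p))\<^sup>2)"
    using XX(1) U2 V2 by (simp add: plan_def integrable_distr_eq norm_Pair)
  moreover have "sets plan = sets borel" by (simp add: plan_def)
  moreover note ce[of "\<lambda>p. fst (snd p)" fst] ce[of "\<lambda>p. snd (snd p)" snd]
  ultimately show ?thesis
    using XX int P.prob_space_axioms unfolding Gamma_def by simp
qed

lemma integral_cost_plan: "(\<integral>p. cost (fst p) (snd p) \<partial>plan) = (\<integral>\<omega>. cost (X \<omega>) (U \<omega>, V \<omega>) \<partial>M)"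
  unfolding plan_def by (subst integral_distr) auto

text \<open>The minorant is now a function \<open>\<psi>\<close> of y alone, so its mean is the same
  under every plan with the given marginal. In the equality case the plan sits on the graph of a
  function of y and is determined by that marginal.\<close>

lemma Gamma_weak_duality:
  assumes \<gamma>: "\<gamma> \<in> Gamma (distr M borel (\<lambda>\<omega>. (U \<omega>, V \<omega>)))"
  shows "(\<integral>p. cost (fst p) (snd p) \<partial>plan) \<le> (\<integral>p. cost (fst p) (snd p) \<partial>\<gamma>)"
    and "(\<integral>p. cost (fst p) (snd p) \<partial>\<gamma>) \<le> (\<integral>p. cost (fst p) (snd p) \<partial>plan) \<Longrightarrow>
      \<gamma> = distr (distr M borel (\<lambda>\<omega>. (U \<omega>, V \<omega>))) borel (\<lambda>y. (curve h (the_minimizer h y), y))"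
proof -
  let ?\<nu> = "distr M borel (\<lambda>\<omega>. (U \<omega>, V \<omega>))"
  interpret G: prob_space \<gamma> using \<gamma> by (simp add: Gamma_def)
  have [measurable_cong]: "sets \<gamma> = sets borel" using \<gamma> by (simp add: Gamma_def)
  have \<nu>: "distr \<gamma> borel snd = ?\<nu>" using \<gamma> by (simp add: Gamma_def)
  have int: "integrable \<gamma> (\<lambda>p. (norm (fst p))\<^sup>2 + (norm (snd p))\<^sup>2)" using \<gamma> by (simp add: Gamma_def)
  have sq: "integrable \<gamma> (\<lambda>p. (norm (fst p))\<^sup>2)" "integrable \<gamma> (\<lambda>p. (fst (snd p))\<^sup>2)" "integrable \<gamma> (\<lambda>p. (snd (snd p))\<^sup>2)"
    by (rule Bochner_Integration.integrable_bound[OF int]; simp add: norm_prod_def)+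
  define \<psi> where "\<psi> y = cost (curve h (the_minimizer h y)) y" for y
  have [measurable]: "\<psi> \<in> borel_measurable borel" unfolding \<psi>_def by measurable
  have AE\<nu>: "AE y in ?\<nu>. \<exists>!t. t \<in> minimizers h y"
    by (subst AE_distr_iff) (use sets_unique_minimizer[OF h] AE_unique_minimizer in auto)
  have AE\<gamma>: "AE p in \<gamma>. \<exists>!t. t \<in> minimizers h (snd p)"
    by (rule AE_distrD[of snd \<gamma> borel]) (use AE\<nu> in \<open>simp_all only: \<nu>\<close>, simp)
  have X\<psi>: "AE \<omega> in M. cost (X \<omega>) (U \<omega>, V \<omega>) = \<psi> (U \<omega>, V \<omega>)"
    using optimal_eq_minimizer[OF X order_refl] by eventually_elim (simp add: \<psi>_def)
  have i\<psi>M: "integrable M (\<lambda>\<omega>. \<psi> (U \<omega>, V \<omega>))"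
    using integrable_cost_X by (subst (asm) integrable_cong_AE[OF _ _ X\<psi>]) auto
  then have "integrable ?\<nu> \<psi>" by (simp add: integrable_distr_eq)
  then have i\<psi>: "integrable \<gamma> (\<lambda>p. \<psi> (snd p))" unfolding \<nu>[symmetric] by (simp add: integrable_distr_eq)
  have "(\<integral>p. \<psi> (snd p) \<partial>\<gamma>) = (\<integral>y. \<psi> y \<partial>?\<nu>)" unfolding \<nu>[symmetric] by (simp add: integral_distr)
  also have "\<dots> = (\<integral>\<omega>. \<psi> (U \<omega>, V \<omega>) \<partial>M)" by (simp add: integral_distr)
  also have "\<dots> = (\<integral>\<omega>. cost (X \<omega>) (U \<omega>, V \<omega>) \<partial>M)" by (rule integral_cong_AE) (use X\<psi> in auto)
  finally have E\<psi>: "(\<integral>p. \<psi> (snd p) \<partial>\<gamma>) = (\<integral>p. cost (fst p) (snd p) \<partial>plan)" by (simp add: integral_cost_plan)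
  have min: "the_minimizer h y \<in> minimizers h y" if "\<exists>!t. t \<in> minimizers h y" for y
    using that the_minimizer_unique by (elim ex1E) metis
  have lower: "AE p in \<gamma>. \<forall>t. \<psi> (snd p) \<le> cost (curve h t) (fst (snd p), snd (snd p))"
    using AE\<gamma> by eventually_elim (use min in \<open>simp add: \<psi>_def minimizers_def\<close>)
  have ce: "AE p in \<gamma>. real_cond_exp \<gamma> (vimage_algebra (space \<gamma>) fst borel) (\<lambda>p. fst (snd p)) p = fst (fst p)"
    "AE p in \<gamma>. real_cond_exp \<gamma> (vimage_algebra (space \<gamma>) fst borel) (\<lambda>p. snd (snd p)) p = snd (fst p)"
    using \<gamma> by (auto simp: Gamma_def)
  note wd = G.weak_duality[OF _ _ _ sq ce h]
  show "(\<integral>p. cost (fst p) (snd p) \<partial>plan) \<le> (\<integral>p. cost (fst p) (snd p) \<partial>\<gamma>)"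
    using wd(2)[OF _ _ _ i\<psi> lower] E\<psi> by simp
  assume opt: "(\<integral>p. cost (fst p) (snd p) \<partial>\<gamma>) \<le> (\<integral>p. cost (fst p) (snd p) \<partial>plan)"
  have "AE p in \<gamma>. fst p = curve h ((fst (fst p) + snd (fst p)) / 2) \<and>
      cost (fst p) (fst (snd p), snd (snd p)) = \<psi> (snd p)"
    using wd(3)[OF _ _ _ i\<psi> lower] opt E\<psi> by simp
  then have supp: "AE p in \<gamma>. p = (curve h (the_minimizer h (snd p)), snd p)"
    using AE\<gamma>
  proof eventually_elim
    case (elim p)
    have "(fst (fst p) + snd (fst p)) / 2 \<in> minimizers h (snd p)"
      using elim(1) min[OF elim(2)] unfolding minimizers_def \<psi>_def by auto
    then have "the_minimizer h (snd p) = (fst (fst p) + snd (fst p)) / 2"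
      using elim(2) by (intro the_minimizer_unique)
    then have "fst p = curve h (the_minimizer h (snd p))" using elim(1) by metis
    then show ?case by (simp add: prod_eq_iff)
  qed
  have "\<gamma> = distr \<gamma> borel (\<lambda>p. p)"
    by (rule distr_id2[symmetric]) (use \<gamma> in \<open>simp add: Gamma_def\<close>)
  also have "\<dots> = distr \<gamma> borel (\<lambda>p. (curve h (the_minimizer h (snd p)), snd p))"
    by (rule distr_cong_AE) (use supp in auto)
  also have "\<dots> = distr (distr \<gamma> borel snd) borel (\<lambda>y. (curve h (the_minimizer h y), y))"
    by (subst distr_distr) (auto simp: comp_def)
  finally show "\<gamma> = distr ?\<nu> borel (\<lambda>y. (curve h (the_minimizer h y), y))" unfolding \<nu> .
qed

lemma plan_unique:
  assumes "\<gamma> \<in> Gamma (distr M borel (\<lambda>\<omega>. (U \<omega>, V \<omega>)))"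
    and "(\<integral>p. cost (fst p) (snd p) \<partial>\<gamma>) \<le> (\<integral>p. cost (fst p) (snd p) \<partial>plan)"
  shows "\<gamma> = plan"
  using Gamma_weak_duality(2)[OF assms] Gamma_weak_duality(2)[OF plan_in_Gamma order_refl] by simp

end

end

section \<open>Supporting curves of equilibria\<close>

text \<open>The insider's problem at one outcome in terms of the total order r = q + u, with the
  profit written as minus a cost. The sign condition is the comparison with q = 0; the last two
  clauses exclude infinite profits from selling at price \<infinity> or buying at price
  -\<infinity>.\<close>

definition price_optimal :: "(real \<Rightarrow> ereal) \<Rightarrow> real \<Rightarrow> real \<Rightarrow> real \<Rightarrow> real \<Rightarrow> bool" where
  "price_optimal f r s u v \<longleftrightarrow> f r = ereal s \<and> (r - u) * (s - v) \<le> 0 \<and>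
    (\<forall>r' s'. f r' = ereal s' \<longrightarrow> (r - u) * (s - v) \<le> (r' - u) * (s' - v)) \<and>
    (\<forall>r'. f r' = \<infinity> \<longrightarrow> u \<le> r') \<and> (\<forall>r'. f r' = -\<infinity> \<longrightarrow> r' \<le> u)"

lemma price_optimal_iff:
  "price_optimal f r s u v \<longleftrightarrow> f r = ereal s \<and>
    (\<forall>q::real. ereal q * (ereal v - f (q + u)) \<le> ereal (r - u) * (ereal v - ereal s))"
proof
  assume *: "price_optimal f r s u v"
  show "f r = ereal s \<and> (\<forall>q::real. ereal q * (ereal v - f (q + u)) \<le> ereal (r - u) * (ereal v - ereal s))"
  proof (intro conjI allI)
    show "f r = ereal s" using * by (simp add: price_optimal_def)
    fix q :: real
    show "ereal q * (ereal v - f (q + u)) \<le> ereal (r - u) * (ereal v - ereal s)"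
    proof (cases "f (q + u)")
      case (real s')
      then have "(r - u) * (s - v) \<le> (q + u - u) * (s' - v)" using * unfolding price_optimal_def by blast
      then show ?thesis using real by (simp add: algebra_simps)
    next
      case PInf
      then have "u \<le> q + u" using * unfolding price_optimal_def by blast
      moreover have "0 \<le> (r - u) * (v - s)" using * by (simp add: price_optimal_def algebra_simps)
      ultimately show ?thesis using PInf by (cases "q = 0") auto
    next
      case MInf
      then have "q + u \<le> u" using * unfolding price_optimal_def by blast
      moreover have "0 \<le> (r - u) * (v - s)" using * by (simp add: price_optimal_def algebra_simps)
      ultimately show ?thesis using MInf by (cases "q = 0") auto
    qed
  qed
next
  assume *: "f r = ereal s \<and> (\<forall>q::real. ereal q * (ereal v - f (q + u)) \<le> ereal (r - u) * (ereal v - ereal s))"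
  then have q: "ereal q * (ereal v - f (q + u)) \<le> ereal ((r - u) * (v - s))" for q by simp
  show "price_optimal f r s u v"
    unfolding price_optimal_def
  proof (intro conjI allI impI)
    show "f r = ereal s" using * by simp
    show "(r - u) * (s - v) \<le> 0" using q[of 0] by (simp add: zero_ereal_def[symmetric] algebra_simps)
  next
    fix r' s' assume "f r' = ereal s'"
    then show "(r - u) * (s - v) \<le> (r' - u) * (s' - v)" using q[of "r' - u"] by (simp add: algebra_simps)
  next
    fix r' assume "f r' = \<infinity>"
    then show "u \<le> r'" using q[of "r' - u"] by (cases "r' < u") auto
  next
    fix r' assume "f r' = -\<infinity>"
    then show "r' \<le> u" using q[of "r' - u"] by (cases "u < r'") auto
  qed
qed

text \<open>Changing the sign of all quantities exchanges buying and selling, so that an upper bound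
  for orders yields the lower bound too.\<close>

lemma price_optimal_reflect:
  assumes "price_optimal f r s u v"
  shows "price_optimal (\<lambda>x. - f (- x)) (- r) (- s) (- u) (- v)"
  unfolding price_optimal_def
proof (intro conjI allI impI)
  show "- f (- (- r)) = ereal (- s)" using assms by (simp add: price_optimal_def)
  show "(- r - - u) * (- s - - v) \<le> 0" using assms by (simp add: price_optimal_def algebra_simps)
next
  fix r' s' assume "- f (- r') = ereal s'"
  then have "f (- r') = ereal (- s')" by (metis ereal_uminus_uminus uminus_ereal.simps(1))
  then have "(r - u) * (s - v) \<le> (- r' - u) * (- s' - v)" using assms unfolding price_optimal_def by blast
  then show "(- r - - u) * (- s - - v) \<le> (r' - - u) * (s' - - v)" by (simp add: algebra_simps)
next
  fix r' assume "- f (- r') = \<infinity>"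
  then have "f (- r') = -\<infinity>" by (metis ereal_uminus_uminus)
  then have "- r' \<le> u" using assms unfolding price_optimal_def by blast
  then show "- u \<le> r'" by simp
next
  fix r' assume "- f (- r') = -\<infinity>"
  then have "f (- r') = \<infinity>" by (metis ereal_uminus_uminus)
  then have "u \<le> - r'" using assms unfolding price_optimal_def by blast
  then show "r' \<le> - u" by simp
qed

text \<open>If v < s, the insider sells, so r \<le> u. At the midpoint of m and r a finite price is
  still at least s, by monotonicity around m, so selling more there would earn strictly
  more.\<close>

lemma price_optimal_bias:
  assumes opt: "price_optimal f r s u v"
    and mono: "\<And>r' s'. f r' = ereal s' \<Longrightarrow> 0 \<le> (r' - m) * (s' - s)"
    and minf: "\<And>r'. f r' = -\<infinity> \<Longrightarrow> r' \<le> m"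
    and m: "m < r"
  shows "s \<le> v"
proof (rule ccontr)
  assume "\<not> s \<le> v" then have v: "v < s" by simp
  have le: "(r - u) * (s - v) \<le> 0" using opt by (simp add: price_optimal_def)
  then have u: "r \<le> u" using v by (simp add: mult_le_0_iff)
  define r' where "r' = (m + r) / 2"
  have r': "m < r'" "r' < r" using m by (auto simp: r'_def)
  show False
  proof (cases "f r'")
    case (real s')
    have "0 \<le> (r' - m) * (s' - s)" by (rule mono[OF real])
    then have s': "s \<le> s'" using r'(1) by (simp add: zero_le_mult_iff)
    have "(r - u) * (s - v) \<le> (r' - u) * (s' - v)" using opt real unfolding price_optimal_def by blast
    also have "\<dots> \<le> (r' - u) * (s - v)" using s' r'(2) u by (intro mult_left_mono_neg) auto
    also have "\<dots> < (r - u) * (s - v)" using r'(2) v by (intro mult_strict_right_mono) auto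
    finally show False by simp
  next
    case PInf
    then have "u \<le> r'" using opt unfolding price_optimal_def by blast
    then show False using u r'(2) by simp
  next
    case MInf
    then show False using minf r'(1) by force
  qed
qed

text \<open>The supporting curve: the boundary of the region below the increasing envelope
  of the price, parametrised along antidiagonals.\<close>

lemma price_optimal_curve:
  assumes "price_optimal f r0 s0 u0 v0"
  obtains h where "nonexpansive h"
    "\<And>r s u v t. price_optimal f r s u v \<Longrightarrow> cost (r, s) (u, v) \<le> cost (curve h t) (u, v)"
proof -
  \<comment> \<open>k belongs to H t when some order at or to the left of t + k has a price of at
    least t - k. The threshold \<open>h\<close> marks where the antidiagonal crosses the increasing
    envelope of f.\<close>
  define H where "H t = {k. \<exists>r\<le>t + k. ereal (t - k) \<le> f r}" for t
  define h where "h t = Inf (H t)" for t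
  have ne: "H t \<noteq> {}" for t
  proof -
    have "max (r0 - t) (t - s0) \<in> H t"
      unfolding H_def using assms by (auto simp: price_optimal_def intro!: exI[of _ r0])
    then show ?thesis by blast
  qed
  have bdd: "bdd_below (H t)" for t
  proof (rule bdd_belowI)
    fix k assume "k \<in> H t"
    then obtain r where r: "r \<le> t + k" "ereal (t - k) \<le> f r" by (auto simp: H_def)
    define \<psi> where "\<psi> = (r0 - u0) * (s0 - v0)"
    have \<psi>: "\<psi> \<le> 0" using assms by (simp add: price_optimal_def \<psi>_def)
    \<comment> \<open>Below this bound a point of the price graph would lie more than 1 - \<psi> to
      the left of u0 and more than 1 - \<psi> above v0; its cost would be at most -(1 - \<psi>)^2
      \<le> \<psi> - 1 < \<psi>.\<close>
    show "min (u0 - t) (t - v0) - 1 + \<psi> \<le> k"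
    proof (rule ccontr)
      assume "\<not> min (u0 - t) (t - v0) - 1 + \<psi> \<le> k"
      then have k: "1 - \<psi> < u0 - (t + k)" "1 - \<psi> < t - k - v0" by auto
      show False
      proof (cases "f r")
        case (real s)
        have "t - k \<le> s" using r(2) real by simp
        then have "1 - \<psi> < u0 - r" "1 - \<psi> < s - v0" using k r(1) by auto
        then have "(1 - \<psi>) * (1 - \<psi>) \<le> (u0 - r) * (s - v0)" using \<psi> by (intro mult_mono) auto
        moreover have "1 * (1 - \<psi>) \<le> (1 - \<psi>) * (1 - \<psi>)" using \<psi> by (intro mult_right_mono) auto
        moreover have "\<psi> \<le> (r - u0) * (s - v0)" using assms real unfolding price_optimal_def \<psi>_def by blast
        ultimately show False by (simp add: algebra_simps)
      next
        case PInf
        then have "u0 \<le> r" using assms unfolding price_optimal_def by blast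
        then show False using k \<psi> r(1) by simp
      next
        case MInf then show False using r(2) by simp
      qed
    qed
  qed
  have up: "k' \<in> H t" if "k \<in> H t" "k \<le> k'" for k k' t
  proof -
    from that(1) obtain r where r: "r \<le> t + k" "ereal (t - k) \<le> f r" by (auto simp: H_def)
    have "ereal (t - k') \<le> ereal (t - k)" using that(2) by simp
    then have "ereal (t - k') \<le> f r" using r(2) by (rule order_trans)
    then show ?thesis unfolding H_def using r(1) that(2) by (auto intro!: exI[of _ r])
  qed
  have in_H: "h t + e \<in> H t" if "e > 0" for t e
  proof -
    have "Inf (H t) < h t + e" using that by (simp add: h_def)
    from cInf_lessD[OF ne this] obtain k where "k \<in> H t" "k < h t + e" by blast
    then show ?thesis using up by simp
  qed
  have notin_H: "h t - e \<notin> H t" if "e > 0" for t e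
  proof
    assume "h t - e \<in> H t"
    then have "h t \<le> h t - e" unfolding h_def[of t] by (rule cInf_lower[OF _ bdd])
    then show False using that by simp
  qed
  have le: "h t' \<le> h t + \<bar>t' - t\<bar>" for t t'
  proof -
    have "h t' - \<bar>t' - t\<bar> \<le> Inf (H t)"
    proof (rule cInf_greatest[OF ne])
      fix k assume "k \<in> H t"
      then obtain r where r: "r \<le> t + k" "ereal (t - k) \<le> f r" by (auto simp: H_def)
      have "ereal (t' - (k + \<bar>t' - t\<bar>)) \<le> ereal (t - k)" by auto
      then have "ereal (t' - (k + \<bar>t' - t\<bar>)) \<le> f r" using r(2) by (rule order_trans)
      moreover have "r \<le> t' + (k + \<bar>t' - t\<bar>)" using r(1) by auto
      ultimately have "k + \<bar>t' - t\<bar> \<in> H t'" unfolding H_def by blast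
      then have "h t' \<le> k + \<bar>t' - t\<bar>" unfolding h_def by (rule cInf_lower[OF _ bdd])
      then show "h t' - \<bar>t' - t\<bar> \<le> k" by simp
    qed
    then show ?thesis by (simp add: h_def)
  qed
  have "nonexpansive h"
    unfolding nonexpansive_def using le by (auto simp: abs_le_iff abs_minus_commute) (smt (verit) le)+
  moreover have "cost (r, s) (u, v) \<le> cost (curve h t) (u, v)" if opt: "price_optimal f r s u v" for r s u v t
  proof -
    define a b where "a = t + h t" and "b = t - h t"
    define \<psi> where "\<psi> = (r - u) * (s - v)"
    have \<psi>0: "\<psi> \<le> 0" using opt by (simp add: price_optimal_def \<psi>_def)
    have fin: "\<psi> \<le> (r' - u) * (s' - v)" if "f r' = ereal s'" for r' s'
      using opt that unfolding price_optimal_def \<psi>_def by blast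
    \<comment> \<open>Curve points are only approached by actual prices, so the comparison holds up
      to an error e K with e arbitrarily small.\<close>
    have lim: "\<psi> \<le> (a - u) * (b - v)"
      if K: "K > 0" "e0 > 0" and le: "\<And>e. 0 < e \<Longrightarrow> e < e0 \<Longrightarrow> \<psi> \<le> (a - u) * (b - v) + e * K" for K e0
    proof (rule field_le_epsilon)
      fix e :: real assume e: "e > 0"
      define d where "d = min (e0 / 2) (e / K)"
      have "0 < d" "d < e0" "d * K \<le> e" using K e by (auto simp: d_def min_def field_simps)
      then show "\<psi> \<le> (a - u) * (b - v) + e" using le[of d] by linarith
    qed
    have "\<psi> \<le> (a - u) * (b - v)"
    proof (cases "0 \<le> (a - u) * (b - v)")
      case True then show ?thesis using \<psi>0 by simp
    next
      case False
      then consider "a < u" "v < b" | "u < a" "b < v" by (auto simp: not_le mult_less_0_iff)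
      then show ?thesis
      proof cases
        case 1
        show ?thesis
        proof (rule lim)
          show "0 < (b - v) + (u - a)" "0 < min (u - a) (b - v)" using 1 by auto
          fix e assume e: "0 < e" "e < min (u - a) (b - v)"
          \<comment> \<open>The curve point is above and to the left of y. Just beyond the threshold
            there is a price at least as far up and to the left, up to e.\<close>
          obtain r' where r': "r' \<le> a + e" "ereal (b - e) \<le> f r'"
            using in_H[OF e(1), of t] by (auto simp: H_def a_def b_def algebra_simps)
          show "\<psi> \<le> (a - u) * (b - v) + e * ((b - v) + (u - a))"
          proof (cases "f r'")
            case (real s')
            have s': "b - e \<le> s'" using r'(2) real by simp
            have "\<psi> \<le> (r' - u) * (s' - v)" by (rule fin[OF real])
            also have "\<dots> \<le> (r' - u) * (b - e - v)" using s' r'(1) e by (intro mult_left_mono_neg) auto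
            also have "\<dots> \<le> (a + e - u) * (b - e - v)" using r'(1) e by (intro mult_right_mono) auto
            also have "\<dots> = (a - u) * (b - v) + e * ((b - v) + (u - a)) - e * e" by (simp add: algebra_simps)
            finally show ?thesis by (smt (verit) mult_nonneg_nonneg e(1))
          next
            case PInf
            then have "u \<le> r'" using opt unfolding price_optimal_def by blast
            then show ?thesis using r'(1) e by simp
          next
            case MInf then show ?thesis using r'(2) by simp
          qed
        qed
      next
        case 2
        show ?thesis
        proof (rule lim)
          show "0 < (a - u) + (v - b)" "0 < min (a - u) (v - b)" using 2 by auto
          fix e assume e: "0 < e" "e < min (a - u) (v - b)"
          \<comment> \<open>The curve point is below and to the right of y. Just before the
            threshold the price at a - e is still less than b + e.\<close>
          have "\<not> ereal (b + e) \<le> f (a - e)"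
            using notin_H[OF e(1), of t] by (auto simp: H_def a_def b_def algebra_simps)
          then have lt: "f (a - e) < ereal (b + e)" by simp
          show "\<psi> \<le> (a - u) * (b - v) + e * ((a - u) + (v - b))"
          proof (cases "f (a - e)")
            case (real s')
            have s': "s' \<le> b + e" using lt real by simp
            have "\<psi> \<le> (a - e - u) * (s' - v)" by (rule fin[OF real])
            also have "\<dots> \<le> (a - e - u) * (b + e - v)" using s' e by (intro mult_left_mono) auto
            also have "\<dots> = (a - u) * (b - v) + e * ((a - u) + (v - b)) - e * e" by (simp add: algebra_simps)
            finally show ?thesis by (smt (verit) mult_nonneg_nonneg e(1))
          next
            case PInf then show ?thesis using lt by simp
          next
            case MInf
            then have "a - e \<le> u" using opt unfolding price_optimal_def by blast
            then show ?thesis using e by simp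
          qed
        qed
      qed
    qed
    then show ?thesis by (simp add: cost_def curve_def a_def b_def \<psi>_def)
  qed
  ultimately show thesis by (rule that)
qed

section \<open>Averaging over the information of the total order\<close>

context finite_measure_subalgebra
begin

lemma cond_exp_bounded_mult:
  assumes [measurable]: "g \<in> borel_measurable F" and w: "integrable M w" and b: "\<And>x. \<bar>g x\<bar> \<le> (B::real)"
  shows "integrable M (\<lambda>x. g x * w x)" "integrable M (\<lambda>x. g x * real_cond_exp M F w x)"
    "(\<integral>x. g x * real_cond_exp M F w x \<partial>M) = (\<integral>x. g x * w x \<partial>M)"
proof -
  have [measurable]: "g \<in> borel_measurable M" "w \<in> borel_measurable M"
    using measurable_from_subalg[OF subalg assms(1)] w by auto
  show i: "integrable M (\<lambda>x. g x * w x)"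
  proof (rule Bochner_Integration.integrable_bound)
    show "integrable M (\<lambda>x. B * w x)" using w by simp
    show "AE x in M. norm (g x * w x) \<le> norm (B * w x)"
      using b by (auto simp: abs_mult intro!: mult_right_mono order_trans[OF b abs_ge_self])
  qed simp
  show "integrable M (\<lambda>x. g x * real_cond_exp M F w x)"
    "(\<integral>x. g x * real_cond_exp M F w x \<partial>M) = (\<integral>x. g x * w x \<partial>M)"
    using real_cond_exp_intg[OF i] by auto
qed

text \<open>Averaging the (affine in y) inequality between costs over the fibres of the
  information F.\<close>

lemma AE_averaged_cost:
  assumes [measurable]: "R \<in> borel_measurable F" "S \<in> borel_measurable F"
    and U: "integrable M U" and V: "integrable M V"
    and S: "AE \<omega> in M. S \<omega> = real_cond_exp M F V \<omega>"
    and le: "AE \<omega> in M. (R \<omega> - U \<omega>) * (S \<omega> - V \<omega>) \<le> (a - U \<omega>) * (b - V \<omega>)"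
  shows "AE \<omega> in M. 0 \<le> (a - real_cond_exp M F U \<omega>) * (b - S \<omega>)"
proof -
  define m where "m = real_cond_exp M F U"
  have mF [measurable]: "m \<in> borel_measurable F" unfolding m_def by simp
  have [measurable]: "R \<in> borel_measurable M" "S \<in> borel_measurable M" "m \<in> borel_measurable M" "U \<in> borel_measurable M" "V \<in> borel_measurable M"
    using U V by (auto intro!: measurable_from_subalg[OF subalg])
  have "AE \<omega> in M. \<bar>R \<omega>\<bar> \<le> real n \<and> \<bar>S \<omega>\<bar> \<le> real n \<and> \<bar>m \<omega>\<bar> \<le> real n \<longrightarrow> 0 \<le> (a - m \<omega>) * (b - S \<omega>)" for n :: nat
  proof -
    \<comment> \<open>No integrability of R is available, so the inequality is tested on the failure
      event cut down to a bounded range of R, S and m; this event lies in F.\<close>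
    define P where "P \<omega> \<longleftrightarrow> \<bar>R \<omega>\<bar> \<le> real n \<and> \<bar>S \<omega>\<bar> \<le> real n \<and> \<bar>m \<omega>\<bar> \<le> real n \<and> (a - m \<omega>) * (b - S \<omega>) < 0" for \<omega>
    define g where "g \<omega> = (if P \<omega> then 1 else 0 :: real)" for \<omega>
    have gF [measurable]: "g \<in> borel_measurable F" unfolding g_def P_def by measurable
    have [measurable]: "g \<in> borel_measurable M" using measurable_from_subalg[OF subalg gF] .
    have bR: "\<bar>g \<omega> * (R \<omega> - a)\<bar> \<le> real n + \<bar>a\<bar>" and bS: "\<bar>g \<omega> * (S \<omega> - b)\<bar> \<le> real n + \<bar>b\<bar>" for \<omega>
      by (auto simp: g_def P_def)
    have bRS: "\<bar>g \<omega> * (a * b - R \<omega> * S \<omega>)\<bar> \<le> \<bar>a * b\<bar> + real n * real n" for \<omega>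
    proof (cases "P \<omega>")
      case True
      then have "\<bar>R \<omega> * S \<omega>\<bar> \<le> real n * real n" unfolding abs_mult P_def by (intro mult_mono) auto
      then show ?thesis using True by (simp add: g_def)
    qed (simp add: g_def)
    have iV: "integrable M (\<lambda>\<omega>. g \<omega> * (R \<omega> - a) * V \<omega>)" "integrable M (\<lambda>\<omega>. g \<omega> * (R \<omega> - a) * real_cond_exp M F V \<omega>)"
      "(\<integral>\<omega>. g \<omega> * (R \<omega> - a) * real_cond_exp M F V \<omega> \<partial>M) = (\<integral>\<omega>. g \<omega> * (R \<omega> - a) * V \<omega> \<partial>M)"
      by (intro cond_exp_bounded_mult[OF _ V bR]; measurable)+
    have iU: "integrable M (\<lambda>\<omega>. g \<omega> * (S \<omega> - b) * U \<omega>)" "integrable M (\<lambda>\<omega>. g \<omega> * (S \<omega> - b) * m \<omega>)"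
      "(\<integral>\<omega>. g \<omega> * (S \<omega> - b) * m \<omega> \<partial>M) = (\<integral>\<omega>. g \<omega> * (S \<omega> - b) * U \<omega> \<partial>M)"
      unfolding m_def by (intro cond_exp_bounded_mult[OF _ U bS]; measurable)+
    have i0: "integrable M (\<lambda>\<omega>. g \<omega> * (a * b - R \<omega> * S \<omega>))"
      by (rule integrable_const_bound[where B = "\<bar>a * b\<bar> + real n * real n"]) (use bRS in auto)
    have iVS: "integrable M (\<lambda>\<omega>. g \<omega> * (R \<omega> - a) * S \<omega>)"
      "(\<integral>\<omega>. g \<omega> * (R \<omega> - a) * S \<omega> \<partial>M) = (\<integral>\<omega>. g \<omega> * (R \<omega> - a) * V \<omega> \<partial>M)"
    proof -
      have ae: "AE \<omega> in M. g \<omega> * (R \<omega> - a) * real_cond_exp M F V \<omega> = g \<omega> * (R \<omega> - a) * S \<omega>"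
        using S by eventually_elim simp
      show "integrable M (\<lambda>\<omega>. g \<omega> * (R \<omega> - a) * S \<omega>)"
        using iV(2) by (subst (asm) integrable_cong_AE[OF _ _ ae]) auto
      show "(\<integral>\<omega>. g \<omega> * (R \<omega> - a) * S \<omega> \<partial>M) = (\<integral>\<omega>. g \<omega> * (R \<omega> - a) * V \<omega> \<partial>M)"
        unfolding iV(3)[symmetric] by (rule integral_cong_AE[symmetric]) (use ae in auto)
    qed
    have "0 \<le> (\<integral>\<omega>. g \<omega> * (a * b - R \<omega> * S \<omega>) + g \<omega> * (R \<omega> - a) * V \<omega> + g \<omega> * (S \<omega> - b) * U \<omega> \<partial>M)"
    proof (rule integral_nonneg_AE)
      show "AE \<omega> in M. 0 \<le> g \<omega> * (a * b - R \<omega> * S \<omega>) + g \<omega> * (R \<omega> - a) * V \<omega> + g \<omega> * (S \<omega> - b) * U \<omega>"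
        using le
      proof eventually_elim
        case (elim \<omega>)
        have "g \<omega> * (a * b - R \<omega> * S \<omega>) + g \<omega> * (R \<omega> - a) * V \<omega> + g \<omega> * (S \<omega> - b) * U \<omega>
          = g \<omega> * ((a - U \<omega>) * (b - V \<omega>) - (R \<omega> - U \<omega>) * (S \<omega> - V \<omega>))" by (simp add: algebra_simps)
        also have "\<dots> \<ge> 0" using elim by (simp add: g_def)
        finally show ?case .
      qed
    qed
    also have "\<dots> = (\<integral>\<omega>. g \<omega> * (a * b - R \<omega> * S \<omega>) + g \<omega> * (R \<omega> - a) * S \<omega> + g \<omega> * (S \<omega> - b) * m \<omega> \<partial>M)"
      using i0 iV iU iVS by simp
    also have "\<dots> = (\<integral>\<omega>. g \<omega> * ((a - m \<omega>) * (b - S \<omega>)) \<partial>M)"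
      by (intro Bochner_Integration.integral_cong) (auto simp: algebra_simps)
    finally have ge: "0 \<le> (\<integral>\<omega>. g \<omega> * ((a - m \<omega>) * (b - S \<omega>)) \<partial>M)" .
    have np: "g \<omega> * ((a - m \<omega>) * (b - S \<omega>)) \<le> 0" for \<omega> by (simp add: g_def P_def)
    have int: "integrable M (\<lambda>\<omega>. g \<omega> * ((a - m \<omega>) * (b - S \<omega>)))"
    proof -
      have "integrable M (\<lambda>\<omega>. g \<omega> * (a * b - R \<omega> * S \<omega>) + g \<omega> * (R \<omega> - a) * S \<omega> + g \<omega> * (S \<omega> - b) * m \<omega>)"
        using i0 iU iVS by simp
      moreover have "(\<lambda>\<omega>. g \<omega> * (a * b - R \<omega> * S \<omega>) + g \<omega> * (R \<omega> - a) * S \<omega> + g \<omega> * (S \<omega> - b) * m \<omega>)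
          = (\<lambda>\<omega>. g \<omega> * ((a - m \<omega>) * (b - S \<omega>)))" by (auto simp: algebra_simps)
      ultimately show ?thesis by simp
    qed
    have "(\<integral>\<omega>. - (g \<omega> * ((a - m \<omega>) * (b - S \<omega>))) \<partial>M) = 0"
    proof (rule antisym)
      show "0 \<le> (\<integral>\<omega>. - (g \<omega> * ((a - m \<omega>) * (b - S \<omega>))) \<partial>M)" by (rule integral_nonneg_AE) (use np in auto)
      show "(\<integral>\<omega>. - (g \<omega> * ((a - m \<omega>) * (b - S \<omega>))) \<partial>M) \<le> 0" using ge by simp
    qed
    then have "AE \<omega> in M. - (g \<omega> * ((a - m \<omega>) * (b - S \<omega>))) = 0"
      using integral_nonneg_eq_0_iff_AE[of M "\<lambda>\<omega>. - (g \<omega> * ((a - m \<omega>) * (b - S \<omega>)))"] int np by auto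
    then show ?thesis by eventually_elim (auto simp: g_def P_def split: if_splits)
  qed
  then have "AE \<omega> in M. \<forall>n::nat. \<bar>R \<omega>\<bar> \<le> real n \<and> \<bar>S \<omega>\<bar> \<le> real n \<and> \<bar>m \<omega>\<bar> \<le> real n \<longrightarrow> 0 \<le> (a - m \<omega>) * (b - S \<omega>)"
    by (subst AE_all_countable) blast
  then show ?thesis
  proof eventually_elim
    case (elim \<omega>)
    obtain n :: nat where "max \<bar>R \<omega>\<bar> (max \<bar>S \<omega>\<bar> \<bar>m \<omega>\<bar>) \<le> real n" using real_arch_simple by blast
    then show ?case using elim[rule_format, of n] by (auto simp: m_def)
  qed
qed

text \<open>One null set must serve uncountably many r, and f has no continuity. The averaged
  inequality is a closed condition on (r, s), so a countable dense subset of the finite part of the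
  graph of f suffices.\<close>

lemma AE_price_monotone:
  assumes R: "R \<in> borel_measurable F" and SF: "S \<in> borel_measurable F"
    and U: "integrable M U" and V: "integrable M V"
    and S: "AE \<omega> in M. S \<omega> = real_cond_exp M F V \<omega>"
    and opt: "AE \<omega> in M. price_optimal f (R \<omega>) (S \<omega>) (U \<omega>) (V \<omega>)"
  shows "AE \<omega> in M. \<forall>r s. f r = ereal s \<longrightarrow> 0 \<le> (r - real_cond_exp M F U \<omega>) * (s - S \<omega>)"
proof -
  define G where "G = {(r, s). f r = ereal s}"
  obtain T where T: "countable T" "T \<subseteq> G" "G \<subseteq> closure T" using separable[of G] by blast
  have "AE \<omega> in M. \<forall>z\<in>T. 0 \<le> (fst z - real_cond_exp M F U \<omega>) * (snd z - S \<omega>)"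
  proof (subst AE_ball_countable[OF T(1)], intro ballI)
    fix z assume "z \<in> T"
    then have z: "f (fst z) = ereal (snd z)" using T(2) by (auto simp: G_def)
    show "AE \<omega> in M. 0 \<le> (fst z - real_cond_exp M F U \<omega>) * (snd z - S \<omega>)"
    proof (rule AE_averaged_cost[OF R SF U V S])
      show "AE \<omega> in M. (R \<omega> - U \<omega>) * (S \<omega> - V \<omega>) \<le> (fst z - U \<omega>) * (snd z - V \<omega>)"
        using opt by eventually_elim (use z in \<open>auto simp: price_optimal_def\<close>)
    qed
  qed
  then show ?thesis
  proof eventually_elim
    case (elim \<omega>)
    let ?C = "{z :: real \<times> real. 0 \<le> (fst z - real_cond_exp M F U \<omega>) * (snd z - S \<omega>)}"
    have "closed ?C" by (intro closed_Collect_le continuous_intros)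
    moreover have "T \<subseteq> ?C" using elim by auto
    ultimately have "G \<subseteq> ?C" using T(3) closure_minimal by blast
    then show ?case by (auto simp: G_def)
  qed
qed

text \<open>A single r with price -\<infinity> bounds U from below almost surely, hence also its
  conditional mean. Rationals below such r give one null set for all of them.\<close>

lemma AE_price_minus_infinity:
  assumes U: "integrable M U" and opt: "AE \<omega> in M. price_optimal f (R \<omega>) (S \<omega>) (U \<omega>) (V \<omega>)"
  shows "AE \<omega> in M. \<forall>r. f r = -\<infinity> \<longrightarrow> r \<le> real_cond_exp M F U \<omega>"
proof -
  have "AE \<omega> in M. \<forall>q\<in>\<rat>. (\<exists>r. f r = -\<infinity> \<and> q \<le> r) \<longrightarrow> q \<le> real_cond_exp M F U \<omega>"
  proof (subst AE_ball_countable[OF countable_rat], intro ballI)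
    fix q :: real
    show "AE \<omega> in M. (\<exists>r. f r = -\<infinity> \<and> q \<le> r) \<longrightarrow> q \<le> real_cond_exp M F U \<omega>"
    proof (cases "\<exists>r. f r = -\<infinity> \<and> q \<le> r")
      case True
      then obtain r where r: "f r = -\<infinity>" "q \<le> r" by blast
      have "AE \<omega> in M. q \<le> U \<omega>"
        using opt by eventually_elim (use r in \<open>auto simp: price_optimal_def\<close>)
      from real_cond_exp_ge_c[OF U this] show ?thesis by eventually_elim simp
    next
      case False
      then show ?thesis by (intro AE_I2) blast
    qed
  qed
  then show ?thesis
  proof eventually_elim
    case (elim \<omega>)
    show ?case
    proof (intro allI impI, rule ccontr)
      fix r assume r: "f r = -\<infinity>" "\<not> r \<le> real_cond_exp M F U \<omega>"
      then have "real_cond_exp M F U \<omega> < r" by simp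
      from Rats_dense_in_real[OF this] obtain q where q: "q \<in> \<rat>" "real_cond_exp M F U \<omega> < q" "q < r" by blast
      then have "q \<le> real_cond_exp M F U \<omega>" using elim r(1) less_imp_le[OF q(3)] by blast
      then show False using q by simp
    qed
  qed
qed

end

text \<open>Where R exceeds m = E[U | F], \<open>price_optimal_bias\<close> gives S \<le> V, and
  since S is the mean of V given F, V = S there. The values of S on this event form a countable set,
  so for atomless V the event has probability 0.\<close>

lemma (in prob_space) AE_order_le_cond_exp:
  assumes sub: "subalgebra M F"
    and R: "R \<in> borel_measurable F" and SF: "S \<in> borel_measurable F"
    and U: "integrable M U" and V: "integrable M V" and at: "atomless_law M V"
    and S: "AE \<omega> in M. S \<omega> = real_cond_exp M F V \<omega>"
    and opt: "AE \<omega> in M. price_optimal f (R \<omega>) (S \<omega>) (U \<omega>) (V \<omega>)"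
  shows "AE \<omega> in M. R \<omega> \<le> real_cond_exp M F U \<omega>"
proof -
  interpret finite_measure_subalgebra M F
    by (intro finite_measure_subalgebra.intro finite_measure_axioms finite_measure_subalgebra_axioms.intro sub)
  define m where "m = real_cond_exp M F U"
  have mF [measurable]: "m \<in> borel_measurable F" unfolding m_def by simp
  note [measurable] = R SF
  have M [measurable]: "R \<in> borel_measurable M" "S \<in> borel_measurable M" "m \<in> borel_measurable M" "V \<in> borel_measurable M"
    using V by (auto intro!: measurable_from_subalg[OF subalg])
  define good where "good \<omega> \<longleftrightarrow> price_optimal f (R \<omega>) (S \<omega>) (U \<omega>) (V \<omega>) \<and>
    (\<forall>r s. f r = ereal s \<longrightarrow> 0 \<le> (r - m \<omega>) * (s - S \<omega>)) \<and> (\<forall>r. f r = -\<infinity> \<longrightarrow> r \<le> m \<omega>)" for \<omega>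
  have good: "AE \<omega> in M. good \<omega>"
    using opt AE_price_monotone[OF R SF U V S opt] AE_price_minus_infinity[OF U opt]
    unfolding good_def m_def by eventually_elim blast
  have le: "S \<omega> \<le> V \<omega>" if "good \<omega>" "m \<omega> < R \<omega>" for \<omega>
    using price_optimal_bias[of f "R \<omega>" "S \<omega>" "U \<omega>" "V \<omega>" "m \<omega>"] that unfolding good_def by blast
  have eq: "AE \<omega> in M. m \<omega> < R \<omega> \<longrightarrow> V \<omega> = S \<omega>"
  proof -
    define g where "g \<omega> = (if m \<omega> < R \<omega> then 1 else 0 :: real)" for \<omega>
    have gF [measurable]: "g \<in> borel_measurable F" unfolding g_def by measurable
    have [measurable]: "g \<in> borel_measurable M" using measurable_from_subalg[OF subalg gF] .
    have b: "\<bar>g \<omega>\<bar> \<le> 1" for \<omega> by (simp add: g_def)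
    note i = cond_exp_bounded_mult[OF gF V b]
    have ae: "AE \<omega> in M. g \<omega> * real_cond_exp M F V \<omega> = g \<omega> * S \<omega>" using S by eventually_elim simp
    have iS: "integrable M (\<lambda>\<omega>. g \<omega> * S \<omega>)"
      using i(2) by (subst (asm) integrable_cong_AE[OF _ _ ae]) auto
    have "(\<integral>\<omega>. g \<omega> * S \<omega> \<partial>M) = (\<integral>\<omega>. g \<omega> * V \<omega> \<partial>M)"
      unfolding i(3)[symmetric] by (rule integral_cong_AE[symmetric]) (use ae in auto)
    then have "(\<integral>\<omega>. g \<omega> * V \<omega> - g \<omega> * S \<omega> \<partial>M) = 0" using i(1) iS by simp
    moreover have "AE \<omega> in M. 0 \<le> g \<omega> * V \<omega> - g \<omega> * S \<omega>"
      using good by eventually_elim (use le in \<open>auto simp: g_def\<close>)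
    ultimately have "AE \<omega> in M. g \<omega> * V \<omega> - g \<omega> * S \<omega> = 0"
      using integral_nonneg_eq_0_iff_AE[of M "\<lambda>\<omega>. g \<omega> * V \<omega> - g \<omega> * S \<omega>"] i(1) iS by auto
    then show ?thesis by eventually_elim (auto simp: g_def split: if_splits)
  qed
  define L where "L = S ` {\<omega>. good \<omega> \<and> m \<omega> < R \<omega>}"
  have "countable L"
  proof -
    \<comment> \<open>The intervals (m, R) attached to different values of S are ordered like these
      values, by monotonicity of the price around m, so a rational from each interval identifies the
      value.\<close>
    have "\<exists>q\<in>\<rat>. \<exists>\<omega>. good \<omega> \<and> S \<omega> = s \<and> m \<omega> < q \<and> q < R \<omega>" if s: "s \<in> L" for s
      using that Rats_dense_in_real unfolding L_def by fast
    then obtain q where q: "\<And>s. s \<in> L \<Longrightarrow> q s \<in> \<rat> \<and> (\<exists>\<omega>. good \<omega> \<and> S \<omega> = s \<and> m \<omega> < q s \<and> q s < R \<omega>)"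
      by metis
    have less: "q s < q s'" if ss: "s \<in> L" "s' \<in> L" "s < s'" for s s'
    proof -
      obtain \<omega> where w: "good \<omega>" "S \<omega> = s" "q s < R \<omega>" using q[OF ss(1)] by blast
      obtain \<omega>' where w': "good \<omega>'" "S \<omega>' = s'" "m \<omega>' < q s'" using q[OF ss(2)] by blast
      have "f (R \<omega>) = ereal s" using w by (simp add: good_def price_optimal_def)
      then have "0 \<le> (R \<omega> - m \<omega>') * (s - s')" using w' by (auto simp: good_def)
      then have "R \<omega> \<le> m \<omega>'" using ss(3) by (simp add: zero_le_mult_iff)
      then show ?thesis using w w' by linarith
    qed
    have "inj_on q L"
    proof (rule inj_onI)
      fix s s' assume "s \<in> L" "s' \<in> L" "q s = q s'"
      then show "s = s'" using less[of s s'] less[of s' s] by (cases s s' rule: linorder_cases) auto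
    qed
    moreover have "countable (q ` L)" by (rule countable_subset[OF _ countable_rat]) (use q in auto)
    ultimately show ?thesis using countable_image_inj_on by blast
  qed
  from AE_not_in_countable[OF M(4) at this] good eq show ?thesis
  proof eventually_elim
    case (elim \<omega>)
    then show ?case unfolding m_def[symmetric] L_def by force
  qed
qed

lemma (in prob_space) AE_order_eq_cond_exp:
  assumes sub: "subalgebra M F"
    and R: "R \<in> borel_measurable F" and SF: "S \<in> borel_measurable F"
    and U: "integrable M U" and V: "integrable M V" and at: "atomless_law M V"
    and S: "AE \<omega> in M. S \<omega> = real_cond_exp M F V \<omega>"
    and opt: "AE \<omega> in M. price_optimal f (R \<omega>) (S \<omega>) (U \<omega>) (V \<omega>)"
  shows "AE \<omega> in M. real_cond_exp M F U \<omega> = R \<omega>"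
proof -
  interpret finite_measure_subalgebra M F
    by (intro finite_measure_subalgebra.intro finite_measure_axioms finite_measure_subalgebra_axioms.intro sub)
  have [measurable]: "V \<in> borel_measurable M" using V by simp
  have neg: "AE \<omega> in M. real_cond_exp M F (\<lambda>\<omega>. - W \<omega>) \<omega> = - real_cond_exp M F W \<omega>" if "integrable M W" for W
    using real_cond_exp_cmult[OF that, of "-1"] by simp
  have at': "atomless_law M (\<lambda>\<omega>. - V \<omega>)"
    unfolding atomless_law_def
  proof
    fix x
    have "(\<lambda>\<omega>. - V \<omega>) -` {x} \<inter> space M = V -` {- x} \<inter> space M" by auto
    then show "measure (distr M borel (\<lambda>\<omega>. - V \<omega>)) {x} = 0"
      using at[unfolded atomless_law_def, rule_format, of "-x"] by (simp add: measure_distr)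
  qed
  have "AE \<omega> in M. - R \<omega> \<le> real_cond_exp M F (\<lambda>\<omega>. - U \<omega>) \<omega>"
  proof (rule AE_order_le_cond_exp[OF sub _ _ _ _ at'])
    show "AE \<omega> in M. - S \<omega> = real_cond_exp M F (\<lambda>\<omega>. - V \<omega>) \<omega>"
      using S neg[OF V] by eventually_elim simp
    show "AE \<omega> in M. price_optimal (\<lambda>x. - f (- x)) (- R \<omega>) (- S \<omega>) (- U \<omega>) (- V \<omega>)"
      using opt by eventually_elim (rule price_optimal_reflect)
  qed (use R SF U V in auto)
  with AE_order_le_cond_exp[OF sub R SF U V at S opt] neg[OF U] show ?thesis
    by eventually_elim simp
qed

section \<open>Equilibria as supported admissible maps\<close>

lemma trading_strategy_measurable:
  assumes "trading_strategy M U V Q" and [measurable]: "U \<in> borel_measurable M" "V \<in> borel_measurable M"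
  shows "Q \<in> borel_measurable M"
proof (rule measurable_from_subalg)
  show "subalgebra M (vimage_algebra (space M) (\<lambda>\<omega>. (U \<omega>, V \<omega>)) borel)"
    by (rule subalgebra_vimage_algebra) measurable
  show "Q \<in> borel_measurable (vimage_algebra (space M) (\<lambda>\<omega>. (U \<omega>, V \<omega>)) borel)"
    using assms(1) by (simp add: trading_strategy_def)
qed

lemma (in prob_space) cond_exp_square_integrable:
  fixes W :: "'a \<Rightarrow> real"
  assumes sub: "subalgebra M F" and W: "integrable M W" "integrable M (\<lambda>\<omega>. (W \<omega>)\<^sup>2)"
  shows "integrable M (\<lambda>\<omega>. (real_cond_exp M F W \<omega>)\<^sup>2)"
proof -
  interpret finite_measure_subalgebra M F
    by (intro finite_measure_subalgebra.intro finite_measure_axioms finite_measure_subalgebra_axioms.intro sub)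
  have "convex_on UNIV (\<lambda>x::real. x\<^sup>2)"
    by (rule convex_power2)
  then show ?thesis
    by (intro integrable_convex_cond_exp[OF W(1), of UNIV]) (use W(2) emeasure_space_1 in auto)
qed

lemma (in prob_space) equilibrium_price_optimal:
  assumes U [measurable]: "U \<in> borel_measurable M" and V [measurable]: "V \<in> borel_measurable M"
    and eq: "equilibrium M U V Q f"
  defines "R \<equiv> \<lambda>\<omega>. Q \<omega> + U \<omega>"
  shows "AE \<omega> in M. real_of_ereal (f (R \<omega>)) = real_cond_exp M (vimage_algebra (space M) R borel) V \<omega>"
    and "AE \<omega> in M. price_optimal f (R \<omega>) (real_of_ereal (f (R \<omega>))) (U \<omega>) (V \<omega>)"
proof -
  have ae: "AE \<omega> in M. f (R \<omega>) = ereal (real_cond_exp M (vimage_algebra (space M) R borel) V \<omega>)"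
    using eq by (simp add: equilibrium_def R_def)
  then show "AE \<omega> in M. real_of_ereal (f (R \<omega>)) = real_cond_exp M (vimage_algebra (space M) R borel) V \<omega>"
    by eventually_elim simp
  have "AE \<omega> in M. \<forall>q::real. ereal q * (ereal (V \<omega>) - f (q + U \<omega>))
      \<le> ereal (Q \<omega>) * (ereal (V \<omega>) - f (R \<omega>))"
    using eq by (simp add: equilibrium_def R_def)
  with ae show "AE \<omega> in M. price_optimal f (R \<omega>) (real_of_ereal (f (R \<omega>))) (U \<omega>) (V \<omega>)"
  proof eventually_elim
    case (elim \<omega>)
    have f: "f (R \<omega>) = ereal (real_of_ereal (f (R \<omega>)))" using elim(1) by simp
    have Q: "Q \<omega> = R \<omega> - U \<omega>" by (simp add: R_def)
    show ?case unfolding price_optimal_iff using elim(2) f unfolding Q by metis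
  qed
qed

text \<open>Both coordinates are conditional means given R, of U by
  \<open>AE_order_eq_cond_exp\<close> and of V by the equilibrium, so Jensen's inequality makes them
  square integrable. The pair carries the same information as R, because the price is a function of
  R.\<close>

lemma (in prob_space) equilibrium_admissible:
  assumes U [measurable]: "U \<in> borel_measurable M" and V [measurable]: "V \<in> borel_measurable M"
    and U2: "integrable M (\<lambda>\<omega>. (U \<omega>)\<^sup>2)" and V2: "integrable M (\<lambda>\<omega>. (V \<omega>)\<^sup>2)"
    and at: "atomless_law M V"
    and eq: "equilibrium M U V Q f"
  shows "(\<lambda>\<omega>. (Q \<omega> + U \<omega>, real_of_ereal (f (Q \<omega> + U \<omega>)))) \<in> admissible_maps M U V"
proof -
  define R where "R = (\<lambda>\<omega>. Q \<omega> + U \<omega>)"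
  define g where "g r = real_of_ereal (f r)" for r
  let ?F = "vimage_algebra (space M) R borel"
  let ?Y = "vimage_algebra (space M) (\<lambda>\<omega>. (U \<omega>, V \<omega>)) borel"
  let ?X = "\<lambda>\<omega>. (R \<omega>, g (R \<omega>))"
  have Rw: "Q \<omega> + U \<omega> = R \<omega>" for \<omega> by (simp add: R_def)
  note po = equilibrium_price_optimal[OF U V eq, folded R_def g_def, unfolded Rw]
  have [measurable]: "f \<in> borel_measurable borel" using eq by (simp add: equilibrium_def pricing_rule_def)
  have [measurable]: "g \<in> borel_measurable borel" unfolding g_def by measurable
  have Qm: "Q \<in> borel_measurable ?Y" using eq by (simp add: equilibrium_def trading_strategy_def)
  have [measurable]: "Q \<in> borel_measurable M"
    using eq by (intro trading_strategy_measurable[OF _ U V]) (simp add: equilibrium_def)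
  have [measurable]: "R \<in> borel_measurable M" unfolding R_def by measurable
  have iU: "integrable M U" and iV: "integrable M V"
    using U2 V2 by (auto intro: integrable_of_square)
  have sub: "subalgebra M ?F" by (rule subalgebra_vimage_algebra) measurable
  have RF: "R \<in> borel_measurable ?F" by (rule measurable_vimage_algebra1) auto
  have SF: "(\<lambda>\<omega>. g (R \<omega>)) \<in> borel_measurable ?F"
    by (rule measurable_vimage_algebra_compose[of R M borel g]) measurable
  have ceU: "AE \<omega> in M. real_cond_exp M ?F U \<omega> = R \<omega>"
    by (rule AE_order_eq_cond_exp[OF sub RF SF iU iV at po])
  have ceV: "AE \<omega> in M. real_cond_exp M ?F V \<omega> = g (R \<omega>)" using po(1) by eventually_elim simp
  have sq: "integrable M (\<lambda>\<omega>. (c \<omega>)\<^sup>2)"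
    if [measurable]: "c \<in> borel_measurable M" and W: "integrable M W" "integrable M (\<lambda>\<omega>. (W \<omega>)\<^sup>2)"
      and ae: "AE \<omega> in M. real_cond_exp M ?F W \<omega> = c \<omega>" for W c
  proof -
    have [measurable]: "W \<in> borel_measurable M" using W(1) by simp
    have "AE \<omega> in M. (real_cond_exp M ?F W \<omega>)\<^sup>2 = (c \<omega>)\<^sup>2" using ae by eventually_elim simp
    from integrable_cong_AE[OF _ _ this] cond_exp_square_integrable[OF sub W] show ?thesis by simp
  qed
  have R2: "integrable M (\<lambda>\<omega>. (R \<omega>)\<^sup>2)" by (rule sq[OF _ iU U2 ceU]) measurable
  have S2: "integrable M (\<lambda>\<omega>. (g (R \<omega>))\<^sup>2)" by (rule sq[OF _ iV V2 ceV]) measurable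
  have iR: "integrable M R" "integrable M (\<lambda>\<omega>. g (R \<omega>))"
    by (rule integrable_of_square, measurable, fact)+
  have intX: "(\<integral>\<omega>. indicator A (?X \<omega>) * W \<omega> \<partial>M) = (\<integral>\<omega>. indicator A (?X \<omega>) * k (R \<omega>) \<partial>M)"
    if A: "A \<in> sets borel" and W: "integrable M W" and kR: "integrable M (\<lambda>\<omega>. k (R \<omega>))"
      and k: "k \<in> borel_measurable borel" and ce: "AE \<omega> in M. real_cond_exp M ?F W \<omega> = k (R \<omega>)"
    for A :: "(real \<times> real) set" and W :: "'a \<Rightarrow> real" and k :: "real \<Rightarrow> real"
  proof -
    define A' where "A' = (\<lambda>r. (r, g r)) -` A"
    have "(\<lambda>r. (r, g r)) \<in> borel \<rightarrow>\<^sub>M (borel :: (real \<times> real) measure)" by measurable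
    from measurable_sets[OF this A] have "A' \<in> sets borel" by (simp add: A'_def)
    moreover have "indicator A (?X \<omega>) = (indicator A' (R \<omega>) :: real)" for \<omega> by (simp add: A'_def indicator_def)
    ultimately show ?thesis using ce unfolding cond_exp_vimage_iff[OF \<open>R \<in> borel_measurable M\<close> k W kR] by simp
  qed
  have "AE \<omega> in M. real_cond_exp M (vimage_algebra (space M) ?X borel) U \<omega> = fst (?X \<omega>)"
    by (subst cond_exp_vimage_iff[of ?X fst]) (use iU iR intX[of _ U "\<lambda>r. r"] ceU in auto)
  moreover have "AE \<omega> in M. real_cond_exp M (vimage_algebra (space M) ?X borel) V \<omega> = snd (?X \<omega>)"
    by (subst cond_exp_vimage_iff[of ?X snd]) (use iV iR intX[of _ V g] ceV in auto)
  moreover have "?X \<in> ?Y \<rightarrow>\<^sub>M borel"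
  proof -
    have "(\<lambda>\<omega>. fst (U \<omega>, V \<omega>)) \<in> borel_measurable ?Y"
      by (rule measurable_vimage_algebra_compose[of "\<lambda>\<omega>. (U \<omega>, V \<omega>)" M]) measurable
    then have "R \<in> borel_measurable ?Y" unfolding R_def using Qm by simp
    then show ?thesis by measurable
  qed
  moreover have "integrable M (\<lambda>\<omega>. (norm (?X \<omega>))\<^sup>2)" using R2 S2 by (simp add: norm_Pair)
  ultimately have "?X \<in> admissible_maps M U V" unfolding admissible_maps_def by (intro CollectI conjI)
  then show ?thesis by (simp only: R_def g_def)
qed

lemma (in prob_space) equilibrium_supporting_curve:
  assumes U [measurable]: "U \<in> borel_measurable M" and V [measurable]: "V \<in> borel_measurable M"
    and eq: "equilibrium M U V Q f"
  obtains h where "nonexpansive h"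
    "AE \<omega> in M. \<forall>t. cost (Q \<omega> + U \<omega>, real_of_ereal (f (Q \<omega> + U \<omega>))) (U \<omega>, V \<omega>) \<le> cost (curve h t) (U \<omega>, V \<omega>)"
proof -
  note po = equilibrium_price_optimal(2)[OF U V eq]
  \<comment> \<open>One outcome with an optimal price starts the construction; the resulting curve
    then serves almost all outcomes.\<close>
  from eventually_happens'[OF ae_filter_bot po] obtain \<omega>0 where
    "price_optimal f (Q \<omega>0 + U \<omega>0) (real_of_ereal (f (Q \<omega>0 + U \<omega>0))) (U \<omega>0) (V \<omega>0)" by blast
  then obtain h where h: "nonexpansive h"
    "\<And>r s u v t. price_optimal f r s u v \<Longrightarrow> cost (r, s) (u, v) \<le> cost (curve h t) (u, v)"
    using price_optimal_curve by blast
  have "AE \<omega> in M. \<forall>t. cost (Q \<omega> + U \<omega>, real_of_ereal (f (Q \<omega> + U \<omega>))) (U \<omega>, V \<omega>) \<le> cost (curve h t) (U \<omega>, V \<omega>)"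
    using po by eventually_elim (use h(2) in blast)
  with h(1) show thesis by (rule that)
qed

lemma (in prob_space) equilibrium_unique_optimal:
  assumes U [measurable]: "U \<in> borel_measurable M" and V [measurable]: "V \<in> borel_measurable M"
    and U2: "integrable M (\<lambda>\<omega>. (U \<omega>)\<^sup>2)" and V2: "integrable M (\<lambda>\<omega>. (V \<omega>)\<^sup>2)"
    and D: "D_regular (distr M borel (\<lambda>\<omega>. (U \<omega>, V \<omega>)))"
    and at: "atomless_law M U" "atomless_law M V"
    and eq: "equilibrium M U V Q f"
  defines "X \<equiv> \<lambda>\<omega>. (Q \<omega> + U \<omega>, real_of_ereal (f (Q \<omega> + U \<omega>)))"
    and "\<nu> \<equiv> distr M borel (\<lambda>\<omega>. (U \<omega>, V \<omega>))"
  defines "\<gamma> \<equiv> distr M borel (\<lambda>\<omega>. (X \<omega>, (U \<omega>, V \<omega>)))"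
  shows "X \<in> admissible_maps M U V"
    and "\<forall>X'\<in>admissible_maps M U V.
      (\<integral>\<omega>. cost (X \<omega>) (U \<omega>, V \<omega>) \<partial>M) \<le> (\<integral>\<omega>. cost (X' \<omega>) (U \<omega>, V \<omega>) \<partial>M)"
    and "\<forall>X'\<in>admissible_maps M U V. (\<forall>X''\<in>admissible_maps M U V.
      (\<integral>\<omega>. cost (X' \<omega>) (U \<omega>, V \<omega>) \<partial>M) \<le> (\<integral>\<omega>. cost (X'' \<omega>) (U \<omega>, V \<omega>) \<partial>M)) \<longrightarrow>
      (AE \<omega> in M. X' \<omega> = X \<omega>)"
    and "\<gamma> \<in> Gamma \<nu>"
    and "\<forall>\<gamma>'\<in>Gamma \<nu>. (\<integral>p. cost (fst p) (snd p) \<partial>\<gamma>) \<le> (\<integral>p. cost (fst p) (snd p) \<partial>\<gamma>')"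
    and "\<forall>\<gamma>'\<in>Gamma \<nu>. (\<forall>\<gamma>''\<in>Gamma \<nu>.
      (\<integral>p. cost (fst p) (snd p) \<partial>\<gamma>') \<le> (\<integral>p. cost (fst p) (snd p) \<partial>\<gamma>'')) \<longrightarrow> \<gamma>' = \<gamma>"
proof -
  show X: "X \<in> admissible_maps M U V"
    unfolding X_def by (rule equilibrium_admissible[OF U V U2 V2 at(2) eq])
  obtain h where h: "nonexpansive h" "AE \<omega> in M. \<forall>t. cost (X \<omega>) (U \<omega>, V \<omega>) \<le> cost (curve h t) (U \<omega>, V \<omega>)"
    unfolding X_def by (rule equilibrium_supporting_curve[OF U V eq])
  note ctx = U V U2 V2 D at h(1) X h(2)
  have \<gamma>: "\<gamma> = plan U V X" unfolding \<gamma>_def plan_def[OF ctx] ..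
  show "\<forall>X'\<in>admissible_maps M U V.
      (\<integral>\<omega>. cost (X \<omega>) (U \<omega>, V \<omega>) \<partial>M) \<le> (\<integral>\<omega>. cost (X' \<omega>) (U \<omega>, V \<omega>) \<partial>M)"
    using X_optimal[OF ctx] by blast
  show "\<forall>X'\<in>admissible_maps M U V. (\<forall>X''\<in>admissible_maps M U V.
      (\<integral>\<omega>. cost (X' \<omega>) (U \<omega>, V \<omega>) \<partial>M) \<le> (\<integral>\<omega>. cost (X'' \<omega>) (U \<omega>, V \<omega>) \<partial>M)) \<longrightarrow>
      (AE \<omega> in M. X' \<omega> = X \<omega>)"
    using optimal_unique[OF ctx] by blast
  show G: "\<gamma> \<in> Gamma \<nu>" unfolding \<gamma> \<nu>_def by (rule plan_in_Gamma[OF ctx])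
  show "\<forall>\<gamma>'\<in>Gamma \<nu>. (\<integral>p. cost (fst p) (snd p) \<partial>\<gamma>) \<le> (\<integral>p. cost (fst p) (snd p) \<partial>\<gamma>')"
    unfolding \<gamma> \<nu>_def using Gamma_weak_duality(1)[OF ctx] by blast
  show "\<forall>\<gamma>'\<in>Gamma \<nu>. (\<forall>\<gamma>''\<in>Gamma \<nu>.
      (\<integral>p. cost (fst p) (snd p) \<partial>\<gamma>') \<le> (\<integral>p. cost (fst p) (snd p) \<partial>\<gamma>'')) \<longrightarrow> \<gamma>' = \<gamma>"
    using plan_unique[OF ctx] G unfolding \<gamma> \<nu>_def by blast
qed

text \<open>The second equilibrium is an optimal map as well and so agrees with the first. Realized
  prices are almost surely finite, hence equality of their real values is equality of the
  prices.\<close>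

lemma (in prob_space) equilibrium_unique:
  assumes U [measurable]: "U \<in> borel_measurable M" and V [measurable]: "V \<in> borel_measurable M"
    and U2: "integrable M (\<lambda>\<omega>. (U \<omega>)\<^sup>2)" and V2: "integrable M (\<lambda>\<omega>. (V \<omega>)\<^sup>2)"
    and D: "D_regular (distr M borel (\<lambda>\<omega>. (U \<omega>, V \<omega>)))"
    and at: "atomless_law M U" "atomless_law M V"
    and eq: "equilibrium M U V Q f" and eq': "equilibrium M U V Q' f'"
  shows "AE \<omega> in M. Q \<omega> = Q' \<omega> \<and> f (Q \<omega> + U \<omega>) = f' (Q' \<omega> + U \<omega>)"
proof -
  note ctx = U V U2 V2 D at
  have "AE \<omega> in M. (Q' \<omega> + U \<omega>, real_of_ereal (f' (Q' \<omega> + U \<omega>))) = (Q \<omega> + U \<omega>, real_of_ereal (f (Q \<omega> + U \<omega>)))"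
    by (rule equilibrium_unique_optimal(3)[OF ctx eq, rule_format, OF equilibrium_unique_optimal(1)[OF ctx eq']])
       (rule equilibrium_unique_optimal(2)[OF ctx eq', rule_format])
  with equilibrium_price_optimal(2)[OF U V eq] equilibrium_price_optimal(2)[OF U V eq']
  show ?thesis by eventually_elim (auto simp: price_optimal_def)
qed

section \<open>Existence of a dual minimizer\<close>

definition dual_value :: "'a measure \<Rightarrow> ('a \<Rightarrow> real) \<Rightarrow> ('a \<Rightarrow> real) \<Rightarrow> (real \<Rightarrow> real) \<Rightarrow> ennreal" where
  "dual_value M U V h = (\<integral>\<^sup>+\<omega>. depth h (U \<omega>, V \<omega>) \<partial>M)"

text \<open>For fixed t the cost depends continuously on the value of the curve at t, so the
  supremum is lower semicontinuous under pointwise convergence.\<close>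

lemma depth_liminf:
  assumes "\<And>t. (\<lambda>n. k n t) \<longlonglongrightarrow> h t"
  shows "depth h y \<le> liminf (\<lambda>n. depth (k n) y)"
  unfolding depth_def[of h]
proof (rule SUP_least)
  fix t
  have "(\<lambda>n. - cost (curve (k n) t) y) \<longlonglongrightarrow> - cost (curve h t) y"
    unfolding cost_def curve_def fst_conv snd_conv by (intro tendsto_intros assms)
  then have "(\<lambda>n. ennreal (- cost (curve (k n) t) y)) \<longlonglongrightarrow> ennreal (- cost (curve h t) y)"
    by (rule tendsto_ennrealI)
  then have "ennreal (- cost (curve h t) y) = liminf (\<lambda>n. ennreal (- cost (curve (k n) t) y))"
    by (rule lim_imp_Liminf[symmetric, rotated]) simp
  also have "\<dots> \<le> liminf (\<lambda>n. depth (k n) y)"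
    by (intro Liminf_mono always_eventually allI depth_ge)
  finally show "ennreal (- cost (curve h t) y) \<le> liminf (\<lambda>n. depth (k n) y)" .
qed

lemma (in prob_space) integrable_half_sum_square:
  fixes U V :: "'a \<Rightarrow> real"
  assumes [measurable]: "U \<in> borel_measurable M" "V \<in> borel_measurable M"
    and "integrable M (\<lambda>\<omega>. (U \<omega>)\<^sup>2)" "integrable M (\<lambda>\<omega>. (V \<omega>)\<^sup>2)"
  shows "integrable M (\<lambda>\<omega>. ((U \<omega> + V \<omega>) / 2)\<^sup>2)" "integrable M (\<lambda>\<omega>. ((U \<omega> - V \<omega>) / 2)\<^sup>2)"
  using integrable_add_squares[OF assms] by (simp_all add: power_divide)

text \<open>Bounds k 0 along a minimizing sequence, the input for compactness. At the parameter a =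
  (U + V) / 2 the cost is -(k a - b)^2 with b = (U - V) / 2, and k 0 differs from k a by at most
  |a|; the factor 3 comes from (x + y + z)^2 \<le> 3 (x^2 + y^2 + z^2).\<close>

lemma (in prob_space) dual_value_lower_bound:
  assumes [measurable]: "U \<in> borel_measurable M" "V \<in> borel_measurable M"
    and sq: "integrable M (\<lambda>\<omega>. (U \<omega>)\<^sup>2)" "integrable M (\<lambda>\<omega>. (V \<omega>)\<^sup>2)"
    and k [measurable]: "nonexpansive k"
  shows "ennreal ((k 0)\<^sup>2) \<le> 3 * dual_value M U V k +
    ennreal (\<integral>\<omega>. 3 * ((U \<omega> + V \<omega>) / 2)\<^sup>2 + 3 * ((U \<omega> - V \<omega>) / 2)\<^sup>2 \<partial>M)"
proof -
  define a where "a = (\<lambda>\<omega>. (U \<omega> + V \<omega>) / 2)"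
  define b where "b = (\<lambda>\<omega>. (U \<omega> - V \<omega>) / 2)"
  have [measurable]: "a \<in> borel_measurable M" "b \<in> borel_measurable M" unfolding a_def b_def by measurable
  have i: "integrable M (\<lambda>\<omega>. 3 * (a \<omega>)\<^sup>2 + 3 * (b \<omega>)\<^sup>2)"
    using integrable_half_sum_square[OF assms(1,2) sq] by (simp add: a_def b_def)
  have pt: "ennreal ((k 0)\<^sup>2) \<le> 3 * depth k (U \<omega>, V \<omega>) + ennreal (3 * (a \<omega>)\<^sup>2 + 3 * (b \<omega>)\<^sup>2)" for \<omega>
  proof -
    have "\<bar>k 0\<bar> \<le> \<bar>k (a \<omega>) - b \<omega>\<bar> + \<bar>a \<omega>\<bar> + \<bar>b \<omega>\<bar>" using nonexpansiveD[OF k, of 0 "a \<omega>"] by linarith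
    then have "(k 0)\<^sup>2 \<le> (\<bar>k (a \<omega>) - b \<omega>\<bar> + \<bar>a \<omega>\<bar> + \<bar>b \<omega>\<bar>)\<^sup>2" by (simp add: abs_le_square_iff[symmetric])
    also have "\<dots> \<le> 3 * (k (a \<omega>) - b \<omega>)\<^sup>2 + (3 * (a \<omega>)\<^sup>2 + 3 * (b \<omega>)\<^sup>2)"
    proof -
      have "0 \<le> (x - y)\<^sup>2 + (y - z)\<^sup>2 + (z - x)\<^sup>2" for x y z :: real by simp
      then have "(x + y + z)\<^sup>2 \<le> 3 * x\<^sup>2 + (3 * y\<^sup>2 + 3 * z\<^sup>2)" for x y z :: real
        by (simp add: power2_eq_square algebra_simps)
      from this[of "\<bar>k (a \<omega>) - b \<omega>\<bar>" "\<bar>a \<omega>\<bar>" "\<bar>b \<omega>\<bar>"] show ?thesis by simp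
    qed
    also have "(k (a \<omega>) - b \<omega>)\<^sup>2 = - cost (curve k (a \<omega>)) (U \<omega>, V \<omega>)"
      unfolding cost_curve by (simp add: a_def b_def)
    finally have "ennreal ((k 0)\<^sup>2) \<le> ennreal (3 * - cost (curve k (a \<omega>)) (U \<omega>, V \<omega>) + (3 * (a \<omega>)\<^sup>2 + 3 * (b \<omega>)\<^sup>2))"
      by (rule ennreal_leI)
    also have "\<dots> = 3 * ennreal (- cost (curve k (a \<omega>)) (U \<omega>, V \<omega>)) + ennreal (3 * (a \<omega>)\<^sup>2 + 3 * (b \<omega>)\<^sup>2)"
    proof -
      have "ennreal (3 * x + y) = 3 * ennreal x + ennreal y" if "0 \<le> x" "0 \<le> y" for x y
        using that by (simp add: ennreal_mult')
      moreover have "0 \<le> - cost (curve k (a \<omega>)) (U \<omega>, V \<omega>)" unfolding cost_curve by (simp add: a_def)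
      moreover have "0 \<le> 3 * (a \<omega>)\<^sup>2 + 3 * (b \<omega>)\<^sup>2" by simp
      ultimately show ?thesis by blast
    qed
    also have "\<dots> \<le> 3 * depth k (U \<omega>, V \<omega>) + ennreal (3 * (a \<omega>)\<^sup>2 + 3 * (b \<omega>)\<^sup>2)"
      by (intro add_mono mult_left_mono depth_ge) auto
    finally show ?thesis .
  qed
  have [measurable]: "(\<lambda>\<omega>. depth k (U \<omega>, V \<omega>)) \<in> borel_measurable M" using k by measurable
  have "ennreal ((k 0)\<^sup>2) = (\<integral>\<^sup>+\<omega>. ennreal ((k 0)\<^sup>2) \<partial>M)" by (simp add: emeasure_space_1)
  also have "\<dots> \<le> (\<integral>\<^sup>+\<omega>. 3 * depth k (U \<omega>, V \<omega>) + ennreal (3 * (a \<omega>)\<^sup>2 + 3 * (b \<omega>)\<^sup>2) \<partial>M)"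
    by (intro nn_integral_mono pt)
  also have "\<dots> = 3 * dual_value M U V k + (\<integral>\<^sup>+\<omega>. ennreal (3 * (a \<omega>)\<^sup>2 + 3 * (b \<omega>)\<^sup>2) \<partial>M)"
    unfolding dual_value_def by (subst nn_integral_add) (auto simp: nn_integral_cmult)
  also have "(\<integral>\<^sup>+\<omega>. ennreal (3 * (a \<omega>)\<^sup>2 + 3 * (b \<omega>)\<^sup>2) \<partial>M) = ennreal (\<integral>\<omega>. 3 * (a \<omega>)\<^sup>2 + 3 * (b \<omega>)\<^sup>2 \<partial>M)"
    by (rule nn_integral_eq_integral[OF i]) simp
  finally show ?thesis unfolding a_def b_def .
qed

lemma (in prob_space) dual_minimizer_exists:
  assumes U [measurable]: "U \<in> borel_measurable M" and V [measurable]: "V \<in> borel_measurable M"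
    and U2: "integrable M (\<lambda>\<omega>. (U \<omega>)\<^sup>2)" and V2: "integrable M (\<lambda>\<omega>. (V \<omega>)\<^sup>2)"
  obtains h where "nonexpansive h" "dual_value M U V h < \<infinity>"
    "\<And>k. nonexpansive k \<Longrightarrow> dual_value M U V h \<le> dual_value M U V k"
proof -
  let ?J = "dual_value M U V"
  define m where "m = Inf (?J ` {k. nonexpansive k})"
  have ne0: "nonexpansive (\<lambda>_. 0)" by (simp add: nonexpansive_def)
  \<comment> \<open>The diagonal h = 0 has finite value, since its cost is at least -((u - v) /
    2)^2.\<close>
  have "?J (\<lambda>_. 0) \<le> (\<integral>\<^sup>+\<omega>. ennreal (((U \<omega> - V \<omega>) / 2)\<^sup>2) \<partial>M)"
    unfolding dual_value_def by (intro nn_integral_mono depth_le) (simp add: cost_curve)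
  also have "\<dots> = ennreal (\<integral>\<omega>. ((U \<omega> - V \<omega>) / 2)\<^sup>2 \<partial>M)"
    by (rule nn_integral_eq_integral[OF integrable_half_sum_square(2)[OF U V U2 V2]]) simp
  finally have J0: "?J (\<lambda>_. 0) < \<infinity>" by (rule order.strict_trans1) simp
  have "m \<le> ?J (\<lambda>_. 0)" unfolding m_def by (rule INF_lower) (simp add: ne0)
  then have m: "m < \<infinity>" using J0 by simp
  obtain j where j: "\<And>n. j n \<in> ?J ` {k. nonexpansive k}" "j \<longlonglongrightarrow> m"
    using Inf_as_limit[of "?J ` {k. nonexpansive k}"] ne0 unfolding m_def by blast
  obtain m' where m': "m = ennreal m'" "0 \<le> m'" using m by (cases m) auto
  define c where "c = m' + 1"
  have c: "m < ennreal c" using m' by (simp add: c_def ennreal_less_iff)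
  \<comment> \<open>Only a tail of the minimizing sequence is kept, on which the values stay below
    \<open>c\<close>, one above the infimum; this bounds the curves at 0.\<close>
  obtain N where N: "\<And>n. n \<ge> N \<Longrightarrow> j n < ennreal c"
    using order_tendstoD(2)[OF j(2) c] by (auto simp: eventually_sequentially)
  have "\<forall>n. \<exists>k. nonexpansive k \<and> ?J k = j (n + N)" using j(1) by (metis (mono_tags, lifting) imageE mem_Collect_eq)
  then obtain k where k: "\<And>n. nonexpansive (k n)" "\<And>n. ?J (k n) = j (n + N)" by metis
  define C where "C = (\<integral>\<omega>. 3 * ((U \<omega> + V \<omega>) / 2)\<^sup>2 + 3 * ((U \<omega> - V \<omega>) / 2)\<^sup>2 \<partial>M)"
  have C0: "0 \<le> C" unfolding C_def by (rule integral_nonneg_AE) simp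
  have c0: "0 < c" using m' by (simp add: c_def)
  have bd: "\<bar>k n 0\<bar> \<le> 3 * c + C + 1" for n
  proof -
    have "ennreal ((k n 0)\<^sup>2) \<le> 3 * ?J (k n) + ennreal C"
      unfolding C_def by (rule dual_value_lower_bound[OF U V U2 V2 k(1)])
    also have "\<dots> \<le> 3 * ennreal c + ennreal C"
      using N[of "n + N"] k(2)[of n] by (intro add_mono mult_left_mono) auto
    also have "\<dots> = ennreal (3 * c + C)" using c0 C0 by (simp add: ennreal_mult)
    finally have "(k n 0)\<^sup>2 \<le> 3 * c + C" using c0 C0 by (subst (asm) ennreal_le_iff) auto
    moreover have "\<bar>k n 0\<bar> \<le> (k n 0)\<^sup>2 + 1"
    proof -
      have "0 \<le> (\<bar>k n 0\<bar> - 1)\<^sup>2" by simp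
      then have "2 * \<bar>k n 0\<bar> \<le> (k n 0)\<^sup>2 + 1" by (simp add: power2_diff)
      then show ?thesis by simp
    qed
    ultimately show ?thesis by simp
  qed
  obtain r h where r: "strict_mono (r :: nat \<Rightarrow> nat)" and h: "nonexpansive h" "\<And>t. (\<lambda>n. k (r n) t) \<longlonglongrightarrow> h t"
    using nonexpansive_subseq[of k, OF k(1) bd] by blast
  have "?J h \<le> (\<integral>\<^sup>+\<omega>. liminf (\<lambda>n. depth (k (r n)) (U \<omega>, V \<omega>)) \<partial>M)"
    unfolding dual_value_def by (intro nn_integral_mono depth_liminf h(2))
  also have "\<dots> \<le> liminf (\<lambda>n. ?J (k (r n)))"
    unfolding dual_value_def
  proof (rule nn_integral_liminf)
    fix i show "(\<lambda>\<omega>. depth (k (r i)) (U \<omega>, V \<omega>)) \<in> borel_measurable M"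
      using borel_measurable_depth[OF k(1)[of "r i"]] by measurable
  qed
  also have "\<dots> = m"
  proof -
    have "(\<lambda>n. j (n + N)) \<longlonglongrightarrow> m" using j(2) by (rule LIMSEQ_ignore_initial_segment)
    then have "(\<lambda>n. ?J (k (r n))) \<longlonglongrightarrow> m"
      using LIMSEQ_subseq_LIMSEQ[OF _ r, of "\<lambda>n. j (n + N)" m] by (simp add: comp_def k(2))
    then show ?thesis by (intro lim_imp_Liminf) auto
  qed
  finally have Jh: "?J h \<le> m" .
  show thesis
  proof (rule that[OF h(1)])
    show "?J h < \<infinity>" using Jh m by simp
    fix k assume "nonexpansive k"
    then have "m \<le> ?J k" unfolding m_def by (intro INF_lower) simp
    with Jh show "?J h \<le> ?J k" by (rule order_trans)
  qed
qed

text \<open>For difference quotients only an asymptotic lower bound Z is known, not a limit, so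
  Fatou's lemma is put with a slack \<eta>. Z may be negative; its positive part is what gets
  compared.\<close>

lemma fatou_real:
  fixes X :: "nat \<Rightarrow> 'a \<Rightarrow> real"
  assumes X: "\<And>n. integrable M (X n)" "\<And>n. AE \<omega> in M. 0 \<le> X n \<omega>" "\<And>n. (\<integral>\<omega>. X n \<omega> \<partial>M) \<le> c"
    and Z: "integrable M Z" "AE \<omega> in M. \<forall>\<eta>>0. eventually (\<lambda>n. Z \<omega> - \<eta> \<le> X n \<omega>) sequentially"
  shows "(\<integral>\<omega>. Z \<omega> \<partial>M) \<le> c"
proof -
  have [measurable]: "X n \<in> borel_measurable M" for n using X(1) by simp
  have c0: "0 \<le> c" using integral_nonneg_AE[OF X(2)[of 0]] X(3)[of 0] by linarith
  have "(\<integral>\<^sup>+\<omega>. ennreal (Z \<omega>) \<partial>M) \<le> (\<integral>\<^sup>+\<omega>. liminf (\<lambda>n. ennreal (X n \<omega>)) \<partial>M)"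
  proof (rule nn_integral_mono_AE)
    show "AE \<omega> in M. ennreal (Z \<omega>) \<le> liminf (\<lambda>n. ennreal (X n \<omega>))"
      using Z(2)
    proof eventually_elim
      case (elim \<omega>)
      show ?case
      proof (subst le_Liminf_iff, intro allI impI)
        fix y assume y: "y < ennreal (Z \<omega>)"
        then obtain y' where y': "y = ennreal y'" "0 \<le> y'" by (cases y) auto
        have "y' < Z \<omega>" using y y' by (simp add: ennreal_less_iff)
        then have "eventually (\<lambda>n. Z \<omega> - (Z \<omega> - y') / 2 \<le> X n \<omega>) sequentially"
          using elim by simp
        then show "eventually (\<lambda>n. y < ennreal (X n \<omega>)) sequentially"
        proof eventually_elim
          case (elim n)
          then have "y' < X n \<omega>" using \<open>y' < Z \<omega>\<close> by (simp add: field_simps)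
          then show ?case using y' by (simp add: ennreal_less_iff)
        qed
      qed
    qed
  qed
  also have "\<dots> \<le> liminf (\<lambda>n. \<integral>\<^sup>+\<omega>. ennreal (X n \<omega>) \<partial>M)"
    by (rule nn_integral_liminf) simp
  also have "\<dots> \<le> ennreal c"
  proof -
    have "(\<integral>\<^sup>+\<omega>. ennreal (X n \<omega>) \<partial>M) \<le> ennreal c" for n
      unfolding nn_integral_eq_integral[OF X(1,2)] by (rule ennreal_leI[OF X(3)])
    then show ?thesis by (intro Liminf_le) auto
  qed
  finally have le: "(\<integral>\<^sup>+\<omega>. ennreal (Z \<omega>) \<partial>M) \<le> ennreal c" .
  have "(\<integral>\<omega>. Z \<omega> \<partial>M) \<le> (\<integral>\<omega>. max 0 (Z \<omega>) \<partial>M)" using Z(1) by (intro integral_mono) auto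
  also have "ennreal (\<integral>\<omega>. max 0 (Z \<omega>) \<partial>M) = (\<integral>\<^sup>+\<omega>. ennreal (max 0 (Z \<omega>)) \<partial>M)"
    by (rule nn_integral_eq_integral[symmetric]) (use Z(1) in auto)
  then have "ennreal (\<integral>\<omega>. max 0 (Z \<omega>) \<partial>M) \<le> ennreal c" using le by (simp add: ennreal_max_0' max.commute)
  then have "(\<integral>\<omega>. max 0 (Z \<omega>) \<partial>M) \<le> c" using c0 by (simp add: ennreal_le_iff)
  finally show ?thesis .
qed

text \<open>One-sided derivative of an infimum in a direction d that is coercive: only
  minimizers of c matter in the limit.\<close>

lemma infimum_perturbation:
  fixes c d :: "real \<Rightarrow> real"
  assumes cont: "continuous_on UNIV c" "continuous_on UNIV d"
    and c: "\<And>t. - p \<le> c t" and d: "\<And>t. \<theta> * t\<^sup>2 - G \<le> d t" and \<theta>: "0 < \<theta>"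
    and B: "\<And>t. c t = - p \<Longrightarrow> B \<le> d t" and \<eta>: "0 < \<eta>"
  obtains e1 where "0 < e1" "\<And>e t. 0 < e \<Longrightarrow> e \<le> e1 \<Longrightarrow> - p + e * (B - \<eta>) \<le> c t + e * d t - e\<^sup>2"
proof -
  \<comment> \<open>On this compact set the slope d is too small, but no minimizer lies in it, so c
    exceeds -p there by a positive gap. Off the set, the surplus \<eta> / 2 in the slope pays for
    the remainder e^2.\<close>
  define S where "S = {t. d t \<le> B - \<eta> / 2}"
  have cS: "closed S" unfolding S_def by (intro closed_Collect_le cont) auto
  have bS: "bounded S"
  proof (rule boundedI)
    fix t assume "t \<in> S"
    then have "\<theta> * t\<^sup>2 \<le> G + B" using d[of t] \<eta> by (simp add: S_def)
    then have "t\<^sup>2 \<le> (G + B) / \<theta>" using \<theta> by (simp add: field_simps)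
    moreover have "0 \<le> (\<bar>t\<bar> - 1)\<^sup>2" by simp
    then have "2 * \<bar>t\<bar> \<le> t\<^sup>2 + 1" by (simp add: power2_diff)
    ultimately show "norm t \<le> (G + B) / \<theta> + 1" by simp
  qed
  have comp: "compact S" using cS bS by (simp add: compact_eq_bounded_closed)
  have off: "- p + e * (B - \<eta>) \<le> c t + e * d t - e\<^sup>2" if "0 < e" "e \<le> \<eta> / 2" "t \<notin> S" for e t
  proof -
    have "e * (B - \<eta> / 2) \<le> e * d t" using that by (intro mult_left_mono) (auto simp: S_def)
    moreover have "e * e \<le> e * (\<eta> / 2)" using that by (intro mult_left_mono) auto
    ultimately show ?thesis using c[of t] by (simp add: power2_eq_square algebra_simps)
  qed
  show thesis
  proof (cases "S = {}")
    case True
    then show thesis using off \<eta> by (intro that[of "\<eta> / 2"]) auto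
  next
    case False
    then obtain s where s: "s \<in> S" "\<And>t. t \<in> S \<Longrightarrow> c s \<le> c t"
      using continuous_attains_inf[OF comp False continuous_on_subset[OF cont(1)]] by auto
    define g where "g = c s + p"
    have "c s \<noteq> - p" using B[of s] s(1) \<eta> by (auto simp: S_def)
    then have g: "0 < g" using c[of s] by (simp add: g_def)
    \<comment> \<open>With e K \<le> g and e \<le> 1 the gap covers the possible loss e (G + B) and
      the remainder e^2.\<close>
    define K where "K = \<bar>G\<bar> + \<bar>B\<bar> + 1"
    have K: "0 < K" by (simp add: K_def)
    show thesis
    proof (rule that)
      show "0 < min (\<eta> / 2) (min 1 (g / K))" using \<eta> g K by simp
      fix e t assume e: "0 < e" "e \<le> min (\<eta> / 2) (min 1 (g / K))"
      show "- p + e * (B - \<eta>) \<le> c t + e * d t - e\<^sup>2"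
      proof (cases "t \<in> S")
        case True
        have "e * K \<le> g" using e K by (simp add: field_simps)
        moreover have "e * e \<le> e * 1" using e by (intro mult_left_mono) auto
        moreover have "0 \<le> \<theta> * t\<^sup>2" using \<theta> by simp
        then have "e * (- G) \<le> e * d t" using d[of t] e by (intro mult_left_mono) auto
        moreover have "e * (G + B - \<eta> + 1) \<le> e * K" using e \<eta> by (intro mult_left_mono) (auto simp: K_def)
        moreover have "g - p \<le> c t" using s(2)[OF True] by (simp add: g_def)
        ultimately show ?thesis by (simp add: power2_eq_square algebra_simps)
      next
        case False
        then show ?thesis using e by (intro off) auto
      qed
    qed
  qed
qed

section \<open>First-order conditions\<close>

lemma nonexpansive_snd_bound:
  assumes "nonexpansive h" shows "\<bar>t - h t - v\<bar> \<le> 2 * \<bar>t\<bar> + \<bar>h 0\<bar> + \<bar>v\<bar>"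
proof -
  have "\<bar>h t\<bar> \<le> \<bar>h 0\<bar> + \<bar>t\<bar>" using nonexpansiveD[OF assms, of t 0] by simp
  then show ?thesis using abs_triangle_ineq4[of "t - h t" v] abs_triangle_ineq4[of t "h t"] by linarith
qed

locale dual_optimal = prob_space M for M :: "'a measure" +
  fixes U V :: "'a \<Rightarrow> real" and h :: "real \<Rightarrow> real"
  assumes U [measurable]: "U \<in> borel_measurable M" and V [measurable]: "V \<in> borel_measurable M"
    and U2: "integrable M (\<lambda>\<omega>. (U \<omega>)\<^sup>2)" and V2: "integrable M (\<lambda>\<omega>. (V \<omega>)\<^sup>2)"
    and h [measurable]: "nonexpansive h"
    and finite_value: "dual_value M U V h < \<infinity>"
    and optimal: "\<And>k. nonexpansive k \<Longrightarrow> dual_value M U V h \<le> dual_value M U V k"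
begin

lemma measurable_depth [measurable]: "nonexpansive k \<Longrightarrow> (\<lambda>\<omega>. depth k (U \<omega>, V \<omega>)) \<in> borel_measurable M"
  by measurable

lemma AE_depth_finite: "AE \<omega> in M. depth h (U \<omega>, V \<omega>) < \<infinity>"
proof -
  have "AE \<omega> in M. depth h (U \<omega>, V \<omega>) \<noteq> \<infinity>"
    by (rule nn_integral_noteq_infinite) (use finite_value h in \<open>auto simp: dual_value_def\<close>)
  then show ?thesis by eventually_elim (simp add: less_top)
qed

text \<open>First variation of the dual value along the curves obtained by dilating the antidiagonal
  parameter by \<theta> and moving the first coordinate by \<phi>. The dilation makes the variation
  coercive, so minimizing sequences that escape to infinity do not contribute.\<close>

lemma first_order:
  fixes \<phi> :: "real \<Rightarrow> real" and \<theta> e0 :: real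
  assumes \<phi>: "continuous_on UNIV \<phi>" "\<And>t. \<bar>\<phi> t\<bar> \<le> 1"
    and e0: "0 < e0" "mono (\<lambda>t. t + h t + e0 * \<phi> t)" and \<theta>: "0 < \<theta>"
    and B: "integrable M B"
    and Bd: "AE \<omega> in M. \<forall>t\<in>minimizers h (U \<omega>, V \<omega>).
      B \<omega> \<le> \<phi> t * (t - h t - V \<omega>) + \<theta> * (2 * t * (t - (U \<omega> + V \<omega>) / 2))"
  shows "(\<integral>\<omega>. B \<omega> \<partial>M) \<le> 0"
proof -
  \<comment> \<open>Steps of at most e0, for which the moved first coordinate is still monotone, and
    at most 1, so that e^2 \<le> e.\<close>
  define e where "e n = min e0 1 * inverse (real (Suc n))" for n :: nat
  have e: "0 < e n" "e n \<le> e0" "e n \<le> 1" for n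
  proof -
    show "0 < e n" using e0(1) by (simp add: e_def)
    have "e n \<le> min e0 1 * 1"
      unfolding e_def using e0(1) by (intro mult_left_mono) (auto simp: inverse_le_1_iff)
    then show "e n \<le> e0" "e n \<le> 1" by auto
  qed
  have e_lim: "e \<longlonglongrightarrow> 0"
    unfolding e_def by (intro tendsto_mult_right_zero LIMSEQ_inverse_real_of_nat)
  define a where "a n t = t + h t + e n * (\<theta> * t + \<phi> t)" for n t
  define b where "b n t = t - h t + e n * \<theta> * t" for n t
  have mono_a: "mono (a n)" for n
  proof (rule monoI)
    fix s t :: real assume st: "s \<le> t"
    have "s + h s + e0 * \<phi> s \<le> t + h t + e0 * \<phi> t" using monoD[OF e0(2) st] .
    moreover have "s + h s \<le> t + h t" by (rule nonexpansive_mono_fst[OF h st])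
    moreover have "e n * (\<phi> s - \<phi> t) \<le> max 0 (e0 * (\<phi> s - \<phi> t))"
    proof (cases "\<phi> s \<le> \<phi> t")
      case True
      then have "e n * (\<phi> s - \<phi> t) \<le> 0" using e(1)[of n] by (simp add: mult_nonneg_nonpos)
      then show ?thesis by simp
    next
      case False
      then have "e n * (\<phi> s - \<phi> t) \<le> e0 * (\<phi> s - \<phi> t)" using e(2)[of n] by (intro mult_right_mono) auto
      then show ?thesis by simp
    qed
    moreover have "e n * (\<theta> * s) \<le> e n * (\<theta> * t)" using st \<theta> e(1)[of n] by (intro mult_left_mono) auto
    ultimately show "a n s \<le> a n t" unfolding a_def by (simp add: algebra_simps max_def split: if_splits)
  qed
  have mono_b: "mono (b n)" for n
  proof (rule monoI)
    fix s t :: real assume st: "s \<le> t"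
    have "e n * \<theta> * s \<le> e n * \<theta> * t" using st \<theta> e(1)[of n] by (intro mult_left_mono) auto
    then show "b n s \<le> b n t" unfolding b_def using nonexpansive_mono_snd[OF h st] by linarith
  qed
  have surj: "\<exists>s. a n s + b n s = 2 * t" for n t
  proof -
    define F where "F s = 2 * s + e n * (2 * \<theta> * s + \<phi> s)" for s
    have F: "a n s + b n s = F s" for s by (simp add: a_def b_def F_def algebra_simps)
    have contF: "continuous_on A F" for A
      unfolding F_def by (intro continuous_intros continuous_on_subset[OF \<phi>(1)]) auto
    have ep: "\<bar>e n * \<phi> s\<bar> \<le> 1" for s
    proof -
      have "\<bar>e n\<bar> * \<bar>\<phi> s\<bar> \<le> 1 * 1" using e[of n] \<phi>(2)[of s] by (intro mult_mono) auto
      then show ?thesis by (simp add: abs_mult)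
    qed
    define T where "T = \<bar>t\<bar> + 1"
    have "0 \<le> e n * (2 * \<theta> * T)" using e(1)[of n] \<theta> by (simp add: T_def)
    then have "F (- T) \<le> 2 * t" "2 * t \<le> F T"
      using ep[of T] ep[of "- T"] unfolding F_def T_def by (auto simp: algebra_simps abs_le_iff)
    then obtain s where "F s = 2 * t" using IVT'[of F "- T" "2 * t" T] contF by (auto simp: T_def)
    then show ?thesis using F by metis
  qed
  have "\<exists>k. nonexpansive k \<and> (\<forall>s. curve k ((a n s + b n s) / 2) = (a n s, b n s))" for n
    using curve_of_monotone[OF mono_a mono_b surj, of n] by metis
  then obtain k where k: "\<And>n. nonexpansive (k n)"
    and ks: "\<And>n s. curve (k n) ((a n s + b n s) / 2) = (a n s, b n s)" by metis
  have k_pt: "\<exists>s. curve (k n) t = (a n s, b n s)" for n t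
  proof -
    obtain s where "a n s + b n s = 2 * t" using surj by blast
    then show ?thesis using ks[of n s] by (intro exI[of _ s]) simp
  qed
  define w where "w \<omega> = (U \<omega> + V \<omega>) / 2" for \<omega>
  \<comment> \<open>The derivative at e = 0 of the cost at the moved point (a, b). The dilation adds
    e \<theta> t to both coordinates, which yields the term 2 \<theta> t (t - w).\<close>
  define d where "d \<omega> t = \<phi> t * (t - h t - V \<omega>) + \<theta> * (2 * t * (t - w \<omega>))" for \<omega> t
  define c where "c \<omega> t = cost (curve h t) (U \<omega>, V \<omega>)" for \<omega> t
  \<comment> \<open>An integrable bound for -d, uniform in t, found by completing the square in
    \<theta> |t|. The last summand 1 absorbs the remainder e^2 \<le> e.\<close>
  define G where "G \<omega> = \<bar>h 0\<bar> + \<bar>V \<omega>\<bar> + (1 + \<theta> * \<bar>w \<omega>\<bar>)\<^sup>2 / \<theta> + 1" for \<omega>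
  have [measurable]: "w \<in> borel_measurable M" unfolding w_def by measurable
  have w2: "integrable M (\<lambda>\<omega>. (w \<omega>)\<^sup>2)" unfolding w_def by (rule integrable_half_sum_square(1)[OF U V U2 V2])
  have w1: "integrable M w" by (rule integrable_of_square[OF _ w2]) measurable
  have V1: "integrable M V" by (rule integrable_of_square[OF V V2])
  have G: "integrable M G"
  proof -
    have "integrable M (\<lambda>\<omega>. \<bar>h 0\<bar> + \<bar>V \<omega>\<bar> + (1 + \<theta>\<^sup>2 * (w \<omega>)\<^sup>2 + 2 * (\<theta> * \<bar>w \<omega>\<bar>)) / \<theta> + 1)"
      using w1 w2 V1 by simp
    then show ?thesis unfolding G_def by (simp add: power2_sum power_mult_distrib)
  qed
  have d_lower: "\<theta> * t\<^sup>2 - (G \<omega> - 1) \<le> d \<omega> t" for \<omega> t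
  proof -
    have "- (\<phi> t * (t - h t - V \<omega>)) \<le> 1 * \<bar>t - h t - V \<omega>\<bar>"
    proof -
      have "- (\<phi> t * (t - h t - V \<omega>)) \<le> \<bar>\<phi> t\<bar> * \<bar>t - h t - V \<omega>\<bar>" unfolding abs_mult[symmetric] by linarith
      also have "\<dots> \<le> 1 * \<bar>t - h t - V \<omega>\<bar>" by (intro mult_right_mono \<phi>(2)) simp
      finally show ?thesis .
    qed
    also have "\<dots> \<le> 2 * \<bar>t\<bar> + \<bar>h 0\<bar> + \<bar>V \<omega>\<bar>" using nonexpansive_snd_bound[OF h] by simp
    finally have 1: "- (2 * \<bar>t\<bar> + \<bar>h 0\<bar> + \<bar>V \<omega>\<bar>) \<le> \<phi> t * (t - h t - V \<omega>)" by simp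
    have "0 \<le> (\<theta> * \<bar>t\<bar> - (1 + \<theta> * \<bar>w \<omega>\<bar>))\<^sup>2 / \<theta>" using \<theta> by simp
    also have "\<dots> = \<theta> * t\<^sup>2 - 2 * \<bar>t\<bar> * (1 + \<theta> * \<bar>w \<omega>\<bar>) + (1 + \<theta> * \<bar>w \<omega>\<bar>)\<^sup>2 / \<theta>"
    proof -
      have "(\<theta> * x - y)\<^sup>2 / \<theta> = \<theta> * x\<^sup>2 - 2 * x * y + y\<^sup>2 / \<theta>" for x y
      proof -
        have "(\<theta> * x - y)\<^sup>2 = \<theta> * (\<theta> * x\<^sup>2 - 2 * x * y) + y\<^sup>2"
          by (simp add: power2_eq_square algebra_simps)
        then show ?thesis using \<theta> by (simp add: add_divide_distrib)
      qed
      from this[of "\<bar>t\<bar>" "1 + \<theta> * \<bar>w \<omega>\<bar>"] show ?thesis by simp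
    qed
    finally have 2: "0 \<le> \<theta> * t\<^sup>2 - 2 * \<bar>t\<bar> * (1 + \<theta> * \<bar>w \<omega>\<bar>) + (1 + \<theta> * \<bar>w \<omega>\<bar>)\<^sup>2 / \<theta>" .
    have "\<theta> * (t * w \<omega>) \<le> \<theta> * (\<bar>t\<bar> * \<bar>w \<omega>\<bar>)" using \<theta> by (intro mult_left_mono) (auto simp: abs_mult[symmetric])
    then have 3: "2 * \<theta> * t\<^sup>2 - 2 * \<bar>t\<bar> * (\<theta> * \<bar>w \<omega>\<bar>) \<le> \<theta> * (2 * t * (t - w \<omega>))"
      by (simp add: power2_eq_square algebra_simps)
    show ?thesis using 1 2 3 unfolding d_def G_def by (simp add: algebra_simps)
  qed
  have cost_ab: "c \<omega> s + e n * d \<omega> s - (e n)\<^sup>2 \<le> cost (a n s, b n s) (U \<omega>, V \<omega>)" for n s \<omega>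
  proof -
    have eq: "cost (a n s, b n s) (U \<omega>, V \<omega>) = c \<omega> s + e n * d \<omega> s + (e n)\<^sup>2 * ((\<theta> * s)\<^sup>2 + \<phi> s * (\<theta> * s))"
      unfolding c_def d_def a_def b_def w_def cost_def curve_def
      by (simp add: power2_eq_square field_simps)
    have "\<bar>\<phi> s * (\<theta> * s)\<bar> \<le> 1 * \<bar>\<theta> * s\<bar>" unfolding abs_mult[of "\<phi> s"] by (intro mult_right_mono \<phi>(2)) simp
    moreover have "0 \<le> (\<bar>\<theta> * s\<bar> - 1)\<^sup>2" by simp
    then have "2 * \<bar>\<theta> * s\<bar> \<le> (\<theta> * s)\<^sup>2 + 1" by (simp only: power2_diff) simp
    moreover have "0 \<le> (\<theta> * s)\<^sup>2" by simp
    ultimately have "- 1 \<le> (\<theta> * s)\<^sup>2 + \<phi> s * (\<theta> * s)" by (simp add: abs_le_iff)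
    then have "(e n)\<^sup>2 * (- 1) \<le> (e n)\<^sup>2 * ((\<theta> * s)\<^sup>2 + \<phi> s * (\<theta> * s))" by (intro mult_left_mono) auto
    then show ?thesis unfolding eq by simp
  qed
  define p where "p \<omega> = enn2real (depth h (U \<omega>, V \<omega>))" for \<omega>
  define q where "q n \<omega> = enn2real (depth (k n) (U \<omega>, V \<omega>))" for n \<omega>
  have [measurable]: "p \<in> borel_measurable M" unfolding p_def using h by measurable
  have [measurable]: "q n \<in> borel_measurable M" for n unfolding q_def using k[of n] by measurable
  have c_lower: "AE \<omega> in M. \<forall>t. - p \<omega> \<le> c \<omega> t"
    using AE_depth_finite by eventually_elim (simp add: p_def c_def cost_ge_depth)
  have dk: "AE \<omega> in M. depth (k n) (U \<omega>, V \<omega>) \<le> ennreal (p \<omega> + e n * G \<omega>)" for n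
    using c_lower
  proof eventually_elim
    case (elim \<omega>)
    show ?case
    proof (rule depth_le)
      fix t
      obtain s where s: "curve (k n) t = (a n s, b n s)" using k_pt by blast
      have "0 \<le> \<theta> * s\<^sup>2" using \<theta> by simp
      then have "e n * (1 - G \<omega>) \<le> e n * d \<omega> s" using d_lower[of s \<omega>] e(1)[of n] by (intro mult_left_mono) auto
      moreover have "e n * e n \<le> e n * 1" using e[of n] by (intro mult_left_mono) auto
      ultimately show "- cost (curve (k n) t) (U \<omega>, V \<omega>) \<le> p \<omega> + e n * G \<omega>"
        unfolding s using cost_ab[of \<omega> s n] elim[rule_format, of s] by (simp add: power2_eq_square algebra_simps)
    qed
  qed
  have G0: "0 \<le> G \<omega>" for \<omega> unfolding G_def using \<theta> by (intro add_nonneg_nonneg) auto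
  have p0: "0 \<le> p \<omega>" for \<omega> by (simp add: p_def)
  have q0: "0 \<le> q n \<omega>" for n \<omega> by (simp add: q_def)
  have ep: "AE \<omega> in M. depth h (U \<omega>, V \<omega>) = ennreal (p \<omega>)"
    using AE_depth_finite by eventually_elim (simp add: p_def)
  have eq: "AE \<omega> in M. depth (k n) (U \<omega>, V \<omega>) = ennreal (q n \<omega>)" for n
    using dk[of n]
  proof eventually_elim
    case (elim \<omega>)
    have "depth (k n) (U \<omega>, V \<omega>) < \<infinity>" using elim by (rule order.strict_trans1) simp
    then show ?case by (simp add: q_def)
  qed
  have Jh: "dual_value M U V h = (\<integral>\<^sup>+\<omega>. ennreal (p \<omega>) \<partial>M)"
    unfolding dual_value_def by (rule nn_integral_cong_AE[OF ep])
  have Jk: "dual_value M U V (k n) = (\<integral>\<^sup>+\<omega>. ennreal (q n \<omega>) \<partial>M)" for n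
    unfolding dual_value_def by (rule nn_integral_cong_AE[OF eq])
  have ip: "integrable M p"
    by (rule integrableI_nonneg) (use p0 finite_value Jh in auto)
  have qle: "AE \<omega> in M. q n \<omega> \<le> p \<omega> + e n * G \<omega>" for n
    using dk[of n] eq[of n]
  proof eventually_elim
    case (elim \<omega>)
    then have "ennreal (q n \<omega>) \<le> ennreal (p \<omega> + e n * G \<omega>)" by simp
    then show ?case using p0[of \<omega>] G0[of \<omega>] e(1)[of n] by (subst (asm) ennreal_le_iff) auto
  qed
  have iq: "integrable M (q n)" for n
  proof (rule Bochner_Integration.integrable_bound)
    show "integrable M (\<lambda>\<omega>. p \<omega> + e n * G \<omega>)" using ip G by simp
    show "AE \<omega> in M. norm (q n \<omega>) \<le> norm (p \<omega> + e n * G \<omega>)"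
      using qle[of n] by eventually_elim (use q0 in auto)
  qed simp
  have pq: "(\<integral>\<omega>. p \<omega> \<partial>M) \<le> (\<integral>\<omega>. q n \<omega> \<partial>M)" for n
  proof -
    have "ennreal (\<integral>\<omega>. p \<omega> \<partial>M) \<le> ennreal (\<integral>\<omega>. q n \<omega> \<partial>M)"
      using optimal[OF k[of n]] unfolding Jh Jk using ip iq p0 q0 by (simp add: nn_integral_eq_integral)
    then show ?thesis using q0 by (subst (asm) ennreal_le_iff) (auto intro: integral_nonneg_AE)
  qed
  \<comment> \<open>By optimality of h the quotients (p - q) / e have mean at most 0. Adding G makes
    them nonnegative, as Fatou's lemma requires, and B bounds them asymptotically from
    below.\<close>
  have "(\<integral>\<omega>. B \<omega> + G \<omega> \<partial>M) \<le> (\<integral>\<omega>. G \<omega> \<partial>M)"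
  proof (rule fatou_real[where X = "\<lambda>n \<omega>. (p \<omega> - q n \<omega>) / e n + G \<omega>"])
    fix n
    show "integrable M (\<lambda>\<omega>. (p \<omega> - q n \<omega>) / e n + G \<omega>)" using ip iq G by simp
    show "AE \<omega> in M. 0 \<le> (p \<omega> - q n \<omega>) / e n + G \<omega>"
      using qle[of n] by eventually_elim (use e(1)[of n] in \<open>simp add: field_simps\<close>)
    have "((\<integral>\<omega>. p \<omega> \<partial>M) - (\<integral>\<omega>. q n \<omega> \<partial>M)) / e n \<le> 0"
      using pq[of n] e(1)[of n] by (intro divide_nonpos_pos) auto
    then show "(\<integral>\<omega>. (p \<omega> - q n \<omega>) / e n + G \<omega> \<partial>M) \<le> (\<integral>\<omega>. G \<omega> \<partial>M)" using ip iq G by simp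
  next
    show "integrable M (\<lambda>\<omega>. B \<omega> + G \<omega>)" using B G by simp
    show "AE \<omega> in M. \<forall>\<eta>>0. \<forall>\<^sub>F n in sequentially. B \<omega> + G \<omega> - \<eta> \<le> (p \<omega> - q n \<omega>) / e n + G \<omega>"
      using Bd c_lower AE_depth_finite
    proof eventually_elim
      case (elim \<omega>)
      show ?case
      proof (intro allI impI)
        fix \<eta> :: real assume \<eta>: "0 < \<eta>"
        have cc: "continuous_on UNIV (c \<omega>)" unfolding c_def by (intro continuous_intros h)
        have cd: "continuous_on UNIV (d \<omega>)"
          unfolding d_def by (intro continuous_intros \<phi>(1) nonexpansive_continuous_on h)
        have Bm: "B \<omega> \<le> d \<omega> t" if "c \<omega> t = - p \<omega>" for t
        proof -
          have "t \<in> minimizers h (U \<omega>, V \<omega>)"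
            using that elim(3) by (intro minimizers_depth) (auto simp: c_def p_def)
          then show ?thesis using elim(1) by (auto simp: d_def w_def)
        qed
        obtain e1 where e1: "0 < e1"
          "\<And>e t. 0 < e \<Longrightarrow> e \<le> e1 \<Longrightarrow> - p \<omega> + e * (B \<omega> - \<eta>) \<le> c \<omega> t + e * d \<omega> t - e\<^sup>2"
          using infimum_perturbation[OF cc cd _ d_lower \<theta> Bm \<eta>] elim(2) by metis
        have "\<forall>\<^sub>F n in sequentially. e n < e1" using order_tendstoD(2)[OF e_lim e1(1)] .
        then show "\<forall>\<^sub>F n in sequentially. B \<omega> + G \<omega> - \<eta> \<le> (p \<omega> - q n \<omega>) / e n + G \<omega>"
        proof eventually_elim
          case (elim n)
          have *: "- cost (curve (k n) t) (U \<omega>, V \<omega>) \<le> p \<omega> - e n * (B \<omega> - \<eta>)" for t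
          proof -
            obtain s where s: "curve (k n) t = (a n s, b n s)" using k_pt by blast
            show ?thesis unfolding s using cost_ab[of \<omega> s n] e1(2)[of "e n" s] e(1)[of n] elim by linarith
          qed
          have "0 \<le> p \<omega> - e n * (B \<omega> - \<eta>)"
            using cost_curve_nonpos_exists[of "k n" "(U \<omega>, V \<omega>)"] * by (metis neg_0_le_iff_le order_trans)
          then have "q n \<omega> \<le> p \<omega> - e n * (B \<omega> - \<eta>)"
            unfolding q_def using enn2real_mono[OF depth_le[OF *]] by simp
          then show ?case using e(1)[of n] by (simp add: field_simps)
        qed
      qed
    qed
  qed
  then show ?thesis using B G by simp
qed

end

section \<open>Minimizers for an optimal curve\<close>

lemma sets_minimizers_empty:
  assumes h: "nonexpansive h" shows "{y. minimizers h y = {}} \<in> sets borel"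
proof -
  define N where "N n = {y. \<exists>t. t \<in> {- real n..real n} \<and> t \<in> minimizers h y}" for n :: nat
  have "N n \<in> sets borel" for n
  proof -
    have "closed {y. \<exists>t. t \<in> {- real n..real n} \<and> (t, y) \<in> {(t, y). t \<in> minimizers h y}}"
      by (rule closed_compact_projection) (use closed_minimizers_graph[OF h] in auto)
    then show ?thesis by (simp add: N_def borel_closed)
  qed
  then have "- (\<Union>n. N n) \<in> sets borel" by (intro borel_comp sets.countable_UN) auto
  moreover have "{y. minimizers h y = {}} = - (\<Union>n. N n)"
  proof (intro set_eqI iffI)
    fix y assume "y \<in> - (\<Union>n. N n)"
    moreover have "\<exists>n. y \<in> N n" if "t \<in> minimizers h y" for t
    proof -
      obtain n :: nat where "\<bar>t\<bar> \<le> real n" using real_arch_simple by blast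
      then have "y \<in> N n" using that unfolding N_def by (intro CollectI exI[of _ t]) auto
      then show ?thesis ..
    qed
    ultimately show "y \<in> {y. minimizers h y = {}}" by blast
  qed (auto simp: N_def)
  ultimately show ?thesis by (simp only:)
qed

lemma on_curve_iff: "curve h ((u + v) / 2) = (u, v) \<longleftrightarrow> h ((u + v) / 2) = (u - v) / 2"
  by (auto simp: curve_def field_simps)

text \<open>Costs between curve points are nonnegative and the point itself has cost 0, so every
  minimizer has cost 0. For y on the curve, ties are confined to the column and the row of
  y.\<close>

lemma minimizer_of_curve_point:
  assumes "nonexpansive h" "t \<in> minimizers h (curve h s)"
  shows "t + h t = s + h s \<or> t - h t = s - h s"
proof -
  have "cost (curve h t) (curve h s) \<le> cost (curve h s) (curve h s)" using assms(2) by (auto simp: minimizers_def)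
  then have "cost (curve h t) (curve h s) = 0"
    using cost_curve_curve_nonneg[OF assms(1), of t s] by (simp add: cost_def)
  then show ?thesis by (simp add: cost_def curve_def)
qed

text \<open>The second coordinate increases along a column, so t is the upper end of a vertical
  segment. Lower ends are upper ends for the reflected curve.\<close>

definition column_top :: "(real \<Rightarrow> real) \<Rightarrow> real \<Rightarrow> bool" where
  "column_top h t \<longleftrightarrow> (\<exists>s<t. s + h s = t + h t) \<and> (\<forall>t'>t. t + h t < t' + h t')"

text \<open>A rational parameter inside the segment recovers the upper end as a supremum.\<close>

lemma countable_column_tops:
  assumes h: "nonexpansive h" shows "countable {t. column_top h t}"
proof (rule countable_subset)
  show "{t. column_top h t} \<subseteq> (\<lambda>q. Sup {t. t + h t = q + h q}) ` \<rat>"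
  proof
    fix t assume "t \<in> {t. column_top h t}"
    then obtain s where s: "s < t" "s + h s = t + h t" and top: "\<And>t'. t < t' \<Longrightarrow> t + h t < t' + h t'"
      by (auto simp: column_top_def)
    obtain q where q: "q \<in> \<rat>" "s < q" "q < t" using Rats_dense_in_real[OF s(1)] by blast
    have xq: "q + h q = t + h t" using column_between[OF h _ _ s(2) refl, of q] q by simp
    have "Sup {t. t + h t = q + h q} = t"
    proof (rule cSup_eq_maximum)
      fix x assume "x \<in> {t. t + h t = q + h q}"
      then show "x \<le> t" using top[of x] xq by force
    qed (simp add: xq)
    then show "t \<in> (\<lambda>q. Sup {t. t + h t = q + h q}) ` \<rat>" using q(1) by (intro image_eqI[of _ _ q]) auto
  qed
qed (simp add: countable_rat)

text \<open>Uniqueness is asked for y off the curve, since ties on the curve may carry positive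
  mass. In this form the assumption passes directly to the reflected data.\<close>

locale dual_regular = dual_optimal M U V h for M :: "'a measure" and U V h +
  assumes unique: "AE \<omega> in M. h ((U \<omega> + V \<omega>) / 2) \<noteq> (U \<omega> - V \<omega>) / 2 \<longrightarrow> (\<exists>!t. t \<in> minimizers h (U \<omega>, V \<omega>))"
begin

definition off :: "'a \<Rightarrow> bool" where
  "off \<omega> \<longleftrightarrow> h ((U \<omega> + V \<omega>) / 2) \<noteq> (U \<omega> - V \<omega>) / 2"

definition T :: "'a \<Rightarrow> real" where "T \<omega> = the_minimizer h (U \<omega>, V \<omega>)"

definition w :: "'a \<Rightarrow> real" where "w \<omega> = (U \<omega> + V \<omega>) / 2"

lemma measurable_off [measurable]: "Measurable.pred M off"
  unfolding off_def using h by measurable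

lemma measurable_T [measurable]: "T \<in> borel_measurable M"
  unfolding T_def using h by measurable

lemma measurable_w [measurable]: "w \<in> borel_measurable M"
  unfolding w_def by measurable

lemma w2: "integrable M (\<lambda>\<omega>. (w \<omega>)\<^sup>2)"
  unfolding w_def by (rule integrable_half_sum_square(1)[OF U V U2 V2])

lemma V1: "integrable M V"
  by (rule integrable_of_square[OF V V2])

lemma AE_T: "AE \<omega> in M. off \<omega> \<longrightarrow> minimizers h (U \<omega>, V \<omega>) = {T \<omega>}"
  using unique
proof eventually_elim
  case (elim \<omega>)
  show ?case
  proof
    assume "off \<omega>"
    then have ex1: "\<exists>!t. t \<in> minimizers h (U \<omega>, V \<omega>)" using elim by (simp add: off_def)
    then have "t = T \<omega>" if "t \<in> minimizers h (U \<omega>, V \<omega>)" for t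
      unfolding T_def using the_minimizer_unique[OF ex1 that] by simp
    then show "minimizers h (U \<omega>, V \<omega>) = {T \<omega>}" using ex1 by blast
  qed
qed

lemma on_curve: "\<not> off \<omega> \<Longrightarrow> curve h ((U \<omega> + V \<omega>) / 2) = (U \<omega>, V \<omega>)"
  by (simp add: on_curve_iff off_def)

lemma off_cost_neg:
  assumes "off \<omega>" "t \<in> minimizers h (U \<omega>, V \<omega>)"
  shows "(t + h t - U \<omega>) * (t - h t - V \<omega>) < 0"
proof -
  have "cost (curve h t) (U \<omega>, V \<omega>) \<noteq> 0"
    using minimizer_cost_eq_0[OF h assms(2)] assms(1) by (auto simp: off_def on_curve_iff)
  moreover have "cost (curve h t) (U \<omega>, V \<omega>) \<le> 0" by (rule minimizer_nonpos[OF assms(2)])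
  ultimately have "cost (curve h t) (U \<omega>, V \<omega>) < 0" by linarith
  then show ?thesis unfolding cost_curve_expand .
qed

lemma square_identity: "2 * t * (t - w \<omega>) = t\<^sup>2 + (t - w \<omega>)\<^sup>2 - (w \<omega>)\<^sup>2"
  by (simp add: power2_eq_square algebra_simps)

text \<open>Pure dilation as test direction: 2 t (t - w) \<ge> t^2 - w^2 bounds the mean of T^2 off
  the curve by E[w^2]. The truncation at N is there because \<open>first_order\<close> takes an
  integrable bound.\<close>

lemma integrable_T2: "integrable M (\<lambda>\<omega>. if off \<omega> then (T \<omega>)\<^sup>2 else 0)"
proof -
  define x where "x \<omega> = (if off \<omega> then (T \<omega>)\<^sup>2 else 0)" for \<omega>
  have [measurable]: "x \<in> borel_measurable M" unfolding x_def by measurable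
  have x0: "0 \<le> x \<omega>" for \<omega> by (simp add: x_def)
  have i: "integrable M (\<lambda>\<omega>. min (real N) (x \<omega>))" for N :: nat
    by (rule integrable_const_bound[where B = "real N"]) (use x0 in auto)
  have le: "(\<integral>\<omega>. min (real N) (x \<omega>) \<partial>M) \<le> (\<integral>\<omega>. (w \<omega>)\<^sup>2 \<partial>M)" for N :: nat
  proof -
    have "(\<integral>\<omega>. min (real N) (x \<omega>) - (w \<omega>)\<^sup>2 \<partial>M) \<le> 0"
    proof (rule first_order[where \<phi> = "\<lambda>_. 0" and \<theta> = 1 and ?e0.0 = 1])
      show "mono (\<lambda>t. t + h t + 1 * 0)" using nonexpansive_mono_fst[OF h] by (simp add: mono_def)
      show "integrable M (\<lambda>\<omega>. min (real N) (x \<omega>) - (w \<omega>)\<^sup>2)" using i w2 by simp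
      show "AE \<omega> in M. \<forall>t\<in>minimizers h (U \<omega>, V \<omega>). min (real N) (x \<omega>) - (w \<omega>)\<^sup>2
          \<le> 0 * (t - h t - V \<omega>) + 1 * (2 * t * (t - (U \<omega> + V \<omega>) / 2))"
        using AE_T
      proof eventually_elim
        case (elim \<omega>)
        show ?case
        proof
          fix t assume t: "t \<in> minimizers h (U \<omega>, V \<omega>)"
          have "x \<omega> \<le> t\<^sup>2" using elim t by (auto simp: x_def)
          then have "min (real N) (x \<omega>) \<le> t\<^sup>2" by simp
          moreover have "0 \<le> (t - w \<omega>)\<^sup>2" by simp
          ultimately show "min (real N) (x \<omega>) - (w \<omega>)\<^sup>2
              \<le> 0 * (t - h t - V \<omega>) + 1 * (2 * t * (t - (U \<omega> + V \<omega>) / 2))"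
            unfolding w_def[symmetric] square_identity by (simp add: add_increasing2)
        qed
      qed
    qed auto
    then show ?thesis using i w2 by simp
  qed
  have "(\<integral>\<^sup>+\<omega>. ennreal (x \<omega>) \<partial>M) = (\<integral>\<^sup>+\<omega>. (SUP N::nat. ennreal (min (real N) (x \<omega>))) \<partial>M)"
  proof (rule nn_integral_cong)
    fix \<omega>
    obtain N :: nat where "x \<omega> \<le> real N" using real_arch_simple by blast
    then have "ennreal (x \<omega>) \<le> ennreal (min (real N) (x \<omega>))" by simp
    also have "\<dots> \<le> (SUP N::nat. ennreal (min (real N) (x \<omega>)))" by (rule SUP_upper) simp
    finally show "ennreal (x \<omega>) = (SUP N::nat. ennreal (min (real N) (x \<omega>)))"
      by (intro antisym SUP_least ennreal_leI) auto
  qed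
  also have "\<dots> = (SUP N::nat. \<integral>\<^sup>+\<omega>. ennreal (min (real N) (x \<omega>)) \<partial>M)"
    by (rule nn_integral_monotone_convergence_SUP) (auto simp: incseq_def le_fun_def intro!: ennreal_leI)
  also have "\<dots> \<le> ennreal (\<integral>\<omega>. (w \<omega>)\<^sup>2 \<partial>M)"
  proof (rule SUP_least)
    fix N :: nat
    have "(\<integral>\<^sup>+\<omega>. ennreal (min (real N) (x \<omega>)) \<partial>M) = ennreal (\<integral>\<omega>. min (real N) (x \<omega>) \<partial>M)"
      by (rule nn_integral_eq_integral[OF i]) (use x0 in auto)
    also have "\<dots> \<le> ennreal (\<integral>\<omega>. (w \<omega>)\<^sup>2 \<partial>M)" by (rule ennreal_leI[OF le])
    finally show "(\<integral>\<^sup>+\<omega>. ennreal (min (real N) (x \<omega>)) \<partial>M) \<le> ennreal (\<integral>\<omega>. (w \<omega>)\<^sup>2 \<partial>M)" .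
  qed
  finally have "(\<integral>\<^sup>+\<omega>. ennreal (x \<omega>) \<partial>M) < \<infinity>" by (rule order.strict_trans1) simp
  then have "integrable M x" by (intro integrableI_nonneg) (use x0 in auto)
  then show ?thesis unfolding x_def .
qed

text \<open>The pricing error at the selected curve point, set to 0 on the curve, where the price
  off the columns is V itself. The first-order conditions are to show that its mean given X1
  vanishes.\<close>

definition D :: "'a \<Rightarrow> real" where "D \<omega> = (if off \<omega> then T \<omega> - h (T \<omega>) - V \<omega> else 0)"

lemma measurable_D [measurable]: "D \<in> borel_measurable M"
  unfolding D_def using h by measurable

lemma integrable_D: "integrable M D"
proof (rule Bochner_Integration.integrable_bound)
  have "integrable M (\<lambda>\<omega>. if off \<omega> then T \<omega> else 0)"
  proof (rule integrable_of_square)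
    have "(\<lambda>\<omega>. (if off \<omega> then T \<omega> else 0)\<^sup>2) = (\<lambda>\<omega>. if off \<omega> then (T \<omega>)\<^sup>2 else 0)" by auto
    then show "integrable M (\<lambda>\<omega>. (if off \<omega> then T \<omega> else 0)\<^sup>2)" using integrable_T2 by simp
  qed measurable
  then show "integrable M (\<lambda>\<omega>. 2 * \<bar>if off \<omega> then T \<omega> else 0\<bar> + \<bar>h 0\<bar> + \<bar>V \<omega>\<bar>)" using V1 by simp
  show "AE \<omega> in M. norm (D \<omega>) \<le> norm (2 * \<bar>if off \<omega> then T \<omega> else 0\<bar> + \<bar>h 0\<bar> + \<bar>V \<omega>\<bar>)"
  proof (rule AE_I2)
    fix \<omega>
    have "\<bar>T \<omega> - h (T \<omega>) - V \<omega>\<bar> \<le> 2 * \<bar>T \<omega>\<bar> + \<bar>h 0\<bar> + \<bar>V \<omega>\<bar>"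
      by (rule nonexpansive_snd_bound[OF h])
    then show "norm (D \<omega>) \<le> norm (2 * \<bar>if off \<omega> then T \<omega> else 0\<bar> + \<bar>h 0\<bar> + \<bar>V \<omega>\<bar>)" by (simp add: D_def)
  qed
qed measurable

text \<open>The dilation term is at least -\<theta> w^2, which is integrable, so \<theta> can be
  sent to 0.\<close>

lemma first_order_limit:
  fixes \<phi> :: "real \<Rightarrow> real"
  assumes \<phi>: "continuous_on UNIV \<phi>" "\<And>t. \<bar>\<phi> t\<bar> \<le> 1"
    and e0: "0 < e0" "mono (\<lambda>t. t + h t + e0 * \<phi> t)"
    and B: "integrable M B"
    and Bd: "AE \<omega> in M. \<forall>t\<in>minimizers h (U \<omega>, V \<omega>). B \<omega> \<le> \<phi> t * (t - h t - V \<omega>)"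
  shows "(\<integral>\<omega>. B \<omega> \<partial>M) \<le> 0"
proof (rule field_le_epsilon)
  fix \<epsilon> :: real assume \<epsilon>: "0 < \<epsilon>"
  define c where "c = (\<integral>\<omega>. (w \<omega>)\<^sup>2 \<partial>M)"
  have c: "0 \<le> c" unfolding c_def by (rule integral_nonneg_AE) simp
  define \<theta> where "\<theta> = \<epsilon> / (c + 1)"
  have \<theta>: "0 < \<theta>" using \<epsilon> c by (simp add: \<theta>_def)
  have "(\<integral>\<omega>. B \<omega> - \<theta> * (w \<omega>)\<^sup>2 \<partial>M) \<le> 0"
  proof (rule first_order[OF \<phi> e0 \<theta>])
    show "integrable M (\<lambda>\<omega>. B \<omega> - \<theta> * (w \<omega>)\<^sup>2)" using B w2 by simp
    show "AE \<omega> in M. \<forall>t\<in>minimizers h (U \<omega>, V \<omega>). B \<omega> - \<theta> * (w \<omega>)\<^sup>2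
        \<le> \<phi> t * (t - h t - V \<omega>) + \<theta> * (2 * t * (t - (U \<omega> + V \<omega>) / 2))"
      using Bd
    proof eventually_elim
      case (elim \<omega>)
      show ?case
      proof
        fix t assume "t \<in> minimizers h (U \<omega>, V \<omega>)"
        then have "B \<omega> \<le> \<phi> t * (t - h t - V \<omega>)" using elim by blast
        moreover have "- (w \<omega>)\<^sup>2 \<le> 2 * t * (t - w \<omega>)" unfolding square_identity by simp
        then have "\<theta> * - (w \<omega>)\<^sup>2 \<le> \<theta> * (2 * t * (t - w \<omega>))" using \<theta> by (intro mult_left_mono) auto
        ultimately show "B \<omega> - \<theta> * (w \<omega>)\<^sup>2 \<le> \<phi> t * (t - h t - V \<omega>) + \<theta> * (2 * t * (t - (U \<omega> + V \<omega>) / 2))"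
          unfolding w_def[symmetric] by simp
      qed
    qed
  qed
  then have "(\<integral>\<omega>. B \<omega> \<partial>M) \<le> \<theta> * c" using B w2 by (simp add: c_def)
  also have "\<dots> \<le> \<epsilon>" using \<epsilon> c by (simp add: \<theta>_def field_simps)
  finally show "(\<integral>\<omega>. B \<omega> \<partial>M) \<le> 0 + \<epsilon>" by simp
qed

text \<open>At the top of a column all mass off the curve would pull the first coordinate to the
  right; a perturbation that moves only points near this corner excludes that.\<close>

lemma AE_not_column_top_aux:
  assumes top: "column_top h t0"
  shows "AE \<omega> in M. off \<omega> \<longrightarrow> T \<omega> \<noteq> t0"
proof -
  define r b where "r = t0 + h t0" and "b = t0 - h t0"
  obtain s where s: "s < t0" "s + h s = r" using top by (auto simp: column_top_def r_def)
  have gt: "r < t + h t" if "t0 < t" for t using top that by (auto simp: column_top_def r_def)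
  define \<delta> where "\<delta> n = (t0 - s) * inverse (real (Suc n))" for n
  have \<delta>: "0 < \<delta> n" "\<delta> n \<le> t0 - s" for n
  proof -
    show "0 < \<delta> n" using s(1) by (simp add: \<delta>_def)
    have "\<delta> n \<le> (t0 - s) * 1" unfolding \<delta>_def using s(1) by (intro mult_left_mono) (auto simp: inverse_le_1_iff)
    then show "\<delta> n \<le> t0 - s" by simp
  qed
  have \<delta>_lim: "\<delta> \<longlonglongrightarrow> 0"
    unfolding \<delta>_def by (intro tendsto_mult_right_zero LIMSEQ_inverse_real_of_nat)
  \<comment> \<open>A gauge of distance from the corner: parameter distance before it, growth of the
    first coordinate beyond it. The tent max(0, \<delta> - g) then falls no faster than the first
    coordinate rises, so the moved coordinate stays monotone.\<close>
  define g where "g t = max 0 (t0 - t) + (max t t0 + h (max t t0) - r)" for t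
  have g_le: "g t = t0 - t" if "t \<le> t0" for t using that by (simp add: g_def r_def)
  have g_ge: "g t = t + h t - r" if "t0 \<le> t" for t using that by (simp add: g_def)
  have g_pos: "0 < g t" if "t \<noteq> t0" for t
    using that g_le[of t] g_ge[of t] gt[of t] by (cases "t < t0") auto
  have g0: "0 \<le> g t" for t using g_pos[of t] g_le[of t0] by (cases "t = t0") auto
  define \<phi> where "\<phi> n t = max 0 (1 - g t / \<delta> n)" for n t
  have \<phi>01: "0 \<le> \<phi> n t" "\<phi> n t \<le> 1" for n t using g0[of t] \<delta>(1)[of n] by (auto simp: \<phi>_def)
  have \<phi>_cont: "continuous_on UNIV (\<phi> n)" for n
  proof -
    have "continuous_on UNIV (\<lambda>t. h (max t t0))"
      by (rule continuous_on_compose2[OF nonexpansive_continuous_on[OF h, of UNIV]]) (auto intro!: continuous_intros)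
    then show ?thesis unfolding \<phi>_def g_def using \<delta>(1)[of n] by (intro continuous_intros) auto
  qed
  have \<phi>_scaled: "\<delta> n * \<phi> n t = max 0 (\<delta> n - g t)" for n t
    using \<delta>(1)[of n] unfolding \<phi>_def by (simp add: max_mult_distrib_left right_diff_distrib)
  have \<phi>_mono: "mono (\<lambda>t. t + h t + \<delta> n * \<phi> n t)" for n
  proof (rule monoI)
    have le: "p + h p + \<delta> n * \<phi> n p \<le> q + h q + \<delta> n * \<phi> n q" if "p \<le> q" "q \<le> t0" for p q
      unfolding \<phi>_scaled using that g_le[of p] g_le[of q] nonexpansive_mono_fst[OF h that(1)] by auto
    have ge: "p + h p + \<delta> n * \<phi> n p \<le> q + h q + \<delta> n * \<phi> n q" if "p \<le> q" "t0 \<le> p" for p q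
      unfolding \<phi>_scaled using that g_ge[of p] g_ge[of q] nonexpansive_mono_fst[OF h that(1)] by auto
    fix p q :: real assume "p \<le> q"
    then show "p + h p + \<delta> n * \<phi> n p \<le> q + h q + \<delta> n * \<phi> n q"
      using le[of p q] ge[of p q] le[of p t0] ge[of t0 q] by (cases "q \<le> t0"; cases "t0 \<le> p") auto
  qed
  \<comment> \<open>On the curve all tied minimizers must be covered. In the corner's own column
    they lose at most 2 \<delta>; in a column with abscissa in (r, r + \<delta>) the loss is at most
    |b| + |V|. For each outcome both contributions vanish in the limit.\<close>
  define B where "B n \<omega> = (if off \<omega> then \<phi> n (T \<omega>) * D \<omega>
    else - (2 * \<delta> n) - (if r < U \<omega> \<and> U \<omega> < r + \<delta> n then \<bar>b\<bar> + \<bar>V \<omega>\<bar> else 0))" for n \<omega>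
  have B_on: "B n \<omega> \<le> - (2 * \<delta> n)" if "\<not> off \<omega>" for n \<omega>
  proof -
    have "0 \<le> \<bar>b\<bar> + \<bar>V \<omega>\<bar>" by simp
    then show ?thesis using that unfolding B_def by (auto simp del: abs_ge_zero)
  qed
  have [measurable]: "\<phi> n \<in> borel_measurable borel" for n
    by (rule borel_measurable_continuous_onI[OF \<phi>_cont])
  have [measurable]: "B n \<in> borel_measurable M" for n unfolding B_def by measurable
  have bound: "norm (B n \<omega>) \<le> \<bar>D \<omega>\<bar> + 2 * (t0 - s) + \<bar>b\<bar> + \<bar>V \<omega>\<bar>" for n \<omega>
  proof (cases "off \<omega>")
    case True
    have "\<bar>\<phi> n (T \<omega>) * D \<omega>\<bar> \<le> 1 * \<bar>D \<omega>\<bar>" unfolding abs_mult using \<phi>01[of n "T \<omega>"] by (intro mult_right_mono) auto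
    then show ?thesis using True s(1) by (simp add: B_def)
  next
    case False
    define e where "e = (if r < U \<omega> \<and> U \<omega> < r + \<delta> n then \<bar>b\<bar> + \<bar>V \<omega>\<bar> else 0)"
    have "0 \<le> e" "e \<le> \<bar>b\<bar> + \<bar>V \<omega>\<bar>" by (auto simp: e_def)
    moreover have "B n \<omega> = - (2 * \<delta> n) - e" using False by (simp add: B_def e_def)
    ultimately show ?thesis using \<delta>[of n] abs_ge_zero[of "D \<omega>"] by simp
  qed
  have dom: "integrable M (\<lambda>\<omega>. \<bar>D \<omega>\<bar> + 2 * (t0 - s) + \<bar>b\<bar> + \<bar>V \<omega>\<bar>)"
    using integrable_D V1 by simp
  have B_int: "integrable M (B n)" for n
    by (rule Bochner_Integration.integrable_bound[OF dom]) (use bound in \<open>auto intro: order_trans[OF _ abs_ge_self]\<close>)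
  have B_le: "(\<integral>\<omega>. B n \<omega> \<partial>M) \<le> 0" for n
  proof (rule first_order_limit[OF \<phi>_cont _ \<delta>(1) \<phi>_mono B_int])
    show "\<bar>\<phi> n t\<bar> \<le> 1" for t using \<phi>01[of n t] by simp
    show "AE \<omega> in M. \<forall>t\<in>minimizers h (U \<omega>, V \<omega>). B n \<omega> \<le> \<phi> n t * (t - h t - V \<omega>)"
      using AE_T
    proof eventually_elim
      case (elim \<omega>)
      show ?case
      proof
        fix t assume t: "t \<in> minimizers h (U \<omega>, V \<omega>)"
        show "B n \<omega> \<le> \<phi> n t * (t - h t - V \<omega>)"
        proof (cases "off \<omega>")
          case True
          then show ?thesis using elim t by (simp add: B_def D_def)
        next
          case False
          define \<tau> where "\<tau> = (U \<omega> + V \<omega>) / 2"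
          have on: "curve h \<tau> = (U \<omega>, V \<omega>)" using on_curve[OF False] by (simp add: \<tau>_def)
          then have UV: "U \<omega> = \<tau> + h \<tau>" "V \<omega> = \<tau> - h \<tau>" by (auto simp: curve_def)
          show ?thesis
          proof (cases "0 \<le> \<phi> n t * (t - h t - V \<omega>)")
            case True
            have "B n \<omega> \<le> 0" using B_on[OF False, of n] \<delta>(1)[of n] by simp
            then show ?thesis using True by simp
          next
            case neg: False
            then have \<phi>t: "0 < \<phi> n t" and zt: "t - h t < V \<omega>"
              using \<phi>01(1)[of n t] by (auto simp: not_le mult_less_0_iff)
            have lt: "t < \<tau>" using zt nonexpansive_mono_snd[OF h, of \<tau> t] UV by force
            have xt: "t + h t = \<tau> + h \<tau>"
              using minimizer_of_curve_point[OF h, of t \<tau>] t zt on UV by auto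
            have gt': "g t < \<delta> n" using \<phi>t \<delta>(1)[of n] unfolding \<phi>_def by (simp add: max_def split: if_splits)
            have low: "t - h t - V \<omega> \<le> \<phi> n t * (t - h t - V \<omega>)"
            proof -
              have "1 * (t - h t - V \<omega>) \<le> \<phi> n t * (t - h t - V \<omega>)"
                using \<phi>01(2)[of n t] zt by (intro mult_right_mono_neg) auto
              then show ?thesis by simp
            qed
            show ?thesis
            proof (cases "t < t0")
              case True
              then have "s < t" using gt' g_le[of t] \<delta>(2)[of n] by simp
              then have "t + h t = r" using column_between[OF h _ _ s(2), of t t0] True r_def by simp
              then have "\<tau> \<le> t0" using gt[of \<tau>] xt by force
              then have "- (2 * \<delta> n) \<le> t - h t - V \<omega>" using UV xt gt' g_le[of t] True by simp
              then show ?thesis using low B_on[OF False, of n] by linarith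
            next
              case ge: False
              have "t \<noteq> t0" using xt gt[of \<tau>] lt by (auto simp: r_def)
              then have "r < t + h t" using gt ge by simp
              moreover have "t + h t < r + \<delta> n" using gt' g_ge[of t] ge by simp
              ultimately have "B n \<omega> = - (2 * \<delta> n) - (\<bar>b\<bar> + \<bar>V \<omega>\<bar>)"
                using False UV xt by (simp add: B_def)
              moreover have "b \<le> t - h t" unfolding b_def using nonexpansive_mono_snd[OF h, of t0 t] ge by simp
              ultimately show ?thesis using low \<delta>(1)[of n] by linarith
            qed
          qed
        qed
      qed
    qed
  qed
  define B0 where "B0 \<omega> = (if off \<omega> \<and> T \<omega> = t0 then D \<omega> else 0)" for \<omega>
  have [measurable]: "B0 \<in> borel_measurable M" unfolding B0_def by measurable
  have lim: "(\<lambda>n. B n \<omega>) \<longlonglongrightarrow> B0 \<omega>" for \<omega>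
  proof (cases "off \<omega>")
    case True
    show ?thesis
    proof (cases "T \<omega> = t0")
      case True
      then have "\<phi> n (T \<omega>) = 1" for n using g_le[of t0] by (simp add: \<phi>_def)
      then show ?thesis using True \<open>off \<omega>\<close> by (simp add: B_def B0_def)
    next
      case False
      have "\<forall>\<^sub>F n in sequentially. \<delta> n < g (T \<omega>)" using order_tendstoD(2)[OF \<delta>_lim g_pos[OF False]] .
      then have "\<forall>\<^sub>F n in sequentially. B n \<omega> = 0"
      proof eventually_elim
        case (elim n)
        then have "\<phi> n (T \<omega>) = 0" using \<delta>(1)[of n] by (simp add: \<phi>_def)
        then show ?case using \<open>off \<omega>\<close> by (simp add: B_def)
      qed
      then show ?thesis using False by (simp add: B0_def tendsto_eventually)
    qed
  next
    case False
    have "\<forall>\<^sub>F n in sequentially. \<not> (r < U \<omega> \<and> U \<omega> < r + \<delta> n)"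
    proof (cases "r < U \<omega>")
      case True
      then have "\<forall>\<^sub>F n in sequentially. \<delta> n < U \<omega> - r" using order_tendstoD(2)[OF \<delta>_lim] by simp
      then show ?thesis by eventually_elim simp
    qed simp
    then have "\<forall>\<^sub>F n in sequentially. B n \<omega> = - (2 * \<delta> n)"
      by eventually_elim (use False in \<open>auto simp: B_def\<close>)
    moreover have "(\<lambda>n. - (2 * \<delta> n)) \<longlonglongrightarrow> - (2 * 0)" by (intro tendsto_intros \<delta>_lim)
    ultimately show ?thesis using False by (simp add: B0_def tendsto_cong)
  qed
  have B0_int: "integrable M B0"
    by (rule Bochner_Integration.integrable_bound[OF integrable_D]) (auto simp: B0_def)
  have "(\<lambda>n. \<integral>\<omega>. B n \<omega> \<partial>M) \<longlonglongrightarrow> (\<integral>\<omega>. B0 \<omega> \<partial>M)"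
    by (rule integral_dominated_convergence[OF _ _ dom]) (use lim bound in auto)
  then have le0: "(\<integral>\<omega>. B0 \<omega> \<partial>M) \<le> 0" by (rule LIMSEQ_le_const2) (use B_le in auto)
  have pos: "AE \<omega> in M. off \<omega> \<and> T \<omega> = t0 \<longrightarrow> 0 < B0 \<omega>"
    using AE_T
  proof eventually_elim
    case (elim \<omega>)
    show ?case
    proof
      assume *: "off \<omega> \<and> T \<omega> = t0"
      then have t0: "t0 \<in> minimizers h (U \<omega>, V \<omega>)" using elim by simp
      have neg: "(r - U \<omega>) * (b - V \<omega>) < 0" using off_cost_neg[OF _ t0] * by (simp add: r_def b_def)
      \<comment> \<open>Otherwise the lower point s of the same column would be cheaper than
        t0.\<close>
      have "U \<omega> > r"
      proof (rule ccontr)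
        assume "\<not> r < U \<omega>"
        then have "0 < r - U \<omega>" using neg by (auto simp: mult_less_0_iff)
        moreover have "s - h s < b" using s unfolding b_def r_def by simp
        ultimately have "(r - U \<omega>) * (s - h s - V \<omega>) < (r - U \<omega>) * (b - V \<omega>)" by simp
        moreover have "cost (curve h t0) (U \<omega>, V \<omega>) \<le> cost (curve h s) (U \<omega>, V \<omega>)"
          using t0 by (auto simp: minimizers_def)
        ultimately show False using s(2) unfolding cost_curve_expand r_def b_def by simp
      qed
      then have "V \<omega> < b" using neg by (auto simp: mult_less_0_iff)
      then show "0 < B0 \<omega>" using * by (simp add: B0_def D_def b_def)
    qed
  qed
  then have nonneg: "AE \<omega> in M. 0 \<le> B0 \<omega>"
    by eventually_elim (auto simp: B0_def split: if_splits)
  then have "0 \<le> (\<integral>\<omega>. B0 \<omega> \<partial>M)" by (rule integral_nonneg_AE)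
  then have "(\<integral>\<omega>. B0 \<omega> \<partial>M) = 0" using le0 by simp
  then have "AE \<omega> in M. B0 \<omega> = 0" using integral_nonneg_eq_0_iff_AE[OF B0_int nonneg] by simp
  with pos show ?thesis by eventually_elim auto
qed

lemma AE_not_column_top: "AE \<omega> in M. off \<omega> \<longrightarrow> \<not> column_top h (T \<omega>)"
proof -
  have "AE \<omega> in M. \<forall>t\<in>{t. column_top h t}. off \<omega> \<longrightarrow> T \<omega> \<noteq> t"
    using AE_not_column_top_aux by (subst AE_ball_countable[OF countable_column_tops[OF h]]) auto
  then show ?thesis by eventually_elim auto
qed

end

text \<open>Where there is no minimizer, the condition on B in \<open>first_order\<close> is
  vacuous, so B may be any constant N there. This gives N P(A) \<le> E[w^2] for every N.\<close>

lemma (in dual_optimal) AE_minimizer_exists: "AE \<omega> in M. minimizers h (U \<omega>, V \<omega>) \<noteq> {}"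
proof -
  define w where "w = (\<lambda>\<omega>. (U \<omega> + V \<omega>) / 2)"
  have w2: "integrable M (\<lambda>\<omega>. (w \<omega>)\<^sup>2)" unfolding w_def by (rule integrable_half_sum_square(1)[OF U V U2 V2])
  define A where "A = {\<omega> \<in> space M. minimizers h (U \<omega>, V \<omega>) = {}}"
  have "A = (\<lambda>\<omega>. (U \<omega>, V \<omega>)) -` {y. minimizers h y = {}} \<inter> space M" by (auto simp: A_def)
  also have "\<dots> \<in> sets M"
    by (rule measurable_sets[OF _ sets_minimizers_empty[OF h]]) measurable
  finally have [measurable]: "A \<in> sets M" .
  have le: "real N * prob A \<le> (\<integral>\<omega>. (w \<omega>)\<^sup>2 \<partial>M)" for N :: nat
  proof -
    have i: "integrable M (\<lambda>\<omega>. real N * indicator A \<omega>)"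
      by (rule integrable_const_bound[where B = "real N"]) (auto simp: indicator_def)
    have "(\<integral>\<omega>. real N * indicator A \<omega> - (w \<omega>)\<^sup>2 \<partial>M) \<le> 0"
    proof (rule first_order[where \<phi> = "\<lambda>_. 0" and \<theta> = 1 and ?e0.0 = 1])
      show "mono (\<lambda>t. t + h t + 1 * 0)" using nonexpansive_mono_fst[OF h] by (simp add: mono_def)
      show "integrable M (\<lambda>\<omega>. real N * indicator A \<omega> - (w \<omega>)\<^sup>2)" using i w2 by simp
      show "AE \<omega> in M. \<forall>t\<in>minimizers h (U \<omega>, V \<omega>). real N * indicator A \<omega> - (w \<omega>)\<^sup>2
          \<le> 0 * (t - h t - V \<omega>) + 1 * (2 * t * (t - (U \<omega> + V \<omega>) / 2))"
      proof (intro AE_I2 ballI)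
        fix \<omega> t assume t: "t \<in> minimizers h (U \<omega>, V \<omega>)"
        then have "\<omega> \<notin> A" by (auto simp: A_def)
        moreover have "2 * t * (t - w \<omega>) = t\<^sup>2 + (t - w \<omega>)\<^sup>2 - (w \<omega>)\<^sup>2" by (simp add: power2_eq_square algebra_simps)
        ultimately show "real N * indicator A \<omega> - (w \<omega>)\<^sup>2 \<le> 0 * (t - h t - V \<omega>) + 1 * (2 * t * (t - (U \<omega> + V \<omega>) / 2))"
          by (simp add: w_def)
      qed
    qed auto
    then show ?thesis using i w2 by simp
  qed
  have "prob A = 0"
  proof (rule ccontr)
    assume "prob A \<noteq> 0"
    then have pos: "0 < prob A" by (simp add: zero_less_measure_iff)
    obtain N :: nat where "(\<integral>\<omega>. (w \<omega>)\<^sup>2 \<partial>M) / prob A < real N" using reals_Archimedean2 by blast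
    then show False using le[of N] pos by (simp add: field_simps)
  qed
  then have "A \<in> null_sets M" by (simp add: emeasure_eq_measure null_setsI)
  then show ?thesis by (rule AE_I') (auto simp: A_def)
qed

text \<open>D-regularity excludes strict ties, and ties in a column or row have cost 0, hence put y
  on the curve.\<close>

lemma (in dual_optimal) dual_regular_of_D_regular:
  assumes D: "D_regular (distr M borel (\<lambda>\<omega>. (U \<omega>, V \<omega>)))"
  shows "dual_regular M U V h"
proof
  have "AE \<omega> in M. \<forall>s t. s \<in> minimizers h (U \<omega>, V \<omega>) \<longrightarrow> t \<in> minimizers h (U \<omega>, V \<omega>) \<longrightarrow> s < t \<longrightarrow>
      s + h s = t + h t \<or> s - h s = t - h t"
    by (rule AE_no_strict_ties[OF _ D h]) measurable
  then show "AE \<omega> in M. h ((U \<omega> + V \<omega>) / 2) \<noteq> (U \<omega> - V \<omega>) / 2 \<longrightarrow> (\<exists>!t. t \<in> minimizers h (U \<omega>, V \<omega>))"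
    using AE_minimizer_exists
  proof eventually_elim
    case (elim \<omega>)
    show ?case
    proof
      assume off: "h ((U \<omega> + V \<omega>) / 2) \<noteq> (U \<omega> - V \<omega>) / 2"
      have less: False if st: "s \<in> minimizers h (U \<omega>, V \<omega>)" "t \<in> minimizers h (U \<omega>, V \<omega>)" "s < t" for s t
      proof -
        have "cost (curve h t) (U \<omega>, V \<omega>) = 0"
          using elim(1) st tie_same_fst(2)[OF st(1,2)] tie_same_snd(2)[OF st(1,2)] by blast
        then have "curve h ((U \<omega> + V \<omega>) / 2) = (U \<omega>, V \<omega>)" by (rule minimizer_cost_eq_0[OF h st(2)])
        then show False using off by (simp add: on_curve_iff)
      qed
      obtain t where t: "t \<in> minimizers h (U \<omega>, V \<omega>)" using elim(2) by blast
      show "\<exists>!t. t \<in> minimizers h (U \<omega>, V \<omega>)"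
      proof (intro ex1I[of _ t] t)
        fix s assume "s \<in> minimizers h (U \<omega>, V \<omega>)"
        then show "s = t" using less[OF _ t] less[OF t] by (cases s t rule: linorder_cases) auto
      qed
    qed
  qed
qed

section \<open>Reflection through the origin\<close>

lemma cost_reflect: "cost (curve (\<lambda>t. - k (- t)) t) (- u, - v) = cost (curve k (- t)) (u, v)"
  by (simp add: cost_def curve_def algebra_simps)

lemma depth_reflect: "depth (\<lambda>t. - k (- t)) (- u, - v) = depth k (u, v)"
proof -
  have le: "depth (\<lambda>t. - k (- t)) (- u, - v) \<le> depth k (u, v)" for k u v
    unfolding depth_def[of "\<lambda>t. - k (- t)"] by (rule SUP_least) (simp only: cost_reflect depth_ge)
  show ?thesis
    by (rule antisym[OF le]) (use le[of "\<lambda>t. - k (- t)" "- u" "- v"] in simp)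
qed

lemma minimizers_reflect:
  "t \<in> minimizers (\<lambda>t. - k (- t)) (- u, - v) \<longleftrightarrow> - t \<in> minimizers k (u, v)"
proof
  assume t: "t \<in> minimizers (\<lambda>t. - k (- t)) (- u, - v)"
  have "cost (curve k (- t)) (u, v) \<le> cost (curve k s) (u, v)" for s
  proof -
    have "cost (curve (\<lambda>t. - k (- t)) t) (- u, - v) \<le> cost (curve (\<lambda>t. - k (- t)) (- s)) (- u, - v)"
      using t unfolding minimizers_def by blast
    then show ?thesis unfolding cost_reflect by simp
  qed
  then show "- t \<in> minimizers k (u, v)" by (simp add: minimizers_def)
next
  assume "- t \<in> minimizers k (u, v)"
  then show "t \<in> minimizers (\<lambda>t. - k (- t)) (- u, - v)" by (simp add: minimizers_def cost_reflect)
qed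

context dual_regular
begin

lemma reflected: "dual_regular M (\<lambda>\<omega>. - U \<omega>) (\<lambda>\<omega>. - V \<omega>) (\<lambda>t. - h (- t))"
proof
  have val: "dual_value M (\<lambda>\<omega>. - U \<omega>) (\<lambda>\<omega>. - V \<omega>) (\<lambda>t. - k (- t)) = dual_value M U V k" for k
    unfolding dual_value_def depth_reflect ..
  show "nonexpansive (\<lambda>t. - h (- t))" by (rule nonexpansive_minus_reflect[OF h])
  show "dual_value M (\<lambda>\<omega>. - U \<omega>) (\<lambda>\<omega>. - V \<omega>) (\<lambda>t. - h (- t)) < \<infinity>" unfolding val by (rule finite_value)
  fix k assume "nonexpansive k"
  from optimal[OF nonexpansive_minus_reflect[OF this]]
  show "dual_value M (\<lambda>\<omega>. - U \<omega>) (\<lambda>\<omega>. - V \<omega>) (\<lambda>t. - h (- t)) \<le> dual_value M (\<lambda>\<omega>. - U \<omega>) (\<lambda>\<omega>. - V \<omega>) k"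
    using val[of "\<lambda>t. - k (- t)"] unfolding val by simp
next
  show "AE \<omega> in M. - h (- ((- U \<omega> + - V \<omega>) / 2)) \<noteq> (- U \<omega> - - V \<omega>) / 2 \<longrightarrow>
      (\<exists>!t. t \<in> minimizers (\<lambda>t. - h (- t)) (- U \<omega>, - V \<omega>))"
    using unique
  proof eventually_elim
    case (elim \<omega>)
    show ?case
    proof
      assume "- h (- ((- U \<omega> + - V \<omega>) / 2)) \<noteq> (- U \<omega> - - V \<omega>) / 2"
      moreover have eq: "- ((- U \<omega> + - V \<omega>) / 2) = (U \<omega> + V \<omega>) / 2" "(- U \<omega> - - V \<omega>) / 2 = - ((U \<omega> - V \<omega>) / 2)"
        by (simp_all add: field_simps)
      ultimately have "h ((U \<omega> + V \<omega>) / 2) \<noteq> (U \<omega> - V \<omega>) / 2" unfolding eq by simp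
      then have "\<exists>!t. t \<in> minimizers h (U \<omega>, V \<omega>)" using elim by blast
      then obtain t where t: "t \<in> minimizers h (U \<omega>, V \<omega>)" "\<And>s. s \<in> minimizers h (U \<omega>, V \<omega>) \<Longrightarrow> s = t" by blast
      show "\<exists>!t. t \<in> minimizers (\<lambda>t. - h (- t)) (- U \<omega>, - V \<omega>)"
        unfolding minimizers_reflect
      proof (intro ex1I[of _ "- t"])
        show "- (- t) \<in> minimizers h (U \<omega>, V \<omega>)" using t(1) by simp
        fix s assume "- s \<in> minimizers h (U \<omega>, V \<omega>)"
        from t(2)[OF this] show "s = - t" by simp
      qed
    qed
  qed
qed (use U2 V2 in auto)

text \<open>Along the column of a minimizer of negative cost, the cost is affine with nonzero slope.
  The minimizer must be an end of the column, the upper one if U lies to the right and the lower one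
  if U lies to the left; upper ends are null by \<open>AE_not_column_top\<close>, lower ends by its
  reflection.\<close>

lemma AE_off_not_column: "AE \<omega> in M. off \<omega> \<longrightarrow> T \<omega> + h (T \<omega>) \<notin> columns h"
proof -
  interpret R: dual_regular M "\<lambda>\<omega>. - U \<omega>" "\<lambda>\<omega>. - V \<omega>" "\<lambda>t. - h (- t)" by (rule reflected)
  have off: "R.off \<omega> = off \<omega>" for \<omega>
  proof -
    have eq: "- ((- U \<omega> + - V \<omega>) / 2) = (U \<omega> + V \<omega>) / 2" "(- U \<omega> - - V \<omega>) / 2 = - ((U \<omega> - V \<omega>) / 2)"
      by (simp_all add: field_simps)
    show ?thesis unfolding R.off_def off_def eq by simp
  qed
  show ?thesis
    using AE_T R.AE_T AE_not_column_top R.AE_not_column_top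
  proof eventually_elim
    case (elim \<omega>)
    show ?case
    proof
      assume *: "off \<omega>"
      define t where "t = T \<omega>"
      have t: "t \<in> minimizers h (U \<omega>, V \<omega>)" using elim(1) * by (simp add: t_def)
      have "- t \<in> minimizers (\<lambda>t. - h (- t)) (- U \<omega>, - V \<omega>)" unfolding minimizers_reflect using t by simp
      then have RT: "R.T \<omega> = - t" using elim(2) * off by auto
      have top: "\<not> column_top h t" and bot: "\<not> column_top (\<lambda>t. - h (- t)) (- t)"
        using elim(3,4) * off RT by (auto simp: t_def)
      have neg: "(t + h t - U \<omega>) * (t - h t - V \<omega>) < 0" by (rule off_cost_neg[OF * t])
      have min: "(t + h t - U \<omega>) * (t - h t - V \<omega>) \<le> (s + h s - U \<omega>) * (s - h s - V \<omega>)" for s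
        using t unfolding minimizers_def cost_curve_expand by blast
      show "T \<omega> + h (T \<omega>) \<notin> columns h"
      proof
        assume "T \<omega> + h (T \<omega>) \<in> columns h"
        then obtain p q where pq: "p < q" "p + h p = t + h t" "q + h q = t + h t"
          unfolding columns_def t_def by auto
        define s where "s = (if p = t then q else p)"
        have s: "s \<noteq> t" "s + h s = t + h t" using pq by (auto simp: s_def)
        have "t + h t - U \<omega> \<noteq> 0" using neg by auto
        then consider "t + h t - U \<omega> < 0" | "0 < t + h t - U \<omega>" by linarith
        then show False
        proof cases
          case 1
          have gt: "t + h t < t' + h t'" if "t < t'" for t'
          proof (rule ccontr)
            assume "\<not> t + h t < t' + h t'"
            then have eq: "t' + h t' = t + h t" using nonexpansive_mono_fst[OF h, of t t'] that by simp
            then have "t - h t < t' - h t'" using that by simp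
            then have "(t' + h t' - U \<omega>) * (t' - h t' - V \<omega>) < (t + h t - U \<omega>) * (t - h t - V \<omega>)"
              unfolding eq using 1 by simp
            then show False using min[of t'] by simp
          qed
          then have "column_top h t" unfolding column_top_def using s by (metis linorder_neqE order_less_irrefl)
          then show False using top by simp
        next
          case 2
          have lt: "t' + h t' < t + h t" if "t' < t" for t'
          proof (rule ccontr)
            assume "\<not> t' + h t' < t + h t"
            then have eq: "t' + h t' = t + h t" using nonexpansive_mono_fst[OF h, of t' t] that by simp
            then have "t' - h t' < t - h t" using that by simp
            then have "(t' + h t' - U \<omega>) * (t' - h t' - V \<omega>) < (t + h t - U \<omega>) * (t - h t - V \<omega>)"
              unfolding eq using 2 by simp
            then show False using min[of t'] by simp
          qed
          have st: "t < s" using s lt[of s] by (cases s t rule: linorder_cases) auto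
          have "column_top (\<lambda>t. - h (- t)) (- t)" unfolding column_top_def
          proof (intro conjI allI impI)
            show "\<exists>s<(- t). s + - h (- s) = - t + - h (- (- t))" using st s(2) by (intro exI[of _ "- s"]) auto
            fix t' assume "- t < t'"
            then show "- t + - h (- (- t)) < t' + - h (- t')" using lt[of "- t'"] by simp
          qed
          then show False using bot by simp
        qed
      qed
    qed
  qed
qed

text \<open>The direction depends on the first coordinate alone, is therefore constant on columns,
  and can be used with either sign \<sigma>. Columns of parameter length \<eta> or more are kept out
  of O', so ties of points on the curve cost at most 2 \<eta>.\<close>

lemma integral_D_open:
  assumes O: "open O'" "O' \<noteq> UNIV" and \<eta>: "0 < \<eta>" and \<sigma>: "\<bar>\<sigma>\<bar> = (1::real)"
    and disj: "\<And>t. (t + \<eta>) + h (t + \<eta>) = t + h t \<Longrightarrow> t + h t \<notin> O'"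
  shows "(\<integral>\<omega>. \<sigma> * (indicator O' (T \<omega> + h (T \<omega>)) * D \<omega>) \<partial>M) \<le> 2 * \<eta>"
proof -
  have cl: "closed (- O')" "- O' \<noteq> {}" using O by auto
  \<comment> \<open>Lipschitz approximations of the indicator of O'. The constant n + 1 dictates the
    step 1 / (n + 1) for which the moved coordinate is monotone. The complement of O' is nonempty,
    as \<open>infdist\<close> to the empty set would be 0.\<close>
  define \<psi> where "\<psi> n r = min 1 (real (Suc n) * infdist r (- O'))" for n r
  have \<psi>01: "0 \<le> \<psi> n r" "\<psi> n r \<le> 1" for n r by (auto simp: \<psi>_def infdist_nonneg)
  have \<psi>_out: "\<psi> n r = 0" if "r \<notin> O'" for n r
  proof -
    have "infdist r (- O') = 0" using in_closed_iff_infdist_zero[OF cl] that by simp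
    then show ?thesis by (simp add: \<psi>_def)
  qed
  have \<psi>_cont: "continuous_on UNIV (\<psi> n)" for n unfolding \<psi>_def by (intro continuous_intros)
  have \<psi>_lip: "\<bar>\<psi> n r - \<psi> n r'\<bar> \<le> real (Suc n) * \<bar>r - r'\<bar>" for n r r'
  proof -
    have "\<bar>\<psi> n r - \<psi> n r'\<bar> \<le> \<bar>real (Suc n) * infdist r (- O') - real (Suc n) * infdist r' (- O')\<bar>"
      unfolding \<psi>_def by linarith
    also have "\<dots> = real (Suc n) * \<bar>infdist r (- O') - infdist r' (- O')\<bar>"
      unfolding right_diff_distrib[symmetric] abs_mult by simp
    also have "\<dots> \<le> real (Suc n) * \<bar>r - r'\<bar>"
      using infdist_triangle_abs[of r "- O'" r'] by (intro mult_left_mono) (auto simp: dist_real_def)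
    finally show ?thesis .
  qed
  have \<psi>_lim: "(\<lambda>n. \<psi> n r) \<longlonglongrightarrow> indicator O' r" for r
  proof (cases "r \<in> O'")
    case True
    have "0 < infdist r (- O')"
      using in_closed_iff_infdist_zero[OF cl, of r] infdist_nonneg[of r "- O'"] True by (simp add: less_le)
    then obtain N :: nat where N: "1 / infdist r (- O') < real N" using reals_Archimedean2 by blast
    have "\<forall>\<^sub>F n in sequentially. \<psi> n r = 1"
    proof (rule eventually_sequentiallyI)
      fix n assume "N \<le> n"
      then have "1 / infdist r (- O') \<le> real (Suc n)" using N by simp
      then have "1 \<le> real (Suc n) * infdist r (- O')" using \<open>0 < infdist r (- O')\<close> by (simp add: divide_le_eq)
      then show "\<psi> n r = 1" unfolding \<psi>_def by simp
    qed
    then show ?thesis using True by (simp add: tendsto_eventually)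
  qed (simp add: \<psi>_out)
  define x where "x t = t + h t" for t
  have [measurable]: "x \<in> borel_measurable borel" unfolding x_def using h by measurable
  have [measurable]: "\<psi> n \<in> borel_measurable borel" for n by (rule borel_measurable_continuous_onI[OF \<psi>_cont])
  have [measurable]: "O' \<in> sets borel" using O(1) by simp
  define B where "B n \<omega> = (if off \<omega> then \<sigma> * \<psi> n (x (T \<omega>)) * D \<omega> else - (2 * \<eta>))" for n \<omega>
  have [measurable]: "B n \<in> borel_measurable M" for n unfolding B_def by measurable
  have bound: "norm (B n \<omega>) \<le> \<bar>D \<omega>\<bar> + 2 * \<eta>" for n \<omega>
  proof -
    have "\<bar>\<sigma> * \<psi> n (x (T \<omega>)) * D \<omega>\<bar> \<le> 1 * \<bar>D \<omega>\<bar>"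
      unfolding abs_mult using \<sigma> \<psi>01[of n "x (T \<omega>)"] by (intro mult_right_mono) auto
    then show ?thesis using \<eta> by (simp add: B_def)
  qed
  have dom: "integrable M (\<lambda>\<omega>. \<bar>D \<omega>\<bar> + 2 * \<eta>)" using integrable_D by simp
  have B_int: "integrable M (B n)" for n
    by (rule Bochner_Integration.integrable_bound[OF dom]) (use bound in \<open>auto intro: order_trans[OF _ abs_ge_self]\<close>)
  have B_le: "(\<integral>\<omega>. B n \<omega> \<partial>M) \<le> 0" for n
  proof (rule first_order_limit[where \<phi> = "\<lambda>t. \<sigma> * \<psi> n (x t)" and ?e0.0 = "1 / real (Suc n)", OF _ _ _ _ B_int])
    have "continuous_on UNIV x" unfolding x_def by (intro continuous_intros nonexpansive_continuous_on h)
    then show "continuous_on UNIV (\<lambda>t. \<sigma> * \<psi> n (x t))"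
      by (intro continuous_intros continuous_on_compose2[OF \<psi>_cont]) auto
    show "\<bar>\<sigma> * \<psi> n (x t)\<bar> \<le> 1" for t using \<sigma> \<psi>01[of n "x t"] by (simp add: abs_mult)
    show "0 < 1 / real (Suc n)" by simp
    show "mono (\<lambda>t. t + h t + 1 / real (Suc n) * (\<sigma> * \<psi> n (x t)))"
    proof (rule monoI)
      fix s t :: real assume st: "s \<le> t"
      have xs: "x s \<le> x t" unfolding x_def by (rule nonexpansive_mono_fst[OF h st])
      have "\<sigma> * \<psi> n (x s) - \<sigma> * \<psi> n (x t) \<le> \<bar>\<sigma> * (\<psi> n (x s) - \<psi> n (x t))\<bar>"
        by (simp add: right_diff_distrib)
      also have "\<dots> \<le> real (Suc n) * \<bar>x s - x t\<bar>" unfolding abs_mult \<sigma> using \<psi>_lip by simp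
      also have "\<dots> = real (Suc n) * (x t - x s)" using xs by simp
      finally have "1 / real (Suc n) * (\<sigma> * \<psi> n (x s) - \<sigma> * \<psi> n (x t)) \<le> x t - x s"
        by (simp add: divide_le_eq mult.commute)
      then show "s + h s + 1 / real (Suc n) * (\<sigma> * \<psi> n (x s)) \<le> t + h t + 1 / real (Suc n) * (\<sigma> * \<psi> n (x t))"
        unfolding right_diff_distrib x_def by linarith
    qed
    show "AE \<omega> in M. \<forall>t\<in>minimizers h (U \<omega>, V \<omega>). B n \<omega> \<le> \<sigma> * \<psi> n (x t) * (t - h t - V \<omega>)"
      using AE_T
    proof eventually_elim
      case (elim \<omega>)
      show ?case
      proof
        fix t assume t: "t \<in> minimizers h (U \<omega>, V \<omega>)"
        show "B n \<omega> \<le> \<sigma> * \<psi> n (x t) * (t - h t - V \<omega>)"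
        proof (cases "off \<omega>")
          case True
          then show ?thesis using elim t by (simp add: B_def D_def)
        next
          case False
          define \<tau> where "\<tau> = (U \<omega> + V \<omega>) / 2"
          have on: "curve h \<tau> = (U \<omega>, V \<omega>)" using on_curve[OF False] by (simp add: \<tau>_def)
          then have UV: "U \<omega> = \<tau> + h \<tau>" "V \<omega> = \<tau> - h \<tau>" by (auto simp: curve_def)
          have alt: "x t = x \<tau> \<or> t - h t = V \<omega>"
            using minimizer_of_curve_point[OF h, of t \<tau>] t on UV by (auto simp: x_def)
          show ?thesis
          proof (cases "t - h t = V \<omega> \<or> x t \<notin> O'")
            case True
            then show ?thesis using False \<psi>_out \<eta> by (auto simp: B_def)
          next
            case nz: False
            then have xt: "x t = x \<tau>" using alt by blast
            have "\<bar>t - \<tau>\<bar> < \<eta>"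
            proof (rule ccontr)
              assume far: "\<not> \<bar>t - \<tau>\<bar> < \<eta>"
              \<comment> \<open>Points of one column at parameter distance \<eta> or more would span
                a column of that length, against \<open>disj\<close>.\<close>
              define s where "s = min t \<tau>"
              have "x s = x t" using xt by (simp add: s_def min_def)
              have "x (max t \<tau>) = x t" using xt by (simp add: max_def)
              have "s \<le> s + \<eta>" "s + \<eta> \<le> max t \<tau>"
                using far \<eta> by (cases "t \<le> \<tau>"; simp add: s_def)+
              from column_between[OF h this, of "x t"] have "s + \<eta> + h (s + \<eta>) = x t"
                using \<open>x s = x t\<close> \<open>x (max t \<tau>) = x t\<close> by (simp add: x_def)
              then show False using disj[of s] \<open>x s = x t\<close> nz by (simp add: x_def)
            qed
            moreover have "t - h t - V \<omega> = 2 * (t - \<tau>)" using xt UV by (simp add: x_def)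
            ultimately have "\<bar>t - h t - V \<omega>\<bar> \<le> 2 * \<eta>" by simp
            then have "\<bar>\<sigma> * \<psi> n (x t)\<bar> * \<bar>t - h t - V \<omega>\<bar> \<le> 1 * (2 * \<eta>)"
              using \<sigma> \<psi>01[of n "x t"] by (intro mult_mono) (auto simp: abs_mult)
            then have "- (2 * \<eta>) \<le> \<sigma> * \<psi> n (x t) * (t - h t - V \<omega>)"
              unfolding abs_mult[symmetric] by linarith
            then show ?thesis using False by (simp add: B_def)
          qed
        qed
      qed
    qed
  qed
  define B0 where "B0 \<omega> = (if off \<omega> then \<sigma> * indicator O' (x (T \<omega>)) * D \<omega> else - (2 * \<eta>))" for \<omega>
  have [measurable]: "B0 \<in> borel_measurable M" unfolding B0_def by measurable
  have "(\<lambda>n. B n \<omega>) \<longlonglongrightarrow> B0 \<omega>" for \<omega>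
    unfolding B_def B0_def by (cases "off \<omega>") (auto intro!: tendsto_intros \<psi>_lim)
  then have "(\<lambda>n. \<integral>\<omega>. B n \<omega> \<partial>M) \<longlonglongrightarrow> (\<integral>\<omega>. B0 \<omega> \<partial>M)"
    by (intro integral_dominated_convergence[OF _ _ dom]) (use bound in auto)
  then have le0: "(\<integral>\<omega>. B0 \<omega> \<partial>M) \<le> 0" by (rule LIMSEQ_le_const2) (use B_le in auto)
  have int: "integrable M (\<lambda>\<omega>. \<sigma> * (indicator O' (x (T \<omega>)) * D \<omega>))"
    by (rule Bochner_Integration.integrable_bound[OF integrable_D]) (use \<sigma> in \<open>auto simp: abs_mult indicator_def\<close>)
  have B0_int: "integrable M B0"
    by (rule Bochner_Integration.integrable_bound[OF dom]) (use \<sigma> \<eta> in \<open>auto simp: B0_def abs_mult indicator_def\<close>)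
  have "(\<integral>\<omega>. \<sigma> * (indicator O' (x (T \<omega>)) * D \<omega>) - 2 * \<eta> \<partial>M) \<le> (\<integral>\<omega>. B0 \<omega> \<partial>M)"
    using \<eta> by (intro integral_mono B0_int) (use int in \<open>auto simp: B0_def D_def\<close>)
  then show ?thesis using le0 int by (simp add: x_def prob_space)
qed

end

section \<open>Construction of an equilibrium\<close>

text \<open>Preimages of singletons are unions of fibres of f. This makes a conditional expectation
  given R constant on an atom of R.\<close>

lemma measurable_vimage_algebra_fibre:
  fixes k :: "'a \<Rightarrow> 'c::t1_space"
  assumes "k \<in> vimage_algebra S f N \<rightarrow>\<^sub>M borel" "x \<in> S" "y \<in> S" "f x = f y" "f \<in> S \<rightarrow> space N"
  shows "k x = k y"
proof -
  have "k -` {k x} \<inter> S \<in> sets (vimage_algebra S f N)"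
    using measurable_sets[OF assms(1), of "{k x}"] by simp
  then obtain A where "k -` {k x} \<inter> S = f -` A \<inter> S"
    using assms(5) by (auto simp: sets_vimage_algebra2)
  then have *: "z \<in> k -` {k x} \<inter> S \<longleftrightarrow> z \<in> f -` A \<inter> S" for z by simp
  have "y \<in> k -` {k x} \<inter> S" unfolding * using *[of x] assms(2-4) by simp
  then show ?thesis by simp
qed

lemma mono_ereal_borel_measurable:
  fixes f :: "real \<Rightarrow> ereal"
  assumes "mono f" shows "f \<in> borel_measurable borel"
proof (rule borel_measurableI_le)
  fix y
  have "is_interval {r. f r \<le> y}"
    unfolding is_interval_1 using monoD[OF assms] by (blast intro: order_trans)
  then have "{r. f r \<le> y} \<in> sets borel" by (rule real_interval_borel_measurable)
  then show "{r \<in> space borel. f r \<le> y} \<in> sets borel" by simp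
qed

context dual_regular
begin

definition X1 :: "'a \<Rightarrow> real" where "X1 \<omega> = T \<omega> + h (T \<omega>)"

lemma measurable_X1 [measurable]: "X1 \<in> borel_measurable M"
  unfolding X1_def using h by measurable

text \<open>Long columns have to be removed as a closed set, and the closure must not swallow other
  abscissas. Near t0 the parameters of long columns form a compact set whose image misses t0 + h t0,
  and t0 + h t0 lies strictly between the abscissas at t0 - 1 and t0 + 1.\<close>

lemma not_column_closure:
  assumes \<eta>: "0 < \<eta>" and r: "t0 + h t0 \<notin> columns h"
  shows "t0 + h t0 \<notin> closure {t + h t | t. (t + \<eta>) + h (t + \<eta>) = t + h t}"
proof -
  define x where "x t = t + h t" for t
  have x_mono: "x s \<le> x t" if "s \<le> t" for s t unfolding x_def by (rule nonexpansive_mono_fst[OF h that])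
  have x_cont: "continuous_on A x" for A unfolding x_def by (intro continuous_intros nonexpansive_continuous_on h)
  have nc: "s = t0" if "x s = x t0" for s
    using r that unfolding columns_def x_def by (cases s t0 rule: linorder_cases) auto
  define K where "K = x ` {t \<in> {t0 - 1..t0 + 1}. x (t + \<eta>) = x t}"
  have "compact {t \<in> {t0 - 1..t0 + 1}. x (t + \<eta>) = x t}"
  proof -
    have "closed {t. x (t + \<eta>) = x t}"
      by (intro closed_Collect_eq continuous_on_compose2[OF x_cont[of UNIV]] continuous_intros x_cont) auto
    moreover have "{t \<in> {t0 - 1..t0 + 1}. x (t + \<eta>) = x t} = {t0 - 1..t0 + 1} \<inter> {t. x (t + \<eta>) = x t}" by auto
    ultimately show ?thesis by (simp add: compact_Int_closed)
  qed
  then have "compact K" unfolding K_def by (rule compact_continuous_image[OF x_cont])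
  then have "open ({x (t0 - 1)<..<x (t0 + 1)} - K)" by (intro open_Diff compact_imp_closed) auto
  moreover have "({x (t0 - 1)<..<x (t0 + 1)} - K) \<inter> {x t | t. x (t + \<eta>) = x t} = {}"
  proof -
    have "x t \<in> K" if "x (t + \<eta>) = x t" "x (t0 - 1) < x t" "x t < x (t0 + 1)" for t
    proof -
      have "t0 - 1 < t" by (rule ccontr) (use that x_mono[of t "t0 - 1"] in auto)
      moreover have "t < t0 + 1" by (rule ccontr) (use that x_mono[of "t0 + 1" t] in auto)
      ultimately show ?thesis unfolding K_def using that by (intro image_eqI[of _ _ t]) auto
    qed
    then show ?thesis by auto
  qed
  ultimately have disj: "({x (t0 - 1)<..<x (t0 + 1)} - K) \<inter> closure {x t | t. x (t + \<eta>) = x t} = {}"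
    using open_Int_closure_eq_empty by blast
  have "x (t0 - 1) \<noteq> x t0" "x (t0 + 1) \<noteq> x t0" using nc[of "t0 - 1"] nc[of "t0 + 1"] by auto
  then have "x t0 \<in> {x (t0 - 1)<..<x (t0 + 1)}" using x_mono[of "t0 - 1" t0] x_mono[of t0 "t0 + 1"] by auto
  moreover have "x t0 \<notin> K"
  proof
    assume "x t0 \<in> K"
    then obtain t where "x t = x t0" "x (t + \<eta>) = x t" by (auto simp: K_def)
    then show False using nc[of t] nc[of "t + \<eta>"] \<eta> by auto
  qed
  ultimately show ?thesis using disj unfolding x_def by blast
qed

text \<open>Almost no mass off the curve selects a column, and D is 0 on the curve, so deleting the
  closure of the long columns from the half-line leaves the integral unchanged. Then \<eta> tends to
  0, for both signs \<sigma>.\<close>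

lemma integral_D_greaterThan: "(\<integral>\<omega>. indicator {a<..} (X1 \<omega>) * D \<omega> \<partial>M) = 0"
proof -
  have bound: "\<sigma> * (\<integral>\<omega>. indicator {a<..} (X1 \<omega>) * D \<omega> \<partial>M) \<le> 2 * \<eta>"
    if \<eta>: "0 < \<eta>" and \<sigma>: "\<bar>\<sigma>\<bar> = (1::real)" for \<eta> \<sigma>
  proof -
    define C where "C = closure {t + h t | t. (t + \<eta>) + h (t + \<eta>) = t + h t}"
    define O' where "O' = {a<..} - C"
    have O: "open O'" "O' \<noteq> UNIV" unfolding O'_def C_def by auto
    have "t + h t \<notin> O'" if "(t + \<eta>) + h (t + \<eta>) = t + h t" for t
    proof -
      have "t + h t \<in> C" unfolding C_def using that by (intro subsetD[OF closure_subset]) blast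
      then show ?thesis by (simp add: O'_def)
    qed
    from integral_D_open[OF O \<eta> \<sigma> this]
    have "(\<integral>\<omega>. \<sigma> * (indicator O' (X1 \<omega>) * D \<omega>) \<partial>M) \<le> 2 * \<eta>" by (simp add: X1_def)
    moreover have "(\<integral>\<omega>. \<sigma> * (indicator O' (X1 \<omega>) * D \<omega>) \<partial>M) = (\<integral>\<omega>. \<sigma> * (indicator {a<..} (X1 \<omega>) * D \<omega>) \<partial>M)"
    proof (rule integral_cong_AE)
      have [measurable]: "O' \<in> sets borel" using O(1) by simp
      show "(\<lambda>\<omega>. \<sigma> * (indicator O' (X1 \<omega>) * D \<omega>)) \<in> borel_measurable M" by measurable
      show "AE \<omega> in M. \<sigma> * (indicator O' (X1 \<omega>) * D \<omega>) = \<sigma> * (indicator {a<..} (X1 \<omega>) * D \<omega>)"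
        using AE_off_not_column
      proof eventually_elim
        case (elim \<omega>)
        show ?case
        proof (cases "off \<omega>")
          case True
          then have "X1 \<omega> \<notin> C" using not_column_closure[OF \<eta>, of "T \<omega>"] elim by (simp add: X1_def C_def)
          then show ?thesis by (simp add: O'_def indicator_def)
        qed (simp add: D_def)
      qed
    qed measurable
    ultimately show ?thesis using \<eta> by auto
  qed
  have "\<sigma> * (\<integral>\<omega>. indicator {a<..} (X1 \<omega>) * D \<omega> \<partial>M) \<le> 0" if "\<bar>\<sigma>\<bar> = 1" for \<sigma>
    by (rule field_le_epsilon) (use bound[OF _ that, of "e / 2" for e] in auto)
  from this[of 1] this[of "-1"] show ?thesis by simp
qed

text \<open>The positive and the negative part of D, as densities, have images under X1 that agree
  on half-lines and hence on all Borel sets.\<close>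

lemma integral_D_borel:
  assumes A: "A \<in> sets borel"
  shows "(\<integral>\<omega>. indicator A (X1 \<omega>) * D \<omega> \<partial>M) = 0"
proof -
  \<comment> \<open>Since \<open>ennreal\<close> truncates at 0, the density is the positive part of
    s D; s = 1 and s = -1 give the two parts.\<close>
  define \<mu> where "\<mu> s = distr (density M (\<lambda>\<omega>. ennreal (s * D \<omega>))) borel X1" for s :: real
  have int: "integrable M (\<lambda>\<omega>. indicator A (X1 \<omega>) * max 0 (s * D \<omega>))" if "A \<in> sets borel" for s and A :: "real set"
    by (rule Bochner_Integration.integrable_bound[where f = "\<lambda>\<omega>. s * D \<omega>"])
       (use that integrable_D in \<open>auto simp: indicator_def\<close>)
  have em: "emeasure (\<mu> s) A = ennreal (\<integral>\<omega>. indicator A (X1 \<omega>) * max 0 (s * D \<omega>) \<partial>M)"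
    if [measurable]: "A \<in> sets borel" for s and A :: "real set"
  proof -
    have "emeasure (\<mu> s) A = (\<integral>\<^sup>+\<omega>. ennreal (s * D \<omega>) * indicator (X1 -` A \<inter> space M) \<omega> \<partial>M)"
      unfolding \<mu>_def by (subst emeasure_distr) (auto simp: emeasure_density)
    also have "\<dots> = (\<integral>\<^sup>+\<omega>. ennreal (indicator A (X1 \<omega>) * max 0 (s * D \<omega>)) \<partial>M)"
      by (intro nn_integral_cong) (auto simp: indicator_def ennreal_max_0)
    also have "\<dots> = ennreal (\<integral>\<omega>. indicator A (X1 \<omega>) * max 0 (s * D \<omega>) \<partial>M)"
      by (rule nn_integral_eq_integral[OF int[OF that]]) (auto simp: indicator_def)
    finally show ?thesis .
  qed
  have split: "(\<integral>\<omega>. indicator A (X1 \<omega>) * D \<omega> \<partial>M) =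
      (\<integral>\<omega>. indicator A (X1 \<omega>) * max 0 (1 * D \<omega>) \<partial>M) - (\<integral>\<omega>. indicator A (X1 \<omega>) * max 0 (- 1 * D \<omega>) \<partial>M)"
    if "A \<in> sets borel" for A :: "real set"
    unfolding Bochner_Integration.integral_diff[OF int[OF that] int[OF that], symmetric]
    by (intro Bochner_Integration.integral_cong) (auto simp: indicator_def)
  have "\<mu> 1 = \<mu> (- 1)"
  proof (rule measure_eqI_lessThan)
    fix a :: real
    show "emeasure (\<mu> 1) {a<..} < \<infinity>" by (simp add: em)
    show "emeasure (\<mu> 1) {a<..} = emeasure (\<mu> (- 1)) {a<..}"
      using split[of "{a<..}"] integral_D_greaterThan[of a] by (simp add: em)
  qed (simp_all add: \<mu>_def)
  then have "emeasure (\<mu> 1) A = emeasure (\<mu> (- 1)) A" by simp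
  then have "(\<integral>\<omega>. indicator A (X1 \<omega>) * max 0 (1 * D \<omega>) \<partial>M) = (\<integral>\<omega>. indicator A (X1 \<omega>) * max 0 (- 1 * D \<omega>) \<partial>M)"
    unfolding em[OF A] by (subst (asm) ennreal_inj) (auto intro!: integral_nonneg_AE simp: indicator_def)
  then show ?thesis using split[OF A] by simp
qed

text \<open>Off the curve the total order is the first coordinate of the optimal point; on the curve
  the insider does not trade. On a column of positive probability the price is the average
  of V, which stays in the column because almost all its mass lies on the curve.\<close>

definition R :: "'a \<Rightarrow> real" where "R \<omega> = (if off \<omega> then X1 \<omega> else U \<omega>)"

text \<open>For r in the range of the first coordinate the \<open>SOME\<close> branch is harmless:
  off the columns the curve point above r is unique, and in a column of probability 0 any point will
  do.\<close>

definition price_value :: "real \<Rightarrow> real" where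
  "price_value r = (if r \<in> columns h \<and> prob {\<omega> \<in> space M. R \<omega> = r} > 0
    then (\<integral>\<omega>. indicator {r} (R \<omega>) * V \<omega> \<partial>M) / prob {\<omega> \<in> space M. R \<omega> = r}
    else (SOME t. t + h t = r) - h (SOME t. t + h t = r))"

text \<open>Infinite prices fence off the orders that the curve does not reach: \<infinity> to the
  right of its range, -\<infinity> to the left.\<close>

definition price :: "real \<Rightarrow> ereal" where
  "price r = (if \<exists>t. t + h t = r then ereal (price_value r) else if \<forall>t. t + h t < r then \<infinity> else -\<infinity>)"

lemma measurable_R [measurable]: "R \<in> borel_measurable M"
  unfolding R_def by measurable

lemma on_curve_coords:
  assumes "\<not> off \<omega>"
  shows "U \<omega> = (U \<omega> + V \<omega>) / 2 + h ((U \<omega> + V \<omega>) / 2)" "V \<omega> = (U \<omega> + V \<omega>) / 2 - h ((U \<omega> + V \<omega>) / 2)"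
  using on_curve[OF assms] by (auto simp: curve_def)

lemma column_point:
  assumes "s + h s = r" "t + h t = r" "s - h s \<le> m" "m \<le> t - h t"
  shows "\<exists>q. q + h q = r \<and> q - h q = m"
proof -
  have "s \<le> (r + m) / 2" "(r + m) / 2 \<le> t" using assms by auto
  from column_between[OF h this assms(1,2)] have "(r + m) / 2 + h ((r + m) / 2) = r" .
  then show ?thesis by (intro exI[of _ "(r + m) / 2"]) (simp add: field_simps)
qed

lemma price_value_on_curve:
  assumes "t + h t = r"
  shows "\<exists>q. q + h q = r \<and> q - h q = price_value r"
proof (cases "r \<in> columns h \<and> prob {\<omega> \<in> space M. R \<omega> = r} > 0")
  case False
  have "(SOME t. t + h t = r) + h (SOME t. t + h t = r) = r" by (rule someI[of "\<lambda>t. t + h t = r", OF assms])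
  then show ?thesis using False by (auto simp: price_value_def)
next
  case True
  define A where "A = {\<omega> \<in> space M. R \<omega> = r}"
  have [measurable]: "A \<in> sets M" unfolding A_def by measurable
  define m where "m = price_value r"
  have ind: "indicator {r} (R \<omega>) = (indicator A \<omega> :: real)" if "\<omega> \<in> space M" for \<omega>
    using that by (auto simp: A_def indicator_def)
  have iA: "integrable M (indicator A :: 'a \<Rightarrow> real)" by (rule integrable_const_bound[where B = 1]) auto
  have iV: "integrable M (\<lambda>\<omega>. indicator A \<omega> * V \<omega>)"
    by (rule Bochner_Integration.integrable_bound[OF V1]) (auto simp: indicator_def)
  have "m = (\<integral>\<omega>. indicator {r} (R \<omega>) * V \<omega> \<partial>M) / prob A"
    using True by (simp add: m_def price_value_def A_def)
  also have "(\<integral>\<omega>. indicator {r} (R \<omega>) * V \<omega> \<partial>M) = (\<integral>\<omega>. indicator A \<omega> * V \<omega> \<partial>M)"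
    by (intro Bochner_Integration.integral_cong) (auto simp: ind)
  finally have "m * prob A = (\<integral>\<omega>. indicator A \<omega> * V \<omega> \<partial>M)" using True by (simp add: A_def)
  then have zero: "(\<integral>\<omega>. indicator A \<omega> * (V \<omega> - m) \<partial>M) = 0"
    using iA iV by (simp add: right_diff_distrib mult.commute)
  have int: "integrable M (\<lambda>\<omega>. indicator A \<omega> * (V \<omega> - m))" using iA iV by (simp add: right_diff_distrib)
  have on: "AE \<omega> in M. \<omega> \<in> A \<longrightarrow> \<not> off \<omega>"
    using AE_off_not_column by eventually_elim (use True in \<open>auto simp: A_def R_def X1_def\<close>)
  \<comment> \<open>The mean of V over the column lies between two values of V taken on the curve;
    the two signs \<sigma> give the two sides.\<close>
  have ex: "\<exists>\<omega>. \<omega> \<in> A \<and> \<not> off \<omega> \<and> \<sigma> * V \<omega> \<le> \<sigma> * m" if "\<bar>\<sigma>\<bar> = (1::real)" for \<sigma>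
  proof (rule ccontr)
    assume no: "\<not> (\<exists>\<omega>. \<omega> \<in> A \<and> \<not> off \<omega> \<and> \<sigma> * V \<omega> \<le> \<sigma> * m)"
    have gt: "AE \<omega> in M. \<omega> \<in> A \<longrightarrow> 0 < \<sigma> * (V \<omega> - m)"
      using on by eventually_elim (use no in \<open>auto simp: right_diff_distrib\<close>)
    have nn: "AE \<omega> in M. 0 \<le> \<sigma> * (indicator A \<omega> * (V \<omega> - m))"
      using gt by eventually_elim (auto simp: indicator_def)
    have "(\<integral>\<omega>. \<sigma> * (indicator A \<omega> * (V \<omega> - m)) \<partial>M) = 0" using zero by simp
    then have "AE \<omega> in M. \<sigma> * (indicator A \<omega> * (V \<omega> - m)) = 0"
      using integral_nonneg_eq_0_iff_AE[OF _ nn] int by simp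
    with gt have "AE \<omega> in M. \<omega> \<notin> A" by eventually_elim (auto simp: indicator_def)
    then have "prob A = 0" by (simp add: prob_eq_0)
    then show False using True by (simp add: A_def)
  qed
  obtain \<omega> where w: "\<omega> \<in> A" "\<not> off \<omega>" "V \<omega> \<le> m" using ex[of 1] by auto
  obtain \<omega>' where w': "\<omega>' \<in> A" "\<not> off \<omega>'" "m \<le> V \<omega>'" using ex[of "-1"] by auto
  have "U \<omega> = r" "U \<omega>' = r" using w w' by (auto simp: A_def R_def)
  then have "\<exists>q. q + h q = r \<and> q - h q = m"
    using on_curve_coords[OF w(2)] on_curve_coords[OF w'(2)] w(3) w'(3)
    by (intro column_point[of "(U \<omega> + V \<omega>) / 2" r "(U \<omega>' + V \<omega>') / 2"]) auto
  then show ?thesis by (simp add: m_def)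
qed

lemma price_value_unique:
  assumes "t + h t \<notin> columns h" shows "price_value (t + h t) = t - h t"
proof -
  obtain q where q: "q + h q = t + h t" "q - h q = price_value (t + h t)"
    using price_value_on_curve[of t] by blast
  have "q = t" using assms q(1) unfolding columns_def by (cases q t rule: linorder_cases) auto
  then show ?thesis using q(2) by simp
qed

lemma range_connected:
  assumes "s + h s \<le> r" "r \<le> t + h t" shows "\<exists>q. q + h q = r"
proof -
  have "s \<le> t \<or> s + h s = t + h t" using nonexpansive_mono_fst[OF h, of t s] assms by force
  then show ?thesis
  proof
    assume "s \<le> t"
    moreover have "continuous_on {s..t} (\<lambda>t. t + h t)" by (intro continuous_intros nonexpansive_continuous_on h)
    ultimately show ?thesis using IVT'[of "\<lambda>t. t + h t" s r t] assms by blast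
  qed (use assms in auto)
qed

lemma price_minus_infinity: "price r = -\<infinity> \<Longrightarrow> r < t + h t"
proof (rule ccontr)
  assume p: "price r = -\<infinity>" and "\<not> r < t + h t"
  then have no: "\<not> (\<exists>t. t + h t = r)" and "\<not> (\<forall>t. t + h t < r)" by (auto simp: price_def split: if_splits)
  then obtain s where "r \<le> s + h s" by (auto simp: not_less)
  then show False using range_connected[of t r s] \<open>\<not> r < t + h t\<close> no by auto
qed

lemma price_infinity: "price r = \<infinity> \<Longrightarrow> t + h t < r"
  by (auto simp: price_def split: if_splits)

text \<open>Monotonicity makes the price Borel in spite of the choices in
  \<open>price_value\<close>.\<close>

lemma mono_price: "mono price"
proof (rule monoI)
  fix r r' :: real assume "r \<le> r'"
  show "price r \<le> price r'"
  proof (cases "r = r'")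
    case False
    then have lt: "r < r'" using \<open>r \<le> r'\<close> by simp
    show ?thesis
    proof (cases "price r")
      case PInf
      then have "\<forall>t. t + h t < r'" using price_infinity[OF PInf] lt by (meson less_trans)
      then have "price r' = \<infinity>" unfolding price_def by (auto dest: spec)
      then show ?thesis by simp
    next
      case (real s)
      then obtain t where t: "t + h t = r" by (auto simp: price_def split: if_splits)
      obtain q where q: "q + h q = r" "q - h q = price_value r" using price_value_on_curve[OF t] by blast
      show ?thesis
      proof (cases "price r'")
        case MInf
        then show ?thesis using price_minus_infinity[OF MInf, of t] t lt by simp
      next
        case (real s')
        then obtain t' where t': "t' + h t' = r'" by (auto simp: price_def split: if_splits)
        obtain q' where q': "q' + h q' = r'" "q' - h q' = price_value r'" using price_value_on_curve[OF t'] by blast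
        have "q \<le> q'" using nonexpansive_mono_fst[OF h, of q' q] q(1) q'(1) lt by force
        then have "price_value r \<le> price_value r'" using nonexpansive_mono_snd[OF h, of q q'] q q' by simp
        moreover have "price r = ereal (price_value r)" "price r' = ereal (price_value r')"
          unfolding price_def using t t' by auto
        ultimately show ?thesis by simp
      qed simp
    qed simp
  qed simp
qed

lemma measurable_price [measurable]: "price \<in> borel_measurable borel"
  by (rule mono_ereal_borel_measurable[OF mono_price])

lemma R_in_range: "\<exists>t. t + h t = R \<omega>"
proof (cases "off \<omega>")
  case True then show ?thesis by (auto simp: R_def X1_def)
next
  case False
  then show ?thesis using on_curve_coords(1)[OF False] by (auto simp: R_def intro!: exI[of _ "(U \<omega> + V \<omega>) / 2"])
qed

lemma price_R: "price (R \<omega>) = ereal (price_value (R \<omega>))"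
  using R_in_range by (simp add: price_def)

lemma price_value_R: "R \<omega> \<notin> columns h \<Longrightarrow> price_value (R \<omega>) = V \<omega> + D \<omega>"
proof (cases "off \<omega>")
  case True
  assume "R \<omega> \<notin> columns h"
  then show ?thesis using True price_value_unique[of "T \<omega>"] by (simp add: R_def X1_def D_def)
next
  case False
  assume "R \<omega> \<notin> columns h"
  then show ?thesis
    using False price_value_unique[of "(U \<omega> + V \<omega>) / 2"] on_curve_coords[OF False] by (simp add: R_def D_def)
qed

lemma AE_price_optimal: "AE \<omega> in M. price_optimal price (R \<omega>) (price_value (R \<omega>)) (U \<omega>) (V \<omega>)"
  using AE_T AE_off_not_column AE_depth_finite
proof eventually_elim
  case (elim \<omega>)
  define p where "p = enn2real (depth h (U \<omega>, V \<omega>))"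
  have p0: "0 \<le> p" by (simp add: p_def)
  have lower: "- p \<le> (t + h t - U \<omega>) * (t - h t - V \<omega>)" for t
    using cost_ge_depth[OF elim(3), of t] by (simp add: p_def cost_curve_expand)
  have finite_price: "\<exists>t. t + h t = r \<and> t - h t = s" if "price r = ereal s" for r s
    using that price_value_on_curve by (auto simp: price_def split: if_splits)
  have cost: "(R \<omega> - U \<omega>) * (price_value (R \<omega>) - V \<omega>) \<le> 0 \<and>
      (\<forall>t. (R \<omega> - U \<omega>) * (price_value (R \<omega>) - V \<omega>) \<le> (t + h t - U \<omega>) * (t - h t - V \<omega>))"
  proof (cases "off \<omega>")
    case True
    then have t: "T \<omega> \<in> minimizers h (U \<omega>, V \<omega>)" using elim(1) by simp
    have "R \<omega> = T \<omega> + h (T \<omega>)" "price_value (R \<omega>) = T \<omega> - h (T \<omega>)"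
      using True elim(2) price_value_unique[of "T \<omega>"] by (simp_all add: R_def X1_def)
    then show ?thesis
      using t minimizer_nonpos[OF t] unfolding minimizers_def cost_curve_expand by simp
  next
    case False
    have "0 \<le> (t + h t - U \<omega>) * (t - h t - V \<omega>)" for t
      using cost_curve_curve_nonneg[OF h, of t "(U \<omega> + V \<omega>) / 2"] unfolding on_curve[OF False] cost_curve_expand .
    then show ?thesis using False by (simp add: R_def)
  qed
  show ?case
    unfolding price_optimal_def
  proof (intro conjI allI impI)
    show "price (R \<omega>) = ereal (price_value (R \<omega>))" by (rule price_R)
    show "(R \<omega> - U \<omega>) * (price_value (R \<omega>) - V \<omega>) \<le> 0" using cost by blast
  next
    fix r s assume "price r = ereal s"
    then show "(R \<omega> - U \<omega>) * (price_value (R \<omega>) - V \<omega>) \<le> (r - U \<omega>) * (s - V \<omega>)"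
      using finite_price cost by blast
  next
    fix r assume inf: "price r = \<infinity>"
    show "U \<omega> \<le> r"
    proof (rule ccontr)
      assume "\<not> U \<omega> \<le> r"
      then have pos: "0 < U \<omega> - r" by simp
      \<comment> \<open>The whole curve would lie to the left of r < U while its second coordinate
        is unbounded above, against finite depth. K and t are chosen so that the cost at t is at
        most -(p + 1).\<close>
      define K where "K = (p + 1) / (U \<omega> - r)"
      have K: "0 < K" "(U \<omega> - r) * K = p + 1" using pos p0 by (auto simp: K_def)
      define t where "t = (K + V \<omega> + r) / 2"
      have xt: "t + h t < r" by (rule price_infinity[OF inf])
      then have "K \<le> t - h t - V \<omega>" by (simp add: t_def field_simps)
      then have "(U \<omega> - r) * K \<le> (U \<omega> - (t + h t)) * (t - h t - V \<omega>)"
        using xt pos K by (intro mult_mono) auto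
      then show False using lower[of t] K(2) by (simp add: algebra_simps)
    qed
  next
    fix r assume inf: "price r = -\<infinity>"
    show "r \<le> U \<omega>"
    proof (rule ccontr)
      assume "\<not> r \<le> U \<omega>"
      then have pos: "0 < r - U \<omega>" by simp
      define K where "K = (p + 1) / (r - U \<omega>)"
      have K: "0 < K" "(r - U \<omega>) * K = p + 1" using pos p0 by (auto simp: K_def)
      define t where "t = (r + V \<omega> - K) / 2"
      have xt: "r < t + h t" by (rule price_minus_infinity[OF inf])
      then have "K \<le> V \<omega> - (t - h t)" by (simp add: t_def field_simps)
      then have "(r - U \<omega>) * K \<le> (t + h t - U \<omega>) * (V \<omega> - (t - h t))"
        using xt pos K by (intro mult_mono) auto
      then show False using lower[of t] K(2) by (simp add: algebra_simps)
    qed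
  qed
qed

text \<open>Off the columns the price is V + D, and \<open>integral_D_borel\<close> removes D from
  integrals over events of R. The columns are countably many; on one of positive probability the
  conditional expectation is constant and equals the average of V.\<close>

lemma AE_price_cond_exp:
  "AE \<omega> in M. price_value (R \<omega>) = real_cond_exp M (vimage_algebra (space M) R borel) V \<omega>"
proof -
  let ?F = "vimage_algebra (space M) R borel"
  interpret S: finite_measure_subalgebra M ?F by (rule finite_measure_subalgebra_vimage) measurable
  define C where "C = columns h"
  have C: "countable C" unfolding C_def by (rule countable_columns[OF h])
  then have [measurable]: "C \<in> sets borel" by (rule sets.countable[rotated]) simp
  define g where "g r = indicator (- C) r * real_of_ereal (price r)" for r
  have [measurable]: "g \<in> borel_measurable borel" unfolding g_def by measurable
  have gR: "g (R \<omega>) = indicator (- C) (R \<omega>) * (V \<omega> + D \<omega>)" for \<omega>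
    using price_value_R[of \<omega>] by (cases "R \<omega> \<in> C") (simp_all add: g_def price_R C_def)
  have iVD: "integrable M (\<lambda>\<omega>. V \<omega> + D \<omega>)" using V1 integrable_D by simp
  have ig: "integrable M (\<lambda>\<omega>. g (R \<omega>))"
    unfolding gR by (rule Bochner_Integration.integrable_bound[OF iVD]) (auto simp: indicator_def)
  have iW: "integrable M (\<lambda>\<omega>. indicator (- C) (R \<omega>) * V \<omega>)"
    by (rule Bochner_Integration.integrable_bound[OF V1]) (auto simp: indicator_def)
  have "AE \<omega> in M. real_cond_exp M ?F (\<lambda>\<omega>. indicator (- C) (R \<omega>) * V \<omega>) \<omega> = g (R \<omega>)"
  proof (subst cond_exp_vimage_iff[OF measurable_R \<open>g \<in> borel_measurable borel\<close> iW ig], intro ballI)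
    fix A :: "real set" assume [measurable]: "A \<in> sets borel"
    have iA: "integrable M (\<lambda>\<omega>. indicator (A \<inter> - C) (R \<omega>) * f \<omega>)" if "integrable M f" for f :: "'a \<Rightarrow> real"
      by (rule Bochner_Integration.integrable_bound[OF that]) (use that in \<open>auto simp: indicator_def\<close>)
    have DR: "indicator (A \<inter> - C) (R \<omega>) * D \<omega> = indicator (A \<inter> - C) (X1 \<omega>) * D \<omega>" for \<omega>
      by (simp add: R_def D_def)
    have "(\<integral>\<omega>. indicator A (R \<omega>) * g (R \<omega>) \<partial>M)
        = (\<integral>\<omega>. indicator (A \<inter> - C) (R \<omega>) * V \<omega> + indicator (A \<inter> - C) (R \<omega>) * D \<omega> \<partial>M)"
      unfolding gR by (intro Bochner_Integration.integral_cong) (auto simp: indicator_def)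
    also have "\<dots> = (\<integral>\<omega>. indicator (A \<inter> - C) (R \<omega>) * V \<omega> \<partial>M) + (\<integral>\<omega>. indicator (A \<inter> - C) (R \<omega>) * D \<omega> \<partial>M)"
      by (rule Bochner_Integration.integral_add[OF iA[OF V1] iA[OF integrable_D]])
    also have "(\<integral>\<omega>. indicator (A \<inter> - C) (R \<omega>) * D \<omega> \<partial>M) = 0"
      unfolding DR by (rule integral_D_borel) measurable
    also have "(\<integral>\<omega>. indicator (A \<inter> - C) (R \<omega>) * V \<omega> \<partial>M) = (\<integral>\<omega>. indicator A (R \<omega>) * (indicator (- C) (R \<omega>) * V \<omega>) \<partial>M)"
      by (intro Bochner_Integration.integral_cong) (auto simp: indicator_def)
    finally show "(\<integral>\<omega>. indicator A (R \<omega>) * (indicator (- C) (R \<omega>) * V \<omega>) \<partial>M) = (\<integral>\<omega>. indicator A (R \<omega>) * g (R \<omega>) \<partial>M)"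
      by simp
  qed
  moreover have "AE \<omega> in M. real_cond_exp M ?F (\<lambda>\<omega>. indicator (- C) (R \<omega>) * V \<omega>) \<omega>
      = indicator (- C) (R \<omega>) * real_cond_exp M ?F V \<omega>"
    by (rule S.real_cond_exp_mult[OF _ V iW])
       (rule measurable_vimage_algebra_compose[of R M borel "indicator (- C)"], measurable)
  ultimately have off_C: "AE \<omega> in M. R \<omega> \<notin> C \<longrightarrow> price_value (R \<omega>) = real_cond_exp M ?F V \<omega>"
    by eventually_elim (auto simp: g_def price_R indicator_def)
  have "AE \<omega> in M. \<forall>r\<in>C. R \<omega> = r \<longrightarrow> price_value r = real_cond_exp M ?F V \<omega>"
  proof (subst AE_ball_countable[OF C], intro ballI)
    fix r assume r: "r \<in> C"
    define A where "A = {\<omega> \<in> space M. R \<omega> = r}"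
    have [measurable]: "A \<in> sets M" unfolding A_def by measurable
    show "AE \<omega> in M. R \<omega> = r \<longrightarrow> price_value r = real_cond_exp M ?F V \<omega>"
    proof (cases "prob A = 0")
      case True
      then have "AE \<omega> in M. \<omega> \<notin> A" by (simp add: prob_eq_0)
      then show ?thesis using AE_space by eventually_elim (auto simp: A_def)
    next
      case False
      then have pos: "0 < prob A" by (simp add: zero_less_measure_iff)
      then have "A \<noteq> {}" by auto
      then obtain \<omega>0 where w0: "\<omega>0 \<in> A" by blast
      define c where "c = real_cond_exp M ?F V \<omega>0"
      have const: "real_cond_exp M ?F V \<omega> = c" if "\<omega> \<in> A" for \<omega>
      proof -
        have "\<omega> \<in> space M" "\<omega>0 \<in> space M" "R \<omega> = R \<omega>0" using that w0 by (simp_all add: A_def)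
        moreover have "R \<in> space M \<rightarrow> space borel" by simp
        ultimately show ?thesis
          unfolding c_def by (rule measurable_vimage_algebra_fibre[OF borel_measurable_cond_exp])
      qed
      have ind: "indicator {r} (R \<omega>) = (indicator A \<omega> :: real)" if "\<omega> \<in> space M" for \<omega>
        using that by (auto simp: A_def indicator_def)
      have i: "integrable M (\<lambda>\<omega>. indicator {r} (R \<omega>) * V \<omega>)"
        by (rule Bochner_Integration.integrable_bound[OF V1]) (auto simp: indicator_def)
      have "(\<integral>\<omega>. indicator {r} (R \<omega>) * V \<omega> \<partial>M) = (\<integral>\<omega>. indicator {r} (R \<omega>) * real_cond_exp M ?F V \<omega> \<partial>M)"
        by (rule S.real_cond_exp_intg(2)[symmetric, OF i measurable_vimage_algebra_compose[OF measurable_R] V]) simp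
      also have "\<dots> = (\<integral>\<omega>. indicator A \<omega> * c \<partial>M)"
        by (intro Bochner_Integration.integral_cong) (auto simp: A_def const indicator_def)
      also have "\<dots> = c * prob A" by simp
      finally have "price_value r = c" using r pos by (simp add: price_value_def A_def C_def)
      show ?thesis
      proof (intro AE_I2 impI)
        fix \<omega> assume "\<omega> \<in> space M" "R \<omega> = r"
        then have "\<omega> \<in> A" by (simp add: A_def)
        then show "price_value r = real_cond_exp M ?F V \<omega>" using const \<open>price_value r = c\<close> by simp
      qed
    qed
  qed
  with off_C show ?thesis by eventually_elim auto
qed

lemma equilibrium_exists: "equilibrium M U V (\<lambda>\<omega>. R \<omega> - U \<omega>) price"
proof -
  \<comment> \<open>The insider's order as an explicit Borel function of (U, V), which yields the
    measurability demanded of a trading strategy.\<close>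
  define \<rho> where "\<rho> y = (if h ((fst y + snd y) / 2) \<noteq> (fst y - snd y) / 2
    then the_minimizer h y + h (the_minimizer h y) - fst y else 0)" for y :: "real \<times> real"
  have [measurable]: "h \<in> borel_measurable borel" "the_minimizer h \<in> borel_measurable borel"
    by (rule borel_measurable_nonexpansive[OF h], rule borel_measurable_the_minimizer[OF h])
  have m1: "(\<lambda>y :: real \<times> real. h ((fst y + snd y) / 2)) \<in> borel_measurable borel" by measurable
  have m2: "(\<lambda>y :: real \<times> real. (fst y - snd y) / 2) \<in> borel_measurable borel" by measurable
  have m3: "(\<lambda>y. the_minimizer h y + h (the_minimizer h y) - fst y) \<in> borel_measurable borel" by measurable
  have \<rho>: "\<rho> \<in> borel_measurable borel"
    unfolding \<rho>_def by (intro measurable_If[OF m3 _ borel_measurable_neq[OF m1 m2]]) simp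
  have Y: "(\<lambda>\<omega>. (U \<omega>, V \<omega>)) \<in> M \<rightarrow>\<^sub>M borel" by measurable
  have eq: "(\<lambda>\<omega>. R \<omega> - U \<omega>) = (\<lambda>\<omega>. \<rho> (U \<omega>, V \<omega>))"
    by (auto simp: \<rho>_def R_def off_def X1_def T_def)
  have "trading_strategy M U V (\<lambda>\<omega>. R \<omega> - U \<omega>)"
    unfolding trading_strategy_def eq by (rule measurable_vimage_algebra_compose[OF Y \<rho>])
  moreover have "AE \<omega> in M. price (R \<omega>) = ereal (real_cond_exp M (vimage_algebra (space M) R borel) V \<omega>)"
    using AE_price_cond_exp by eventually_elim (simp add: price_R)
  moreover have "AE \<omega> in M. \<forall>q::real. ereal q * (ereal (V \<omega>) - price (q + U \<omega>))
      \<le> ereal (R \<omega> - U \<omega>) * (ereal (V \<omega>) - price (R \<omega>))"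
    using AE_price_optimal unfolding price_optimal_iff price_R by eventually_elim blast
  ultimately show ?thesis
    unfolding equilibrium_def pricing_rule_def by (simp add: measurable_price)
qed

end

theorem theorem7:
  fixes M :: "'a measure" and U V :: "'a \<Rightarrow> real"
  assumes "prob_space M"
    and "U \<in> borel_measurable M" and "V \<in> borel_measurable M"
    and "integrable M (\<lambda>\<omega>. (U \<omega>)\<^sup>2)" and "integrable M (\<lambda>\<omega>. (V \<omega>)\<^sup>2)"
    and "D_regular (distr M borel (\<lambda>\<omega>. (U \<omega>, V \<omega>)))"
  shows "(\<exists>Q f. equilibrium M U V Q f) \<and>
    (atomless_law M U \<and> atomless_law M V \<longrightarrow>
      (\<forall>Q f Q' f'. equilibrium M U V Q f \<and> equilibrium M U V Q' f' \<longrightarrow>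
          (AE \<omega> in M. Q \<omega> = Q' \<omega>) \<and>
          (AE \<omega> in M. Q \<omega> + U \<omega> = Q' \<omega> + U \<omega>) \<and>
          (AE \<omega> in M. f (Q \<omega> + U \<omega>) = f' (Q' \<omega> + U \<omega>))) \<and>
      (\<forall>Q f. equilibrium M U V Q f \<longrightarrow>
        (let X = (\<lambda>\<omega>. (Q \<omega> + U \<omega>, real_of_ereal (f (Q \<omega> + U \<omega>))));
             \<gamma> = distr M borel (\<lambda>\<omega>. (X \<omega>, (U \<omega>, V \<omega>)));
             \<nu> = distr M borel (\<lambda>\<omega>. (U \<omega>, V \<omega>))
         in X \<in> admissible_maps M U V \<and>
            (\<forall>X'\<in>admissible_maps M U V.
               (\<integral>\<omega>. cost (X \<omega>) (U \<omega>, V \<omega>) \<partial>M) \<le> (\<integral>\<omega>. cost (X' \<omega>) (U \<omega>, V \<omega>) \<partial>M)) \<and>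
            (\<forall>X'\<in>admissible_maps M U V.
               (\<forall>X''\<in>admissible_maps M U V.
                  (\<integral>\<omega>. cost (X' \<omega>) (U \<omega>, V \<omega>) \<partial>M) \<le> (\<integral>\<omega>. cost (X'' \<omega>) (U \<omega>, V \<omega>) \<partial>M))
               \<longrightarrow> (AE \<omega> in M. X' \<omega> = X \<omega>)) \<and>
            \<gamma> \<in> Gamma \<nu> \<and>
            (\<forall>\<gamma>'\<in>Gamma \<nu>. (\<integral>p. cost (fst p) (snd p) \<partial>\<gamma>) \<le> (\<integral>p. cost (fst p) (snd p) \<partial>\<gamma>')) \<and>
            (\<forall>\<gamma>'\<in>Gamma \<nu>.
               (\<forall>\<gamma>''\<in>Gamma \<nu>. (\<integral>p. cost (fst p) (snd p) \<partial>\<gamma>') \<le> (\<integral>p. cost (fst p) (snd p) \<partial>\<gamma>''))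
               \<longrightarrow> \<gamma>' = \<gamma>))))"
proof -
  interpret prob_space M by (rule assms(1))
  note UV = assms(2-6)
  have ex: "\<exists>Q f. equilibrium M U V Q f"
  proof -
    obtain h where h: "nonexpansive h" "dual_value M U V h < \<infinity>"
      "\<And>k. nonexpansive k \<Longrightarrow> dual_value M U V h \<le> dual_value M U V k"
      by (rule dual_minimizer_exists[OF assms(2-5)]) blast
    interpret O: dual_optimal M U V h
      by (intro dual_optimal.intro dual_optimal_axioms.intro assms h)
    interpret R: dual_regular M U V h by (rule O.dual_regular_of_D_regular[OF assms(6)])
    show ?thesis using R.equilibrium_exists by blast
  qed
  have uniq: "(AE \<omega> in M. Q \<omega> = Q' \<omega>) \<and> (AE \<omega> in M. Q \<omega> + U \<omega> = Q' \<omega> + U \<omega>) \<and>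
      (AE \<omega> in M. f (Q \<omega> + U \<omega>) = f' (Q' \<omega> + U \<omega>))"
    if "atomless_law M U" "atomless_law M V" "equilibrium M U V Q f" "equilibrium M U V Q' f'" for Q f Q' f'
  proof -
    have ae: "AE \<omega> in M. Q \<omega> = Q' \<omega> \<and> f (Q \<omega> + U \<omega>) = f' (Q' \<omega> + U \<omega>)"
      by (rule equilibrium_unique[OF UV that])
    have "AE \<omega> in M. Q \<omega> = Q' \<omega>" using ae by eventually_elim simp
    moreover have "AE \<omega> in M. Q \<omega> + U \<omega> = Q' \<omega> + U \<omega>" using ae by eventually_elim simp
    moreover have "AE \<omega> in M. f (Q \<omega> + U \<omega>) = f' (Q' \<omega> + U \<omega>)" using ae by eventually_elim (rule conjunct2)
    ultimately show ?thesis by (intro conjI)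
  qed
  show ?thesis
    unfolding Let_def
  proof (intro conjI[OF ex] impI, elim conjE, intro conjI allI impI, goal_cases)
    case (1 Q f Q' f')
    then show ?case by (elim conjE) (rule uniq[THEN conjunct1])
  next
    case (2 Q f Q' f')
    then show ?case by (elim conjE) (rule uniq[THEN conjunct2, THEN conjunct1])
  next
    case (3 Q f Q' f')
    then show ?case by (elim conjE) (rule uniq[THEN conjunct2, THEN conjunct2])
  next
    case (4 Q f)
    then show ?case by (rule equilibrium_unique_optimal(1)[OF UV])
  next
    case (5 Q f)
    then show ?case by (rule equilibrium_unique_optimal(2)[OF UV])
  next
    case (6 Q f)
    then show ?case by (rule equilibrium_unique_optimal(3)[OF UV])
  next
    case (7 Q f)
    then show ?case by (rule equilibrium_unique_optimal(4)[OF UV])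
  next
    case (8 Q f)
    then show ?case by (rule equilibrium_unique_optimal(5)[OF UV])
  next
    case (9 Q f)
    then show ?case by (rule equilibrium_unique_optimal(6)[OF UV])
  qed
qed

end
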